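(* Let $a,b,c$ be real numbers with $0<a<1$, $a\le c$ and $0\le b\le c$, and put $$M(z)=\frac{c-2+(1-a)(1-b)z}{(1-z)\left(1-a+a\,\dfrac{{}_2F_1(a+1,b;c;z)}{{}_2F_1(a,b;c;z)}\right)}.$$ Then: (1) If $1-b>0$ and $c-2+(1-a)(1-b)\ge 0$, then $$\kappa\bigl(z\,{}_2F_1(a,b;c;z)\bigr)=\frac{5-c-a-b}{2}+M(-1).$$ (2) If $1-b<0$ and $c-2+(1-a)(1-b)\le 0$, then $$\kappa\bigl(z\,{}_2F_1(a,b;c;z)\bigr)=\frac{5-c-a-b}{2}+M(1),$$ where $M(1)$ denotes the (unrestricted) limit of $M(z)$ as $z\to1$ in $\mathbb D$.
   Context: $\mathbb D=\{z\in\mathbb C:|z|<1\}$. For real $a,b,c$ with $c\ne 0,-1,-2,\dots$, ${}_2F_1(a,b;c;z)=\sum_{n=0}^\infty \frac{(a)_n(b)_n}{(c)_n n!}z^n$ for $z\in\mathbb D$, where $(a)_0=1$ and $(a)_n=a(a+1)\cdots(a+n-1)$; values at $z=-1$ are those of its analytic continuation to $\mathbb C\setminus[1,+\infty)$. For $f$ analytic in $\mathbb D$ with $f(0)=0$, $f'(0)=1$, the order of convexity of $f$ is $\kappa(f)=1+\inf_{z\in\mathbb D}\operatorname{Re}\frac{zf''(z)}{f'(z)}\in[-\infty,1]$; it is regarded as not defined if $f'$ has zeros in $\mathbb D$. The limit $M(1)$ is understood in the extended sense: if $M(z)\to\infty$ as $z\to1$ in $\mathbb D$, then $M(1)$ is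 the extended real value approached along real $z\to1^-$ (note $M$ is real on $(-1,1)$), and the equality in (2) is an equality in $[-\infty,1]$. *)

theory Defs
  imports "HOL-Analysis.Analysis"
begin

definition hyp2F1_series :: "real \<Rightarrow> real \<Rightarrow> real \<Rightarrow> complex \<Rightarrow> complex" where
  "hyp2F1_series a b c z =
     eval_fps (fps_hypergeo [complex_of_real a, complex_of_real b] [complex_of_real c] 1) z"

lemma hyp2F1_series_altdef:
  "hyp2F1_series a b c z =
     (\<Sum>n. of_real (pochhammer a n * pochhammer b n / (pochhammer c n * fact n)) * z ^ n)"
  by (simp add: hyp2F1_series_def eval_fps_def pochhammer_of_real)

(* For c not in {0, -1, -2, ...} the series has an analytic continuation to the slit plane.
   It is unique there, so the choice operator only leaves the values on the cut [1, \<infinity>)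
   undetermined, and these are never used. *)
definition hyp2F1 :: "real \<Rightarrow> real \<Rightarrow> real \<Rightarrow> complex \<Rightarrow> complex" where
  "hyp2F1 a b c = (SOME F. F holomorphic_on (- complex_of_real ` {1..}) \<and>
                           (\<forall>z\<in>ball 0 1. F z = hyp2F1_series a b c z))"

(* A relation rather than a function, since the order of convexity is not defined when
   deriv f has zeros in the disc. The infimum is taken in ereal, so it may be -\<infinity>. *)
definition has_order_of_convexity :: "(complex \<Rightarrow> complex) \<Rightarrow> ereal \<Rightarrow> bool" where
  "has_order_of_convexity f \<kappa> \<longleftrightarrow>
     f holomorphic_on ball 0 1 \<and> f 0 = 0 \<and> deriv f 0 = 1 \<and>
     (\<forall>z\<in>ball 0 1. deriv f z \<noteq> 0) \<and>
     \<kappa> = 1 + (INF z\<in>ball 0 1. ereal (Re (z * deriv (deriv f) z / deriv f z)))"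

definition M_fun :: "real \<Rightarrow> real \<Rightarrow> real \<Rightarrow> complex \<Rightarrow> complex" where
  "M_fun a b c z =
     (of_real (c - 2) + of_real ((1 - a) * (1 - b)) * z) /
     ((1 - z) * (of_real (1 - a) + of_real a * (hyp2F1 (a + 1) b c z / hyp2F1 a b c z)))"

(* The unrestricted limit of g(z) as z \<rightarrow> 1 in the unit disc is either the finite real number m,
   or infinite in modulus, in which case m is the infinite value approached along real z \<rightarrow> 1-. *)
definition has_ext_limit_at_one :: "(complex \<Rightarrow> complex) \<Rightarrow> ereal \<Rightarrow> bool" where
  "has_ext_limit_at_one g m \<longleftrightarrow>
     (\<exists>r. m = ereal r \<and> (g \<longlongrightarrow> complex_of_real r) (at 1 within ball 0 1)) \<or>
     (\<bar>m\<bar> = \<infinity> \<and> filterlim g at_infinity (at 1 within ball 0 1) \<and>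
      ((\<lambda>x. ereal (Re (g (complex_of_real x)))) \<longlongrightarrow> m) (at_left 1))"

end

theory Submission
  imports Defs "HOL-Complex_Analysis.Complex_Analysis" "HOL-Real_Asymp.Real_Asymp"
begin

text \<open>
  Write \<open>F = F(a,b;c;z)\<close>, \<open>w = F(a+1,b;c;z) / F(a,b;c;z)\<close> and \<open>D = 1 - a + a w\<close>. Since
  \<open>z F' = a (F(a+1,b;c;z) - F)\<close>, the function \<open>f = z F\<close> has \<open>f' = F D\<close>, and the hypergeometric
  differential equation turns \<open>1 + z f''/f'\<close> into
  \<open>2 - a - b + (a b - k)/(1 - z) + k h - (1-a)(1-b)(1-z) h\<close>, where \<open>h = 1/((1-z) D)\<close> and
  \<open>k = c - 2 + (1-a)(1-b)\<close>; the last two terms are \<open>M\<close>. So everything is decided by how the real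
  parts of \<open>h\<close> and \<open>(1-z) h\<close> behave on the unit disc.

  The point is that \<open>h\<close> is a mixture of the functions \<open>1/(1 - t z)\<close>, \<open>0 \<le> t \<le> 1\<close>. The class of
  these mixtures is described by H. S. Wall's criterion: \<open>f\<close> is analytic off \<open>[1,\<infinity>)\<close>, \<open>f(0) = 1\<close>, \<open>f\<close> is real
  on the real axis, and \<open>sqrt(1-z) f\<close> has positive real part. In this form it is obvious that the
  class is closed under \<open>f \<mapsto> 1 - a + a f\<close> and under \<open>f \<mapsto> 1/((1-z) f)\<close>, so that \<open>w\<close> in the class
  gives \<open>h\<close> in the class. In the variable \<open>u\<close> with \<open>z = 4u/(1+u)\<^sup>2\<close> the criterion asks for a function
  of positive real part on the disc, and Poisson's formula yields
  \<open>wall_class_positive_functional\<close>: an inequality between real linear combinations of values that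
  holds for every \<open>1/(1 - t z)\<close> holds for the whole class. No representing measure is ever
  constructed; each estimate on \<open>h\<close> is an elementary inequality in \<open>t\<close>.

  That \<open>w\<close> is in the class is Gauss' continued fraction. In the variable \<open>u\<close>, and after a Cayley transform, one
  step of the continued fraction is one step of Schur's algorithm with parameter
  \<open>1 - 2 b/c \<in> [-1,1]\<close>. A formal power series with an infinite Schur expansion of this kind is
  analytic on the disc and bounded by one there (\<open>schur_algorithm_converges\<close>), because its
  coefficients are eventually those of the finite truncations; this replaces any discussion of the
  convergence of the continued fraction. The class then also yields the analytic continuation of
  \<open>F\<close> to the slit plane, as \<open>F\<close> is the exponential of a primitive of \<open>a (w - 1)/z\<close>.

  If \<open>b < 1\<close> and \<open>k \<ge> 0\<close>, all terms have their least real part at \<open>z = -1\<close>. This is plain for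
  \<open>-(1-z) h\<close> and for \<open>h\<close>; the coefficient \<open>a b - k\<close> of \<open>1/(1-z)\<close> may be negative, but then \<open>h\<close> contains
  \<open>1/(1-z)\<close> with weight at least \<open>(k - a b)/k\<close>, which compensates exactly
  (\<open>wall_class_atom_bound\<close>). If \<open>b > 1\<close> and \<open>k \<le> 0\<close>, then \<open>a b - k > 0\<close> and \<open>M\<close> has its infimum
  at \<open>z = 1\<close>, while the real part of \<open>1/(1-z)\<close> is above \<open>1/2\<close> and tends to \<open>1/2\<close> along suitable sequences tending to
  \<open>1\<close>. Here \<open>D\<close> is unbounded near \<open>1\<close>, so \<open>h\<close> has no mass at \<open>t = 1\<close>, and this makes its unrestricted
  limit at \<open>1\<close> exist, finite or with real part tending to infinity.
\<close>

section \<open>The slit plane\<close>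

definition slit_plane :: "complex set" where
  "slit_plane = - complex_of_real ` {1..}"

lemma slit_plane_iff: "z \<in> slit_plane \<longleftrightarrow> 1 - z \<notin> \<real>\<^sub>\<le>\<^sub>0"
proof
  assume z: "z \<in> slit_plane"
  show "1 - z \<notin> \<real>\<^sub>\<le>\<^sub>0"
  proof
    assume "1 - z \<in> \<real>\<^sub>\<le>\<^sub>0"
    then obtain x where "x \<le> 0" "1 - z = of_real x" by (auto elim: nonpos_Reals_cases)
    hence "z = of_real (1 - x)" "1 \<le> 1 - x" by (auto simp: algebra_simps)
    thus False using z unfolding slit_plane_def by blast
  qed
next
  assume *: "1 - z \<notin> \<real>\<^sub>\<le>\<^sub>0"
  show "z \<in> slit_plane" unfolding slit_plane_def
  proof
    assume "z \<in> complex_of_real ` {1..}"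
    then obtain x where "x \<ge> 1" "z = of_real x" by auto
    hence "1 - z = of_real (1 - x)" "1 - x \<le> 0" by auto
    thus False using * by (metis nonpos_Reals_of_real_iff)
  qed
qed

lemma open_slit_plane: "open slit_plane"
proof -
  have "slit_plane = (\<lambda>z. 1 - z) -` (- \<real>\<^sub>\<le>\<^sub>0)" by (auto simp: slit_plane_iff)
  moreover have "open ((\<lambda>z::complex. 1 - z) -` (- \<real>\<^sub>\<le>\<^sub>0))"
    by (intro open_vimage open_Compl closed_nonpos_Reals_complex continuous_intros)
  ultimately show ?thesis by simp
qed

lemma of_real_mem_slit_plane [simp]: "complex_of_real x \<in> slit_plane \<longleftrightarrow> x < 1"
  by (auto simp: slit_plane_def)

lemma mem_slit_plane_simps [simp]: "0 \<in> slit_plane" "- 1 \<in> slit_plane" "1 \<notin> slit_plane"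
  using of_real_mem_slit_plane[of 0] of_real_mem_slit_plane[of "-1"] of_real_mem_slit_plane[of 1]
  by (simp_all del: of_real_mem_slit_plane)

lemma ball_subset_slit_plane: "ball 0 1 \<subseteq> slit_plane"
  by (auto simp: slit_plane_def)

lemma starlike_slit_plane: "starlike slit_plane"
proof -
  have "closed_segment 0 z \<subseteq> slit_plane" if z: "z \<in> slit_plane" for z
  proof
    fix w assume "w \<in> closed_segment 0 z"
    then obtain u where u: "0 \<le> u" "u \<le> 1" "w = of_real u * z"
      by (auto simp: closed_segment_def scaleR_conv_of_real)
    show "w \<in> slit_plane" unfolding slit_plane_def
    proof
      assume "w \<in> complex_of_real ` {1..}"
      then obtain x where x: "x \<ge> 1" "of_real u * z = of_real x" using u by auto
      hence "u \<noteq> 0" by auto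
      hence "z = of_real (x / u)" using x by (simp add: field_simps)
      moreover have "x / u \<ge> 1" using x u \<open>u \<noteq> 0\<close> by (simp add: field_simps)
      ultimately show False using z unfolding slit_plane_def by blast
    qed
  qed
  thus ?thesis unfolding starlike_def by (intro bexI[of _ 0]) auto
qed

lemma connected_slit_plane: "connected slit_plane"
  using starlike_slit_plane by (simp add: starlike_imp_connected)

lemma Re_csqrt_slit_plane: "z \<in> slit_plane \<Longrightarrow> Re (csqrt (1 - z)) > 0"
  using csqrt_principal[of "1 - z"] 
proof (elim disjE conjE)
  assume z: "z \<in> slit_plane" and r: "Re (csqrt (1 - z)) = 0"
  have "1 - z = (csqrt (1 - z))\<^sup>2" by simp
  also have "\<dots> = of_real (- (Im (csqrt (1 - z)))\<^sup>2)"
    using r by (auto simp: complex_eq_iff power2_eq_square simp del: power2_csqrt csqrt.simps)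
  also have "\<dots> \<in> \<real>\<^sub>\<le>\<^sub>0" by (subst nonpos_Reals_of_real_iff) auto
  finally show ?thesis using z by (simp add: slit_plane_iff)
qed auto

lemma csqrt_one_minus_holomorphic: "(\<lambda>z. csqrt (1 - z)) holomorphic_on slit_plane"
  by (intro holomorphic_intros) (auto simp: slit_plane_iff)

section \<open>Wall's class of functions\<close>

text \<open>This is the class of functions \<open>\<integral> d\<mu>(t) / (1 - t z)\<close> with a probability measure \<open>\<mu>\<close> on \<open>[0,1]\<close>,
  written without the measure. The condition on the square root is stable under pointwise operations
  and is what the continued fraction produces.\<close>
definition wall_class :: "(complex \<Rightarrow> complex) set" where
  "wall_class = {f. f holomorphic_on slit_plane \<and> f 0 = 1 \<and>
     (\<forall>z\<in>slit_plane. f (cnj z) = cnj (f z)) \<and>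
     (\<forall>z\<in>slit_plane. Re (csqrt (1 - z) * f z) > 0)}"

lemma wall_class_holomorphic: "f \<in> wall_class \<Longrightarrow> f holomorphic_on slit_plane"
  and wall_class_0: "f \<in> wall_class \<Longrightarrow> f 0 = 1"
  and wall_class_cnj: "f \<in> wall_class \<Longrightarrow> z \<in> slit_plane \<Longrightarrow> f (cnj z) = cnj (f z)"
  and wall_class_Re_pos: "f \<in> wall_class \<Longrightarrow> z \<in> slit_plane \<Longrightarrow> Re (csqrt (1 - z) * f z) > 0"
  by (auto simp: wall_class_def)

lemma wall_class_nonzero: "f \<in> wall_class \<Longrightarrow> z \<in> slit_plane \<Longrightarrow> f z \<noteq> 0"
  using wall_class_Re_pos[of f z] by auto

lemma wall_class_convex_one:
  assumes "f \<in> wall_class" "0 \<le> a" "a \<le> 1"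
  shows "(\<lambda>z. of_real (1 - a) + of_real a * f z) \<in> wall_class"
proof -
  have "Re (csqrt (1 - z) * (of_real (1 - a) + of_real a * f z)) > 0" if "z \<in> slit_plane" for z
  proof -
    let ?s = "csqrt (1 - z)"
    have s: "Re ?s > 0" "Re (?s * f z) > 0"
      using Re_csqrt_slit_plane[OF that] wall_class_Re_pos[OF assms(1) that] by auto
    have "Re (?s * (of_real (1 - a) + of_real a * f z)) = (1 - a) * Re ?s + a * Re (?s * f z)"
      by (simp add: algebra_simps del: csqrt.simps)
    also have "\<dots> > 0"
    proof (cases "a = 0")
      case False
      have "a * Re (?s * f z) > 0" using False assms s(2) by (intro mult_pos_pos) auto
      moreover have "(1 - a) * Re ?s \<ge> 0" using assms s(1) by (intro mult_nonneg_nonneg) auto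
      ultimately show ?thesis by linarith
    qed (use s in simp)
    finally show ?thesis .
  qed
  with assms show ?thesis
    by (auto simp: wall_class_def simp del: csqrt.simps intro!: holomorphic_intros)
qed

lemma Re_inverse_pos: "Re z > 0 \<Longrightarrow> Re (1 / z) > 0"
  by (auto simp: Re_divide intro!: divide_pos_pos sum_power2_gt_zero_iff[THEN iffD2])

text \<open>Multiplying by the square root turns \<open>1/((1-z) f)\<close> into the reciprocal of \<open>sqrt(1-z) f\<close>, and
  reciprocals preserve a positive real part.\<close>
lemma wall_class_dual:
  assumes f: "f \<in> wall_class"
  shows "(\<lambda>z. 1 / ((1 - z) * f z)) \<in> wall_class"
proof -
  have nz: "1 - z \<noteq> 0" if "z \<in> slit_plane" for z using that by auto
  have "Re (csqrt (1 - z) * (1 / ((1 - z) * f z))) > 0" if z: "z \<in> slit_plane" for z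
  proof -
    let ?s = "csqrt (1 - z)"
    have "?s * (1 / ((1 - z) * f z)) = ?s * (1 / (?s\<^sup>2 * f z))" by simp
    also have "\<dots> = 1 / (?s * f z)"
      using nz[OF z] by (simp add: power2_eq_square del: power2_csqrt)
    finally have "?s * (1 / ((1 - z) * f z)) = 1 / (?s * f z)" .
    thus ?thesis using Re_inverse_pos[OF wall_class_Re_pos[OF f z]] by metis
  qed
  moreover have "(\<lambda>z. 1 / ((1 - z) * f z)) holomorphic_on slit_plane"
    by (intro holomorphic_intros wall_class_holomorphic[OF f])
       (use wall_class_nonzero[OF f] nz in auto)
  ultimately show ?thesis using wall_class_cnj[OF f] wall_class_0[OF f]
    by (simp add: wall_class_def del: csqrt.simps times_complex.sel mult_1_right)
qed

section \<open>The Koebe map from the unit disc onto the slit plane\<close>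

definition koebe :: "complex \<Rightarrow> complex" where "koebe u = 4 * u / (1 + u)\<^sup>2"

lemma one_plus_nonzero: "norm (u :: complex) < 1 \<Longrightarrow> 1 + u \<noteq> 0"
  by (metis add.inverse_inverse add_eq_0_iff norm_minus_cancel norm_one order_less_irrefl)

lemma one_minus_nonzero: "norm (u :: complex) < 1 \<Longrightarrow> 1 - u \<noteq> 0"
  by auto

text \<open>The square root of \<open>1 - z\<close> becomes rational in the disc variable; all that follows about the Koebe
  map is read off from this.\<close>
lemma koebe_eq: "norm u < 1 \<Longrightarrow> 1 - koebe u = ((1 - u) / (1 + u))\<^sup>2"
  using one_plus_nonzero[of u]
  by (simp add: koebe_def power_divide divide_simps) (simp add: power2_eq_square algebra_simps)

lemma Re_cayley_pos:
  assumes "norm (u :: complex) < 1"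
  shows "Re ((1 - u) / (1 + u)) > 0"
proof -
  have "(Re u)\<^sup>2 + (Im u)\<^sup>2 < 1"
    using assms by (simp add: cmod_def)
  hence "Re (1 - u) * Re (1 + u) + Im (1 - u) * Im (1 + u) > 0"
    by (simp add: power2_eq_square algebra_simps)
  moreover have "(Re (1 + u))\<^sup>2 + (Im (1 + u))\<^sup>2 > 0"
    using one_plus_nonzero[OF assms] by (metis complex_neq_0)
  ultimately show ?thesis by (simp add: Re_divide)
qed

lemma csqrt_koebe: "norm u < 1 \<Longrightarrow> csqrt (1 - koebe u) = (1 - u) / (1 + u)"
  by (intro csqrt_unique) (auto simp: koebe_eq Re_cayley_pos)

lemma koebe_mem_slit_plane: "norm u < 1 \<Longrightarrow> koebe u \<in> slit_plane"
proof -
  assume u: "norm u < 1"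
  show ?thesis unfolding slit_plane_iff
  proof
    assume "1 - koebe u \<in> \<real>\<^sub>\<le>\<^sub>0"
    then obtain x where x: "x \<le> 0" "1 - koebe u = of_real x" by (auto elim: nonpos_Reals_cases)
    hence "Re (csqrt (1 - koebe u)) = 0" by (simp add: csqrt_of_real' del: csqrt.simps)
    thus False using Re_cayley_pos[OF u] csqrt_koebe[OF u] by (simp del: csqrt.simps)
  qed
qed

definition koebe_inv :: "complex \<Rightarrow> complex" where
  "koebe_inv z = (1 - csqrt (1 - z)) / (1 + csqrt (1 - z))"

lemma norm_cayley_less_1:
  assumes "Re (s :: complex) > 0"
  shows "norm ((1 - s) / (1 + s)) < 1"
proof -
  have "(norm (1 - s))\<^sup>2 < (norm (1 + s))\<^sup>2"
    unfolding cmod_power2 using assms by (simp add: power2_eq_square algebra_simps)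
  hence "norm (1 - s) < norm (1 + s)" by (rule power2_less_imp_less) simp
  moreover from this have "norm (1 + s) > 0" by (meson le_less_trans norm_ge_zero)
  ultimately show ?thesis by (simp add: norm_divide)
qed

lemma one_plus_nonzero': "Re (s :: complex) > 0 \<Longrightarrow> 1 + s \<noteq> 0"
  by (auto simp: complex_eq_iff)

lemma norm_koebe_inv: "z \<in> slit_plane \<Longrightarrow> norm (koebe_inv z) < 1"
  unfolding koebe_inv_def by (intro norm_cayley_less_1 Re_csqrt_slit_plane)

lemma koebe_koebe_inv:
  assumes "z \<in> slit_plane"
  shows "koebe (koebe_inv z) = z"
proof -
  define s where "s = csqrt (1 - z)"
  have s: "s\<^sup>2 = 1 - z" "1 + s \<noteq> 0"
    using one_plus_nonzero'[OF Re_csqrt_slit_plane[OF assms]] by (auto simp: s_def simp del: csqrt.simps)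
  define u where "u = koebe_inv z"
  have u: "u = (1 - s) / (1 + s)" by (simp add: u_def koebe_inv_def s_def)
  have "(1 - u) / (1 + u) = s" using s(2) by (simp add: u divide_simps)
  hence "1 - koebe u = s\<^sup>2" using norm_koebe_inv[OF assms] by (simp add: koebe_eq u_def)
  thus ?thesis using s by (simp add: u_def)
qed

lemma koebe_inv_holomorphic: "koebe_inv holomorphic_on slit_plane"
  unfolding koebe_inv_def
  by (intro holomorphic_intros csqrt_one_minus_holomorphic one_plus_nonzero' Re_csqrt_slit_plane)

lemma koebe_holomorphic: "koebe holomorphic_on ball 0 1"
  unfolding koebe_def by (intro holomorphic_intros) (auto dest: one_plus_nonzero)

lemma csqrt_one_minus_cnj: "z \<in> slit_plane \<Longrightarrow> csqrt (1 - cnj z) = cnj (csqrt (1 - z))"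
  using cnj_csqrt[of "1 - z"] by (simp add: slit_plane_iff del: csqrt.simps)

lemma koebe_inv_cnj: "z \<in> slit_plane \<Longrightarrow> koebe_inv (cnj z) = cnj (koebe_inv z)"
  by (simp add: koebe_inv_def csqrt_one_minus_cnj del: csqrt.simps)

lemma koebe_cnj: "koebe (cnj u) = cnj (koebe u)"
  by (simp add: koebe_def)

section \<open>Poisson's formula and positivity of linear functionals\<close>

text \<open>The function of positive real part on the disc that corresponds to a member of Wall's class: the
  factor is the square root of \<open>1 - z\<close>.\<close>
definition disc_fun :: "(complex \<Rightarrow> complex) \<Rightarrow> complex \<Rightarrow> complex" where
  "disc_fun f u = f (koebe u) * (1 - u) / (1 + u)"

lemma disc_fun_holomorphic:
  assumes "f \<in> wall_class" shows "disc_fun f holomorphic_on ball 0 1"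
proof -
  have "(\<lambda>u. f (koebe u)) holomorphic_on ball 0 1"
    using holomorphic_on_compose_gen[OF koebe_holomorphic wall_class_holomorphic[OF assms]] koebe_mem_slit_plane
    by (auto simp: o_def image_subset_iff)
  thus ?thesis unfolding disc_fun_def
    by (intro holomorphic_intros) (auto dest: one_plus_nonzero)
qed

lemma disc_fun_Re_pos:
  assumes "f \<in> wall_class" "norm u < 1"
  shows "Re (disc_fun f u) > 0"
proof -
  have "Re (csqrt (1 - koebe u) * f (koebe u)) > 0"
    by (intro wall_class_Re_pos assms koebe_mem_slit_plane)
  thus ?thesis by (simp only: csqrt_koebe[OF assms(2)] disc_fun_def) (simp add: mult.commute)
qed

lemma disc_fun_cnj:
  assumes "f \<in> wall_class" "norm u < 1"
  shows "disc_fun f (cnj u) = cnj (disc_fun f u)"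
  using assms by (simp add: disc_fun_def koebe_cnj wall_class_cnj koebe_mem_slit_plane)

text \<open>On the unit circle the real-symmetrised Poisson kernel, divided by the square root of \<open>1 - z\<close>, is exactly one of
  the functions \<open>1/(1 - t z)\<close>. This is why positive real part in the disc variable amounts to
  being a mixture of these functions.\<close>
lemma poisson_kernel_koebe:
  assumes u: "norm u < 1" and v: "norm v = 1"
  shows "(1 - u\<^sup>2) / (1 - u * v) / (v - u) * v * ((1 + u) / (1 - u)) =
         1 / (1 - of_real ((1 + Re v) / 2) * koebe u)"
proof -
  have v0: "v \<noteq> 0" using v by auto
  have inv: "cnj v = 1 / v" using v v0 complex_norm_square[of v] by (simp add: field_simps)
  have t: "of_real ((1 + Re v) / 2) = (2 + v + 1 / v) / 4"
  proof -
    have "2 * complex_of_real (Re v) = v + 1 / v"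
      using complex_add_cnj[of v] by (simp add: inv)
    moreover have "of_real ((1 + Re v) / 2) = (2 + 2 * complex_of_real (Re v)) / 4" by simp
    ultimately show ?thesis by (simp only: add.assoc)
  qed
  have nz: "1 + u \<noteq> 0" "1 - u \<noteq> 0" "v - u \<noteq> 0" "1 - u * v \<noteq> 0"
    using u v one_plus_nonzero[OF u] by (auto simp: norm_mult dest: arg_cong[of _ _ norm])
  have "1 - of_real ((1 + Re v) / 2) * koebe u = (1 - u * v) * (v - u) / (v * (1 + u)\<^sup>2)"
    unfolding t koebe_def using nz v0
    by (simp add: divide_simps) (simp add: power2_eq_square algebra_simps)
  moreover have "(1 - u\<^sup>2) / (1 - u * v) / (v - u) * v * ((1 + u) / (1 - u)) = v * (1 + u)\<^sup>2 / ((1 - u * v) * (v - u))"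
    using nz by (simp add: divide_simps) (simp add: power2_eq_square algebra_simps)
  ultimately show ?thesis by simp
qed

text \<open>Cauchy's integral formula at the point \<open>u\<close> for \<open>\<phi>(r v) (1 - u\<^sup>2)/(1 - u v)\<close>, whose second factor is one at
  \<open>v = u\<close>. The dilation by \<open>r < 1\<close> keeps the integrand analytic up to the circle.\<close>
lemma disc_fun_cauchy:
  assumes f: "f \<in> wall_class" and r: "0 < r" "r < 1" and u: "norm u < 1"
  shows "((\<lambda>x. disc_fun f (of_real r * cis (2 * pi * x)) /
              (1 - of_real ((1 + cos (2 * pi * x)) / 2) * koebe u))
          has_integral (disc_fun f (of_real r * u) * ((1 + u) / (1 - u)))) {0..1}"
proof -
  \<comment> \<open>The second factor turns the Cauchy kernel into the symmetrised Poisson kernel.\<close>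
  define g where "g v = disc_fun f (of_real r * v) * ((1 - u\<^sup>2) / (1 - u * v))" for v
  have nz: "1 - u * v \<noteq> 0" if "norm v \<le> 1" for v
  proof
    assume "1 - u * v = 0"
    hence "norm u * norm v = 1" by (metis norm_mult norm_one right_minus_eq)
    moreover have "norm u * norm v \<le> norm u" using that by (simp add: mult_left_le)
    ultimately show False using u by linarith
  qed
  have sub: "norm (of_real r * v) < 1" if "norm v \<le> 1" for v :: complex
  proof -
    have "r * norm v \<le> r * 1" using that r by (intro mult_left_mono) auto
    also have "\<dots> < 1" using r by simp
    finally show ?thesis using r by (simp add: norm_mult)
  qed
  have "(disc_fun f \<circ> (\<lambda>v. of_real r * v)) holomorphic_on cball 0 1"
    by (intro holomorphic_on_compose_gen[OF _ disc_fun_holomorphic[OF f]] holomorphic_intros)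
       (use sub in auto)
  hence "g holomorphic_on cball 0 1"
    unfolding g_def by (intro holomorphic_intros) (use nz in \<open>auto simp: o_def\<close>)
  hence "((\<lambda>v. g v / (v - u)) has_contour_integral (2 * of_real pi * \<i> * g u)) (circlepath 0 1)"
    using u by (intro Cauchy_integral_circlepath_simple) auto
  hence "((\<lambda>x. g (cis (2 * pi * x)) / (cis (2 * pi * x) - u) * (2 * of_real pi * \<i> * cis (2 * pi * x)))
          has_integral (2 * of_real pi * \<i> * g u)) {0..1}"
    unfolding has_contour_integral vector_derivative_circlepath
    by (simp add: circlepath_def part_circlepath_def linepath_def cis_conv_exp mult_ac)
  from has_integral_mult_right[OF this, of "(1 + u) / (1 - u) / (2 * of_real pi * \<i>)"]
  have *: "((\<lambda>x. (1 + u) / (1 - u) / (2 * of_real pi * \<i>) *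
           (g (cis (2 * pi * x)) / (cis (2 * pi * x) - u) * (2 * of_real pi * \<i> * cis (2 * pi * x))))
          has_integral ((1 + u) / (1 - u) / (2 * of_real pi * \<i>) * (2 * of_real pi * \<i> * g u))) {0..1}" .
  have eq1: "(1 + u) / (1 - u) / (2 * of_real pi * \<i>) * (2 * of_real pi * \<i> * g u) =
             disc_fun f (of_real r * u) * ((1 + u) / (1 - u))"
    using nz[of u] u by (simp add: g_def power2_eq_square)
  have eq2: "(1 + u) / (1 - u) / (2 * of_real pi * \<i>) *
           (g v / (v - u) * (2 * of_real pi * \<i> * v)) =
           disc_fun f (of_real r * v) / (1 - of_real ((1 + Re v) / 2) * koebe u)" if "norm v = 1" for v
  proof -
    have "(1 + u) / (1 - u) / (2 * of_real pi * \<i>) * (g v / (v - u) * (2 * of_real pi * \<i> * v)) =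
      disc_fun f (of_real r * v) * ((1 - u\<^sup>2) / (1 - u * v) / (v - u) * v * ((1 + u) / (1 - u)))"
    proof -
      have *: "q / p * (D * A / w * (p * v)) = D * (A / w * v * q)" if "p \<noteq> 0" for q p D A w :: complex
        using that by (cases "w = 0") (simp_all add: field_simps)
      show ?thesis unfolding g_def by (rule *) simp
    qed
    also have "\<dots> = disc_fun f (of_real r * v) / (1 - of_real ((1 + Re v) / 2) * koebe u)"
      unfolding poisson_kernel_koebe[OF u that] by simp
    finally show ?thesis .
  qed
  from * show ?thesis unfolding eq1 eq2[OF norm_cis] by simp
qed

text \<open>The kernel does not change when \<open>v\<close> is replaced by its conjugate, so by real symmetry the
  boundary values can be conjugated; averaging leaves their real part.\<close>
lemma disc_fun_poisson:
  assumes f: "f \<in> wall_class" and r: "0 < r" "r < 1" and u: "norm u < 1"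
  shows "((\<lambda>x. of_real (Re (disc_fun f (of_real r * cis (2 * pi * x)))) /
              (1 - of_real ((1 + cos (2 * pi * x)) / 2) * koebe u))
          has_integral (disc_fun f (of_real r * u) * ((1 + u) / (1 - u)))) {0..1}"
proof -
  let ?\<phi> = "\<lambda>x. disc_fun f (of_real r * cis (2 * pi * x))"
  let ?k = "\<lambda>x. 1 - of_real ((1 + cos (2 * pi * x)) / 2) * koebe u"
  let ?I = "disc_fun f (of_real r * u) * ((1 + u) / (1 - u))"
  have ru: "norm (of_real r * u) < 1"
    using r u mult_strict_mono[of r 1 "norm u" 1] by (simp add: norm_mult)
  have "((\<lambda>x. ?\<phi> x / ?k x) has_integral ?I) {0..1}"
    by (rule disc_fun_cauchy[OF f r u])
  moreover have "((\<lambda>x. cnj (?\<phi> x) / ?k x) has_integral ?I) {0..1}"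
  proof -
    have "norm (cnj u) < 1" using u by simp
    from disc_fun_cauchy[OF f r this, THEN has_integral_cnj[THEN iffD2]]
    have "((\<lambda>x. cnj (?\<phi> x) / ?k x) has_integral cnj (disc_fun f (of_real r * cnj u)) * ((1 + u) / (1 - u))) {0..1}"
      by (simp add: o_def koebe_cnj)
    moreover have "cnj (disc_fun f (of_real r * cnj u)) = disc_fun f (of_real r * u)"
      using disc_fun_cnj[OF f ru] by simp
    ultimately show ?thesis by simp
  qed
  ultimately have "((\<lambda>x. ?\<phi> x / ?k x + cnj (?\<phi> x) / ?k x) has_integral (?I + ?I)) {0..1}"
    by (rule has_integral_add)
  hence "((\<lambda>x. (?\<phi> x / ?k x + cnj (?\<phi> x) / ?k x) / 2) has_integral ((?I + ?I) / 2)) {0..1}"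
    by (rule has_integral_divide)
  moreover have "(?\<phi> x / ?k x + cnj (?\<phi> x) / ?k x) / 2 = of_real (Re (?\<phi> x)) / ?k x" for x
  proof -
    have "(?\<phi> x / k + cnj (?\<phi> x) / k) / 2 = ((?\<phi> x + cnj (?\<phi> x)) / 2) / k" for k
      by (simp add: add_divide_distrib mult.commute)
    also have "(?\<phi> x + cnj (?\<phi> x)) / 2 = of_real (Re (?\<phi> x))"
      unfolding complex_add_cnj by simp
    finally show ?thesis .
  qed
  moreover have "(x + x) / 2 = x" for x :: complex by simp
  ultimately show ?thesis by (simp only:)
qed

text \<open>For a dilated function the functional is an integral of its values on the kernels
  \<open>1/(1 - t z)\<close> against the nonnegative weight provided by Poisson's formula. Then \<open>r\<close> tends to one.\<close>
theorem wall_class_positive_functional: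
  fixes z :: "'i \<Rightarrow> complex" and c :: "'i \<Rightarrow> complex"
  assumes f: "f \<in> wall_class" and I: "finite I" and z: "\<And>i. i \<in> I \<Longrightarrow> z i \<in> slit_plane"
    and pos: "\<And>t. 0 \<le> t \<Longrightarrow> t \<le> 1 \<Longrightarrow> (\<Sum>i\<in>I. Re (c i / (1 - of_real t * z i))) \<ge> 0"
  shows "(\<Sum>i\<in>I. Re (c i * f (z i))) \<ge> 0"
proof -
  define u where "u i = koebe_inv (z i)" for i
  have u: "norm (u i) < 1" "koebe (u i) = z i" if "i \<in> I" for i
    using norm_koebe_inv koebe_koebe_inv z that by (auto simp: u_def)
  define L where "L r = (\<Sum>i\<in>I. Re (c i * (disc_fun f (of_real r * u i) * ((1 + u i) / (1 - u i)))))" for r :: real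
  have Lpos: "L r \<ge> 0" if r: "0 < r" "r < 1" for r
  proof -
    let ?p = "\<lambda>x. Re (disc_fun f (of_real r * cis (2 * pi * x)))"
    let ?t = "\<lambda>x. (1 + cos (2 * pi * x)) / 2"
    have "((\<lambda>x. Re (c i * (of_real (?p x) / (1 - of_real (?t x) * z i)))) has_integral
            Re (c i * (disc_fun f (of_real r * u i) * ((1 + u i) / (1 - u i))))) {0..1}"
      if "i \<in> I" for i
      using has_integral_Re[OF has_integral_mult_right[OF disc_fun_poisson[OF f r u(1)[OF that]], of "c i"]]
      by (simp only: u(2)[OF that])
    hence "((\<lambda>x. \<Sum>i\<in>I. Re (c i * (of_real (?p x) / (1 - of_real (?t x) * z i)))) has_integral L r) {0..1}"
      unfolding L_def by (intro has_integral_sum I)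
    moreover have "(\<Sum>i\<in>I. Re (c i * (of_real (?p x) / (1 - of_real (?t x) * z i)))) \<ge> 0" for x
    proof -
      have "Re (c i * (of_real (?p x) / (1 - of_real (?t x) * z i))) =
            ?p x * Re (c i / (1 - of_real (?t x) * z i))" for i
      proof -
        have "c i * (of_real (?p x) / (1 - of_real (?t x) * z i)) =
              of_real (?p x) * (c i / (1 - of_real (?t x) * z i))" by simp
        thus ?thesis by (simp only: Re_complex_of_real times_complex.sel Im_complex_of_real mult_zero_left diff_zero)
      qed
      hence "(\<Sum>i\<in>I. Re (c i * (of_real (?p x) / (1 - of_real (?t x) * z i)))) =
        ?p x * (\<Sum>i\<in>I. Re (c i / (1 - of_real (?t x) * z i)))" by (simp only: sum_distrib_left)
      moreover have "?p x \<ge> 0"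
        using disc_fun_Re_pos[OF f, of "of_real r * cis (2 * pi * x)"] r by (simp add: norm_mult)
      moreover have "?t x \<ge> 0" "?t x \<le> 1"
        using cos_ge_minus_one[of "2 * pi * x"] cos_le_one[of "2 * pi * x"] by (simp_all del: cos_ge_minus_one cos_le_one)
      ultimately show ?thesis using pos[of "?t x"] by (simp only: mult_nonneg_nonneg)
    qed
    ultimately show ?thesis by (rule has_integral_nonneg)
  qed
  have "(L \<longlongrightarrow> (\<Sum>i\<in>I. Re (c i * f (z i)))) (at_left 1)"
  proof -
    have "((\<lambda>r. Re (c i * (disc_fun f (of_real r * u i) * ((1 + u i) / (1 - u i))))) \<longlongrightarrow> Re (c i * f (z i))) (at_left 1)"
      if i: "i \<in> I" for i
    proof -
      have "isCont (disc_fun f) (u i)"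
        using disc_fun_holomorphic[OF f] u(1)[OF i]
        by (metis centre_in_ball continuous_on_interior dist_0_norm holomorphic_on_imp_continuous_on interior_open mem_ball open_ball)
      moreover have "((\<lambda>r. of_real r * u i) \<longlongrightarrow> of_real 1 * u i) (at_left (1::real))"
        by (intro tendsto_intros)
      ultimately have "((\<lambda>r. disc_fun f (of_real r * u i)) \<longlongrightarrow> disc_fun f (u i)) (at_left (1::real))"
        by (intro isCont_tendsto_compose[of "u i" "disc_fun f"]) auto
      hence "((\<lambda>r. Re (c i * (disc_fun f (of_real r * u i) * ((1 + u i) / (1 - u i))))) \<longlongrightarrow>
         Re (c i * (disc_fun f (u i) * ((1 + u i) / (1 - u i))))) (at_left (1::real))"
        by (intro tendsto_intros)
      moreover have "disc_fun f (u i) * ((1 + u i) / (1 - u i)) = f (z i)"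
        using u[OF i] one_plus_nonzero[OF u(1)[OF i]] one_minus_nonzero[OF u(1)[OF i]]
        by (simp add: disc_fun_def)
      ultimately show ?thesis by (simp only:)
    qed
    thus ?thesis unfolding L_def by (intro tendsto_sum)
  qed
  moreover have "eventually (\<lambda>r. L r \<ge> 0) (at_left 1)"
    using Lpos eventually_at_left_real[of 0 1] by (auto elim!: eventually_mono)
  ultimately show ?thesis by (intro tendsto_lowerbound[of L _ "at_left 1"]) auto
qed

section \<open>Inequalities for the real part on the unit disc\<close>

lemma wall_class_real: "f \<in> wall_class \<Longrightarrow> x < 1 \<Longrightarrow> f (complex_of_real x) = of_real (Re (f (of_real x)))"
  using wall_class_cnj[of f "of_real x"] by (auto simp: complex_eq_iff)

text \<open>Four points suffice for every estimate below; surplus slots carry the coefficient zero.\<close>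
lemma wall_class_positive_functional4:
  assumes f: "f \<in> wall_class"
    and z: "z1 \<in> slit_plane" "z2 \<in> slit_plane" "z3 \<in> slit_plane" "z4 \<in> slit_plane"
    and pos: "\<And>t. 0 \<le> t \<Longrightarrow> t \<le> 1 \<Longrightarrow>
      Re (c1 / (1 - of_real t * z1)) + Re (c2 / (1 - of_real t * z2)) +
      Re (c3 / (1 - of_real t * z3)) + Re (c4 / (1 - of_real t * z4)) \<ge> 0"
  shows "Re (c1 * f z1) + Re (c2 * f z2) + Re (c3 * f z3) + Re (c4 * f z4) \<ge> 0"
proof -
  have "(\<Sum>i<4. Re ([c1, c2, c3, c4] ! i * f ([z1, z2, z3, z4] ! i))) \<ge> 0"
  proof (rule wall_class_positive_functional[OF f])
    fix i :: nat assume "i \<in> {..<4}"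
    hence "i = 0 \<or> i = 1 \<or> i = 2 \<or> i = 3" by auto
    thus "[z1, z2, z3, z4] ! i \<in> slit_plane" using z by auto
  next
    fix t :: real assume "0 \<le> t" "t \<le> 1"
    from pos[OF this] show "(\<Sum>i<4. Re ([c1, c2, c3, c4] ! i / (1 - of_real t * [z1, z2, z3, z4] ! i))) \<ge> 0"
      by (simp add: eval_nat_numeral)
  qed simp
  thus ?thesis by (simp add: eval_nat_numeral)
qed

text \<open>A modulus is the real part after a rotation, so bounds on moduli also pass from the kernels to the class.\<close>
lemma wall_class_norm_le:
  assumes f: "f \<in> wall_class"
    and z: "z1 \<in> slit_plane" "z2 \<in> slit_plane" "z3 \<in> slit_plane" "z4 \<in> slit_plane"
    and le: "\<And>t. 0 \<le> t \<Longrightarrow> t \<le> 1 \<Longrightarrow>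
      norm (c1 / (1 - of_real t * z1) + c2 / (1 - of_real t * z2)) \<le>
      Re (c3 / (1 - of_real t * z3)) + Re (c4 / (1 - of_real t * z4))"
  shows "norm (c1 * f z1 + c2 * f z2) \<le> Re (c3 * f z3) + Re (c4 * f z4)"
proof -
  define v where "v = c1 * f z1 + c2 * f z2"
  \<comment> \<open>A unimodular factor with \<open>l v = - |v|\<close>.\<close>
  define l where "l = - (if v = 0 then 1 else cnj v / of_real (norm v))"
  have l: "norm l = 1" "l * v = - of_real (norm v)"
    using complex_norm_square[of v] by (auto simp: l_def norm_divide field_simps power2_eq_square)
  have "Re (l * c1 * f z1) + Re (l * c2 * f z2) + Re (c3 * f z3) + Re (c4 * f z4) \<ge> 0"
  proof (rule wall_class_positive_functional4[OF f z])
    fix t :: real assume t: "0 \<le> t" "t \<le> 1"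
    let ?k = "c1 / (1 - of_real t * z1) + c2 / (1 - of_real t * z2)"
    have "Re (l * ?k) \<ge> - norm (l * ?k)" using abs_Re_le_cmod[of "l * ?k"] by linarith
    also have "norm (l * ?k) = norm ?k" by (simp only: norm_mult l mult_1_left)
    finally have "Re (l * ?k) \<ge> - norm ?k" .
    moreover have "Re (l * ?k) = Re (l * c1 / (1 - of_real t * z1)) + Re (l * c2 / (1 - of_real t * z2))"
      by (simp only: distrib_left times_divide_eq_right plus_complex.sel)
    ultimately show "Re (l * c1 / (1 - of_real t * z1)) + Re (l * c2 / (1 - of_real t * z2)) +
        Re (c3 / (1 - of_real t * z3)) + Re (c4 / (1 - of_real t * z4)) \<ge> 0"
      using le[OF t] by linarith
  qed
  moreover have "Re (l * c1 * f z1) + Re (l * c2 * f z2) = Re (l * v)"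
    by (simp only: v_def distrib_left mult.assoc plus_complex.sel)
  ultimately show ?thesis unfolding l(2) v_def[symmetric] by simp
qed

lemma Re_kernel_real: "Re (of_real k / (1 - of_real t * of_real x)) = k / (1 - t * x)"
proof -
  have "of_real k / (1 - of_real t * of_real x) = complex_of_real (k / (1 - t * x))" by simp
  thus ?thesis by (simp only: Re_complex_of_real)
qed

lemma Re_kernel_neg_one: "Re (of_real k / (1 - of_real t * (-1))) = k / (1 + t)"
  using Re_kernel_real[of k t "-1"] by simp

lemma one_minus_mult_pos:
  assumes "x < 1" "0 \<le> t" "t \<le> 1" shows "1 - t * x > (0::real)"
proof (cases "x \<ge> 0")
  case True
  hence "t * x \<le> 1 * x" using assms by (intro mult_right_mono) auto
  thus ?thesis using assms by simp
next
  case False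
  hence "t * x \<le> 0" using assms by (simp add: mult_nonneg_nonpos)
  thus ?thesis by simp
qed

text \<open>With the positive denominator made explicit, the estimates on real parts become polynomial inequalities
  in \<open>t\<close>, \<open>Re z\<close> and \<open>|z|\<close>.\<close>
lemma Re_kernel:
  fixes z :: complex
  assumes "1 - of_real t * z \<noteq> 0"
  shows "Re (1 / (1 - of_real t * z)) = (1 - t * Re z) / (1 - 2 * t * Re z + t\<^sup>2 * (norm z)\<^sup>2)"
    and "Re ((1 - z) / (1 - of_real t * z)) =
           (1 - (1 + t) * Re z + t * (norm z)\<^sup>2) / (1 - 2 * t * Re z + t\<^sup>2 * (norm z)\<^sup>2)"
    and "1 - 2 * t * Re z + t\<^sup>2 * (norm z)\<^sup>2 > 0"
proof -
  have d: "(Re (1 - of_real t * z))\<^sup>2 + (Im (1 - of_real t * z))\<^sup>2 = 1 - 2 * t * Re z + t\<^sup>2 * (norm z)\<^sup>2"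
    unfolding cmod_power2 by (simp add: power2_eq_square algebra_simps)
  show "Re (1 / (1 - of_real t * z)) = (1 - t * Re z) / (1 - 2 * t * Re z + t\<^sup>2 * (norm z)\<^sup>2)"
    unfolding Re_divide d by simp
  show "Re ((1 - z) / (1 - of_real t * z)) =
           (1 - (1 + t) * Re z + t * (norm z)\<^sup>2) / (1 - 2 * t * Re z + t\<^sup>2 * (norm z)\<^sup>2)"
    unfolding Re_divide d unfolding cmod_power2 by (simp add: power2_eq_square algebra_simps)
  show "1 - 2 * t * Re z + t\<^sup>2 * (norm z)\<^sup>2 > 0"
    unfolding d[symmetric] using assms by (metis complex_neq_0)
qed

lemma kernel_denominator_nonzero:
  assumes "norm (z :: complex) < 1" "0 \<le> t" "t \<le> 1"
  shows "1 - of_real t * z \<noteq> 0"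
proof -
  have "t * norm z \<le> 1 * norm z" using assms by (intro mult_right_mono) auto
  hence "norm (of_real t * z) < 1" using assms by (simp add: norm_mult)
  thus ?thesis by (rule one_minus_nonzero)
qed

lemma norm_square_le_1: "norm (z::complex) < 1 \<Longrightarrow> (norm z)\<^sup>2 \<le> 1"
  by (simp add: abs_square_le_1)

lemma Re_ge_minus_1: "norm (z::complex) < 1 \<Longrightarrow> - 1 < Re z" "norm z < 1 \<Longrightarrow> Re z < 1"
  using abs_Re_le_cmod[of z] by linarith+

lemma Re_kernel_ge:
  fixes z :: complex
  assumes "norm z < 1" "0 \<le> t" "t \<le> 1"
  shows "Re (1 / (1 - of_real t * z)) \<ge> 1 / (1 + t)"
proof -
  note k = Re_kernel[OF kernel_denominator_nonzero[OF assms]]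
  let ?x = "Re z" and ?r = "(norm z)\<^sup>2"
  have "t * (?x + ?r) \<le> 1 + ?x"
  proof (cases "?x + ?r \<ge> 0")
    case True
    hence "t * (?x + ?r) \<le> 1 * (?x + ?r)" using assms by (intro mult_right_mono) auto
    also have "1 * (?x + ?r) \<le> 1 + ?x" using norm_square_le_1[OF assms(1)] by simp
    finally show ?thesis .
  next
    case False
    hence "t * (?x + ?r) \<le> 0" using assms by (simp add: mult_nonneg_nonpos)
    thus ?thesis using Re_ge_minus_1[OF assms(1)] by linarith
  qed
  hence "0 \<le> t * (1 + ?x - t * (?x + ?r))" using assms by simp
  hence "1 - 2 * t * ?x + t\<^sup>2 * ?r \<le> (1 - t * ?x) * (1 + t)"
    by (simp add: power2_eq_square algebra_simps)
  thus ?thesis unfolding k(1) using k(3) assms by (simp add: field_simps)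
qed

lemma Re_dual_kernel_bounds:
  fixes z :: complex
  assumes "norm z < 1" "0 \<le> t" "t \<le> 1"
  shows "Re ((1 - z) / (1 - of_real t * z)) \<le> 2 / (1 + t)"
    and "Re ((1 - z) / (1 - of_real t * z)) \<ge> 0"
proof -
  note k = Re_kernel[OF kernel_denominator_nonzero[OF assms]]
  let ?x = "Re z" and ?r = "(norm z)\<^sup>2"
  have r: "?r \<le> 1" "?r \<ge> ?x\<^sup>2" and x: "- 1 < ?x" "?x < 1"
    using norm_square_le_1[OF assms(1)] Re_ge_minus_1[OF assms(1)] by (auto simp: cmod_power2)
  have "t * ?r \<le> t * 1" "(1 - t) * ?x \<ge> (1 - t) * (-1)"
    using r x assms by (intro mult_left_mono; simp)+
  hence "0 \<le> (1 - t) * (1 + ?x * (1 - t) - t * ?r)" using assms by (simp add: mult.commute)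
  hence "(1 - (1 + t) * ?x + t * ?r) * (1 + t) \<le> 2 * (1 - 2 * t * ?x + t\<^sup>2 * ?r)"
    by (simp add: power2_eq_square algebra_simps)
  thus "Re ((1 - z) / (1 - of_real t * z)) \<le> 2 / (1 + t)"
    unfolding k(2) using k(3) assms by (simp add: field_simps)
  have "1 - (1 + t) * ?x + t * ?r = (1 - t) * (1 - ?x) + t * (1 - 2 * ?x + ?r)"
    by (simp add: algebra_simps)
  moreover have "1 - 2 * ?x + ?r \<ge> (1 - ?x)\<^sup>2" using r by (simp add: power2_eq_square algebra_simps)
  hence "1 - 2 * ?x + ?r \<ge> 0" using zero_le_power2[of "1 - ?x"] by (rule order_trans[rotated])
  ultimately have "1 - (1 + t) * ?x + t * ?r \<ge> 0" using assms x by simp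
  thus "Re ((1 - z) / (1 - of_real t * z)) \<ge> 0" unfolding k(2) using k(3) by simp
qed

lemma norm_kernel_le:
  fixes z :: complex
  assumes "norm z < 1" "0 \<le> t" "t \<le> 1"
  shows "norm (1 / (1 - of_real t * z)) \<le> 1 / (1 - t * norm z)"
proof -
  have "1 - t * norm z > 0"
    using assms mult_right_mono[of t 1 "norm z"] by auto
  moreover have "1 - t * norm z \<le> norm (1 - of_real t * z)"
    using norm_triangle_ineq2[of 1 "of_real t * z"] assms by (simp add: norm_mult)
  ultimately show ?thesis by (simp add: norm_divide frac_le)
qed

lemma mem_slit_plane_if_norm_less_1: "norm z < 1 \<Longrightarrow> z \<in> slit_plane"
  using ball_subset_slit_plane by auto

text \<open>For \<open>t < 1\<close> the Moebius map \<open>z \<mapsto> (1 - z)/(1 - t z)\<close> sends the unit disc to the disc with diameter from \<open>0\<close>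
  to \<open>2/(1 + t)\<close>, its values at \<open>1\<close> and \<open>-1\<close>.\<close>
lemma wall_class_dual_Re_bounds:
  assumes f: "f \<in> wall_class" and z: "norm z < 1"
  shows "Re ((1 - z) * f z) \<le> 2 * Re (f (-1))" and "Re ((1 - z) * f z) \<ge> 0"
proof -
  have "Re (of_real 2 * f (-1)) + Re (- (1 - z) * f z) + Re (0 * f 0) + Re (0 * f 0) \<ge> 0"
  proof (rule wall_class_positive_functional4[OF f])
    fix t :: real assume t: "0 \<le> t" "t \<le> 1"
    show "Re (of_real 2 / (1 - of_real t * (-1))) + Re (- (1 - z) / (1 - of_real t * z)) +
      Re (0 / (1 - of_real t * 0)) + Re (0 / (1 - of_real t * 0)) \<ge> 0"
      using Re_dual_kernel_bounds(1)[OF z t]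
      by (simp only: Re_kernel_neg_one minus_divide_left[symmetric] uminus_complex.sel) simp
  qed (use z mem_slit_plane_if_norm_less_1 in auto)
  thus "Re ((1 - z) * f z) \<le> 2 * Re (f (-1))" by simp (simp add: algebra_simps)
  have "Re ((1 - z) * f z) + Re (0 * f 0) + Re (0 * f 0) + Re (0 * f 0) \<ge> 0"
    by (rule wall_class_positive_functional4[OF f])
       (use z mem_slit_plane_if_norm_less_1 Re_dual_kernel_bounds(2)[OF z] in auto)
  thus "Re ((1 - z) * f z) \<ge> 0" by simp
qed

lemma wall_class_Re_ge_neg_one:
  assumes f: "f \<in> wall_class" and z: "norm z < 1"
  shows "Re (f z) \<ge> Re (f (-1))"
proof -
  have "Re (1 * f z) + Re (of_real (-1) * f (-1)) + Re (0 * f 0) + Re (0 * f 0) \<ge> 0"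
  proof (rule wall_class_positive_functional4[OF f])
    fix t :: real assume t: "0 \<le> t" "t \<le> 1"
    show "Re (1 / (1 - of_real t * z)) + Re (of_real (-1) / (1 - of_real t * (-1))) +
      Re (0 / (1 - of_real t * 0)) + Re (0 / (1 - of_real t * 0)) \<ge> 0"
      unfolding Re_kernel_neg_one using Re_kernel_ge[OF z t] by simp
  qed (use z mem_slit_plane_if_norm_less_1 in auto)
  thus ?thesis by simp
qed

lemma wall_class_norm_le_norm:
  assumes f: "f \<in> wall_class" and z: "norm z < 1"
  shows "norm (f z) \<le> Re (f (of_real (norm z)))"
proof -
  have "norm (1 * f z + 0 * f 0) \<le> Re (of_real 1 * f (of_real (norm z))) + Re (0 * f 0)"
  proof (rule wall_class_norm_le[OF f])
    fix t :: real assume t: "0 \<le> t" "t \<le> 1"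
    show "norm (1 / (1 - of_real t * z) + 0 / (1 - of_real t * 0)) \<le>
      Re (of_real 1 / (1 - of_real t * of_real (norm z))) + Re (0 / (1 - of_real t * 0))"
      unfolding Re_kernel_real using norm_kernel_le[OF z t] by simp
  qed (use z mem_slit_plane_if_norm_less_1 in auto)
  thus ?thesis by simp
qed

lemma wall_class_mono:
  assumes f: "f \<in> wall_class" and xy: "x \<le> y" "y < 1"
  shows "Re (f (of_real x)) \<le> Re (f (of_real y))"
proof -
  have "Re (of_real 1 * f (of_real y)) + Re (of_real (-1) * f (of_real x)) + Re (0 * f 0) + Re (0 * f 0) \<ge> 0"
  proof (rule wall_class_positive_functional4[OF f])
    fix t :: real assume t: "0 \<le> t" "t \<le> 1"
    have x: "x < 1" using xy by simp
    have "t * x \<le> t * y" using t xy by (intro mult_left_mono) auto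
    hence "1 / (1 - t * x) \<le> 1 / (1 - t * y)"
      using one_minus_mult_pos[OF xy(2) t] by (intro frac_le) simp_all
    thus "Re (of_real 1 / (1 - of_real t * of_real y)) + Re (of_real (-1) / (1 - of_real t * of_real x)) +
      Re (0 / (1 - of_real t * 0)) + Re (0 / (1 - of_real t * 0)) \<ge> 0"
      unfolding Re_kernel_real by simp
  qed (use xy in auto)
  thus ?thesis by simp
qed

text \<open>The hypothesis says that \<open>1/(1-z)\<close> occurs in \<open>f\<close> with weight at least \<open>l\<close>, and after splitting it off the
  rest still has its least real part at \<open>-1\<close>. Without a measure this is seen as follows: on the
  kernels \<open>(1 - x) f(x)\<close> becomes \<open>(1 - x)/(1 - t x)\<close>, which is at most one near \<open>t = 1\<close> and as small as one
  likes elsewhere when \<open>x\<close> is close to one.\<close>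
lemma wall_class_atom_bound:
  assumes f: "f \<in> wall_class" and z: "norm z < 1"
    and l: "\<And>x. 0 < x \<Longrightarrow> x < 1 \<Longrightarrow> l \<le> (1 - x) * Re (f (of_real x))"
  shows "Re (f z) - Re (f (-1)) \<ge> l * (Re (1 / (1 - z)) - 1 / 2)"
proof (rule field_le_epsilon)
  fix e :: real assume e: "e > 0"
  define G where "G t = Re (1 / (1 - of_real t * z)) - 1 / (1 + t)" for t
  define R where "R = Re (1 / (1 - z)) - 1 / 2"
  have G: "G t \<ge> 0" if "0 \<le> t" "t \<le> 1" for t
    using Re_kernel_ge[OF z that] by (simp add: G_def)
  have G1: "G 1 = R" by (simp add: G_def R_def)
  have R: "R \<ge> 0" using G[of 1] G1 by simp
  have "isCont G 1" unfolding G_def isCont_def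
    by (intro tendsto_intros) (use z in auto)
  hence "eventually (\<lambda>t. G t > R - e) (at_left 1)"
    using e G1 by (intro order_tendstoD(1)) (auto simp: isCont_def filterlim_at_split)
  then obtain b where b: "b < 1" "\<And>t. b < t \<Longrightarrow> t < 1 \<Longrightarrow> G t > R - e"
    unfolding eventually_at_left_field by blast
  define n where "n = 1 - b"
  have n: "n > 0" using b by (simp add: n_def)
  \<comment> \<open>Chosen so that \<open>(1 - x) R \<le> e n\<close>, which handles the \<open>t\<close> at distance at least \<open>n\<close> from one; the maximum only keeps \<open>x\<close> positive.\<close>
  define x where "x = max (1/2) (1 - e * n / (R + 1))"
  have x: "0 < x" "x < 1" using e n R by (auto simp: x_def)
  have xR: "(1 - x) * R \<le> e * n"
  proof -
    have "1 - x \<le> e * n / (R + 1)" by (simp add: x_def)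
    hence "(1 - x) * R \<le> e * n / (R + 1) * R" using R by (intro mult_right_mono)
    also have "\<dots> \<le> e * n" using R e n by (simp add: field_simps)
    finally show ?thesis .
  qed
  have key: "G t + e \<ge> (1 - x) * R / (1 - t * x)" if t: "0 \<le> t" "t \<le> 1" for t
  proof (cases "t > b")
    case True
    have "t * x \<le> 1 * x" using t x by (intro mult_right_mono) auto
    hence "(1 - x) * R / (1 - t * x) \<le> (1 - x) * R / (1 - x)"
      using x R one_minus_mult_pos[OF x(2) t]
      by (intro divide_left_mono mult_nonneg_nonneg mult_pos_pos) auto
    hence "(1 - x) * R / (1 - t * x) \<le> R" using x by simp
    moreover have "G t \<ge> R - e" using b(2)[of t] True t e G1 by (cases "t = 1") auto
    ultimately show ?thesis by linarith
  next
    case False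
    have "t * x \<le> t * 1" using t x by (intro mult_left_mono) auto
    hence "n \<le> 1 - t * x" using False by (simp add: n_def)
    hence "(1 - x) * R / (1 - t * x) \<le> (1 - x) * R / n"
      using n x R by (intro divide_left_mono mult_nonneg_nonneg mult_pos_pos) auto
    also have "\<dots> \<le> e" using xR n by (simp add: field_simps)
    finally show ?thesis using G[OF t] by linarith
  qed
  have "Re (1 * f z) + Re (of_real (-1) * f (-1)) + Re (of_real (- ((1 - x) * R)) * f (of_real x)) + Re (of_real e * f 0) \<ge> 0"
  proof (rule wall_class_positive_functional4[OF f])
    fix t :: real assume t: "0 \<le> t" "t \<le> 1"
    show "Re (1 / (1 - of_real t * z)) + Re (of_real (-1) / (1 - of_real t * (-1))) +
      Re (of_real (- ((1 - x) * R)) / (1 - of_real t * of_real x)) + Re (of_real e / (1 - of_real t * 0)) \<ge> 0"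
      unfolding Re_kernel_real Re_kernel_neg_one using key[OF t] by (simp add: G_def)
  qed (use z x mem_slit_plane_if_norm_less_1 in auto)
  hence "Re (f z) - Re (f (-1)) + e \<ge> R * ((1 - x) * Re (f (of_real x)))"
    by (simp add: wall_class_0[OF f] mult_ac)
  moreover have "R * ((1 - x) * Re (f (of_real x))) \<ge> R * l"
    using l[OF x] R by (intro mult_left_mono) auto
  ultimately show "l * (Re (1 / (1 - z)) - 1 / 2) \<le> Re (f z) - Re (f (-1)) + e"
    by (simp add: R_def mult.commute)
qed

section \<open>Behaviour at the point one\<close>

lemma norm_kernel_ge:
  assumes z: "norm z < 1" and t: "0 \<le> t" "t \<le> 1"
  shows "norm (1 - of_real t * z) \<ge> 1 - t" and "norm (1 - of_real t * z) \<ge> t * norm (1 - z)"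
    and "norm (1 - of_real t * z) \<le> (1 - t) + t * norm (1 - z)"
    and "Re (1 - of_real t * z) \<ge> 1 - t"
proof -
  have e: "1 - of_real t * z = of_real (1 - t) + of_real t * (1 - z)" by (simp add: algebra_simps)
  have Rz: "Re (1 - z) \<ge> 0" using Re_ge_minus_1[OF z] by simp
  have Re: "Re (1 - of_real t * z) = (1 - t) + t * Re (1 - z)"
    unfolding e by simp
  thus R: "Re (1 - of_real t * z) \<ge> 1 - t" using Rz t by simp
  thus "norm (1 - of_real t * z) \<ge> 1 - t" using complex_Re_le_cmod[of "1 - of_real t * z"] by linarith
  have "norm (of_real t * (1 - z)) \<le> norm (1 - of_real t * z)"
  proof (rule power2_le_imp_le)
    have "(Re (of_real t * (1 - z)))\<^sup>2 \<le> (Re (1 - of_real t * z))\<^sup>2"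
      unfolding Re using Rz t by (intro power_mono) auto
    thus "(norm (of_real t * (1 - z)))\<^sup>2 \<le> (norm (1 - of_real t * z))\<^sup>2"
      unfolding cmod_power2 by simp
  qed simp
  thus "norm (1 - of_real t * z) \<ge> t * norm (1 - z)" using t by (simp add: norm_mult)
  show "norm (1 - of_real t * z) \<le> (1 - t) + t * norm (1 - z)"
    unfolding e using norm_triangle_ineq[of "of_real (1 - t)" "of_real t * (1 - z)"] t
    by (simp add: norm_mult del: of_real_diff)
qed

text \<open>Since \<open>Re (1 - z) > 0\<close>, the numbers \<open>1 - t\<close> and \<open>t (1 - z)\<close> do not cancel in
  \<open>1 - t z = (1 - t) + t (1 - z)\<close>, so a point \<open>z\<close> may be replaced by the real point at the same distance from one.\<close>
lemma wall_class_dual_norm_le: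
  assumes f: "f \<in> wall_class" and z: "norm z < 1" and d: "d = norm (1 - z)" "d < 1"
  shows "norm ((1 - z) * f z) \<le> 2 * (d * Re (f (of_real (1 - d))))"
proof -
  have d0: "d > 0" using d z by auto
  have "norm ((1 - z) * f z + 0 * f 0) \<le> Re (of_real (2 * d) * f (of_real (1 - d))) + Re (0 * f 0)"
  proof (rule wall_class_norm_le[OF f])
    fix t :: real assume t: "0 \<le> t" "t \<le> 1"
    have p: "1 - t * (1 - d) > 0" using one_minus_mult_pos[of "1 - d" t] t d0 by simp
    have "1 - t * (1 - d) = (1 - t) + t * d" by (simp add: algebra_simps)
    also have "\<dots> \<le> 2 * norm (1 - of_real t * z)" using norm_kernel_ge(1,2)[OF z t] d by simp
    finally have "(1 - t * (1 - d)) \<le> 2 * norm (1 - of_real t * z)" .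
    hence "d * (1 - t * (1 - d)) \<le> d * (2 * norm (1 - of_real t * z))" using d0 by (intro mult_left_mono) auto
    hence "d / norm (1 - of_real t * z) \<le> 2 * d / (1 - t * (1 - d))"
      using p kernel_denominator_nonzero[OF z t] by (simp add: field_simps)
    thus "norm ((1 - z) / (1 - of_real t * z) + 0 / (1 - of_real t * 0)) \<le>
      Re (of_real (2 * d) / (1 - of_real t * of_real (1 - d))) + Re (0 / (1 - of_real t * 0))"
      unfolding Re_kernel_real d(1)[symmetric] by (simp add: norm_divide d(1)[symmetric])
  qed (use z mem_slit_plane_if_norm_less_1 d0 in \<open>auto simp del: of_real_diff\<close>)
  thus ?thesis by simp
qed

text \<open>Oscillation near one is controlled by the increase along the real axis. If \<open>f\<close> is bounded on
  \<open>[0,1)\<close>, that increase tends to zero, which gives an unrestricted limit.\<close>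
lemma wall_class_near_one_finite:
  assumes f: "f \<in> wall_class" and z: "norm z < 1" and x: "0 \<le> x" "x < 1" and d: "norm (1 - z) \<le> 1 - x"
  defines "y \<equiv> max (norm z) ((1 + x) / 2)"
  shows "norm (f z - f (of_real x)) \<le> 4 * (Re (f (of_real y)) - Re (f (of_real x)))" and "y < 1"
proof -
  show y: "y < 1" using z x by (simp add: y_def)
  have y2: "y \<ge> norm z" "y - x \<ge> (1 - x) / 2" by (auto simp: y_def max_def field_simps)
  hence xy: "x \<le> y" using x by simp
  have "norm (1 * f z + (-1) * f (of_real x)) \<le> Re (of_real 4 * f (of_real y)) + Re (of_real (-4) * f (of_real x))"
  proof (rule wall_class_norm_le[OF f])
    fix t :: real assume t: "0 \<le> t" "t \<le> 1"
    define u where "u = 1 - of_real t * z"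
    have px: "1 - t * x > 0" and py: "1 - t * y > 0" using one_minus_mult_pos t x y by auto
    have u0: "u \<noteq> 0" using kernel_denominator_nonzero[OF z t] by (simp add: u_def)
    have uy: "norm u \<ge> 1 - t * y"
    proof -
      have "t * norm z \<le> t * y" using t y2 by (intro mult_left_mono) auto
      moreover have "norm u \<ge> 1 - t * norm z"
        using norm_triangle_ineq2[of 1 "of_real t * z"] t by (simp add: norm_mult u_def)
      ultimately show ?thesis by linarith
    qed
    have X: "of_real (1 - t * x) \<noteq> (0 :: complex)" using px by (simp del: of_real_diff)
    have "1 / u + (-1) / (1 - of_real t * of_real x) = 1 / u - 1 / of_real (1 - t * x)" by simp
    also have "\<dots> = (of_real (1 - t * x) - u) / (u * of_real (1 - t * x))"
      using u0 X by (simp add: diff_frac_eq del: of_real_diff)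
    also have "of_real (1 - t * x) - u = of_real t * (z - of_real x)"
      by (simp add: u_def algebra_simps)
    finally have e: "1 / u + (-1) / (1 - of_real t * of_real x) = of_real t * (z - of_real x) / (u * of_real (1 - t * x))" .
    have "norm (z - of_real x) \<le> norm (1 - z) + norm (1 - of_real x :: complex)"
      using norm_triangle_ineq4[of "1 - of_real x" "1 - z"] by simp
    also have "norm (1 - of_real x :: complex) = 1 - x"
      using x by (metis abs_of_nonneg diff_ge_0_iff_ge less_imp_le norm_of_real of_real_1 of_real_diff)
    finally have "norm (z - of_real x) \<le> 2 * (1 - x)" using d by simp
    also have "\<dots> \<le> 4 * (y - x)" using y2(2) by simp
    finally have nz: "norm (z - of_real x) \<le> 4 * (y - x)" .
    have "norm (of_real t * (z - of_real x) / (u * of_real (1 - t * x))) = t * norm (z - of_real x) / (norm u * (1 - t * x))"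
      using t px by (simp add: norm_divide norm_mult del: of_real_diff)
    also have "\<dots> \<le> t * (4 * (y - x)) / ((1 - t * y) * (1 - t * x))"
      using t px py uy nz xy by (intro frac_le mult_left_mono mult_right_mono mult_pos_pos mult_nonneg_nonneg) auto
    also have "\<dots> = 4 / (1 - t * y) + (-4) / (1 - t * x)"
      using px py by (simp add: divide_simps) (simp add: algebra_simps)
    finally show "norm (1 / (1 - of_real t * z) + (-1) / (1 - of_real t * of_real x)) \<le>
      Re (of_real 4 / (1 - of_real t * of_real y)) + Re (of_real (-4) / (1 - of_real t * of_real x))"
      unfolding Re_kernel_real u_def[symmetric] e .
  qed (use z x y mem_slit_plane_if_norm_less_1 in auto)
  thus "norm (f z - f (of_real x)) \<le> 4 * (Re (f (of_real y)) - Re (f (of_real x)))" by simp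
qed

text \<open>For \<open>1 - t \<ge> |1 - z|\<close> the real part of \<open>1/(1 - t z)\<close> is at least a quarter of \<open>1/(1 - t x)\<close>. For the
  remaining \<open>t\<close> nothing better than a nonnegative real part can be expected, so these are removed by
  the subtracted term; for a function without mass at \<open>t = 1\<close> this term is negligible.\<close>
lemma wall_class_near_one_infinite:
  assumes f: "f \<in> wall_class" and z: "norm z < 1" and x: "0 \<le> x" "x < 1"
    and d: "d = norm (1 - z)" "d < 1"
  shows "4 * Re (f z) \<ge> Re (f (of_real x)) - 2 / (1 - x) * (d * Re (f (of_real (1 - d))))"
proof -
  have d0: "d > 0" using d z by auto
  have "Re (of_real 4 * f z) + Re (of_real (-1) * f (of_real x)) + Re (of_real (2 / (1 - x) * d) * f (of_real (1 - d))) + Re (0 * f 0) \<ge> 0"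
  proof (rule wall_class_positive_functional4[OF f])
    fix t :: real assume t: "0 \<le> t" "t \<le> 1"
    have px: "1 - t * x > 0" and pd: "1 - t * (1 - d) > 0" using one_minus_mult_pos t x d0 by auto
    note k = norm_kernel_ge[OF z t]
    let ?u = "1 - of_real t * z"
    have Reu: "Re (4 / ?u) = 4 * (Re ?u / (norm ?u)\<^sup>2)" by (simp add: Re_divide cmod_power2)
    have third: "2 / (1 - x) * d / (1 - t * (1 - d)) \<ge> 0" using x d0 pd by simp
    have "4 * (Re ?u / (norm ?u)\<^sup>2) - 1 / (1 - t * x) + 2 / (1 - x) * d / (1 - t * (1 - d)) \<ge> 0"
    proof (cases "1 - t \<ge> d")
      case True
      hence t1: "1 - t > 0" using d0 by simp
      have "t * d \<le> d" using t d0 by (simp add: mult_left_le_one_le)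
      hence n: "norm ?u \<le> 2 * (1 - t)" using k(3) True unfolding d(1)[symmetric] by simp
      have npos: "norm ?u > 0" using k(1) t1 by linarith
      have "1 / s = 4 * (s / (2 * s)\<^sup>2)" if "s > 0" for s :: real
        using that by (simp add: power2_eq_square field_simps)
      from this[OF t1] have "1 / (1 - t) = 4 * ((1 - t) / (2 * (1 - t))\<^sup>2)" .
      also have "\<dots> \<le> 4 * (Re ?u / (norm ?u)\<^sup>2)"
        using n npos k(4) t1 by (intro mult_left_mono frac_le power_mono) auto
      finally have "1 / (1 - t) \<le> 4 * (Re ?u / (norm ?u)\<^sup>2)" .
      moreover have "t * x \<le> t * 1" using t x by (intro mult_left_mono) auto
      hence "1 / (1 - t * x) \<le> 1 / (1 - t)" using t1 by (intro frac_le) auto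
      ultimately show ?thesis using third by linarith
    next
      case False
      have "t * x \<le> 1 * x" using t x by (intro mult_right_mono) auto
      hence "1 / (1 - t * x) \<le> 1 / (1 - x)" using x by (intro frac_le) auto
      also have "\<dots> = 2 / (1 - x) * (1 / 2)" using x by (simp add: divide_simps)
      also have "\<dots> \<le> 2 / (1 - x) * (d / (1 - t * (1 - d)))"
      proof (intro mult_left_mono)
        have "t * d \<le> 1 * d" using t d0 by (intro mult_right_mono) auto
        moreover have "1 - t * (1 - d) = (1 - t) + t * d" by (simp add: algebra_simps)
        ultimately have "1 - t * (1 - d) \<le> 2 * d" using False by linarith
        thus "1 / 2 \<le> d / (1 - t * (1 - d))" using pd by (simp add: field_simps)
      qed (use x in simp)
      finally have "1 / (1 - t * x) \<le> 2 / (1 - x) * d / (1 - t * (1 - d))" by simp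
      moreover have "Re ?u / (norm ?u)\<^sup>2 \<ge> 0" using k(4) t by (intro divide_nonneg_nonneg) auto
      ultimately show ?thesis by linarith
    qed
    thus "Re (of_real 4 / (1 - of_real t * z)) + Re (of_real (-1) / (1 - of_real t * of_real x)) +
      Re (of_real (2 / (1 - x) * d) / (1 - of_real t * of_real (1 - d))) + Re (0 / (1 - of_real t * 0)) \<ge> 0"
      unfolding Re_kernel_real of_real_numeral Reu by simp
  qed (use z x d0 mem_slit_plane_if_norm_less_1 in \<open>auto simp del: of_real_diff\<close>)
  thus ?thesis by (simp add: algebra_simps)
qed

lemma Re_inverse_one_minus_ge:
  assumes "norm (z::complex) < 1" shows "Re (1 / (1 - z)) \<ge> 1 / 2"
  using Re_kernel_ge[OF assms, of 1] by simp

lemma dist_one_filterlim: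
  "filterlim (\<lambda>z. 1 - norm (1 - z)) (at_left 1) (at (1::complex) within ball 0 1)"
proof -
  have "((\<lambda>z::complex. 1 - norm (1 - z)) \<longlongrightarrow> 1 - norm (1 - 1 :: complex)) (at 1 within ball 0 1)"
    by (intro tendsto_intros)
  moreover have "eventually (\<lambda>z::complex. 1 - norm (1 - z) < 1) (at 1 within ball 0 1)"
    by (auto simp: eventually_at_filter)
  ultimately show ?thesis unfolding filterlim_at by (auto elim: eventually_mono)
qed

lemma eventually_near_one:
  assumes "d > 0"
  shows "eventually (\<lambda>z. norm z < 1 \<and> norm (1 - z) < d) (at (1::complex) within ball 0 1)"
  using assms unfolding eventually_at by (intro exI[of _ d]) (auto simp: dist_norm norm_minus_commute)

lemma wall_class_dual_tendsto_zero:
  assumes h: "h \<in> wall_class" and lim: "((\<lambda>x. (1 - x) * Re (h (of_real x))) \<longlongrightarrow> 0) (at_left 1)"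
  shows "((\<lambda>z. (1 - z) * h z) \<longlongrightarrow> 0) (at 1 within ball 0 1)"
proof (rule Lim_null_comparison)
  show "eventually (\<lambda>z. norm ((1 - z) * h z) \<le> 2 * (norm (1 - z) * Re (h (of_real (1 - norm (1 - z)))))) (at 1 within ball 0 1)"
    using eventually_near_one[OF zero_less_one]
    by eventually_elim (rule wall_class_dual_norm_le[OF h], simp_all)
  have "((\<lambda>z. (1 - (1 - norm (1 - z))) * Re (h (of_real (1 - norm (1 - z))))) \<longlongrightarrow> 0) (at (1::complex) within ball 0 1)"
    by (rule filterlim_compose[OF lim dist_one_filterlim])
  from tendsto_mult_right[OF this, of 2]
  show "((\<lambda>z. 2 * (norm (1 - z) * Re (h (of_real (1 - norm (1 - z)))))) \<longlongrightarrow> 0) (at (1::complex) within ball 0 1)"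
    by (simp add: mult.commute mult.left_commute)
qed

text \<open>The limit is the supremum along the real axis, on which members of the class are nondecreasing.\<close>
lemma wall_class_tendsto_finite:
  assumes h: "h \<in> wall_class" and B: "\<And>x. 0 \<le> x \<Longrightarrow> x < 1 \<Longrightarrow> Re (h (of_real x)) \<le> B"
  obtains L where "(h \<longlongrightarrow> of_real L) (at 1 within ball 0 1)" "\<And>x. 0 \<le> x \<Longrightarrow> x < 1 \<Longrightarrow> Re (h (of_real x)) \<le> L"
proof -
  define X where "X = (\<lambda>x. Re (h (of_real x))) ` {0..<1}"
  define L where "L = Sup X"
  have bdd: "bdd_above X" unfolding X_def using B by (auto intro!: bdd_aboveI2)
  have L: "Re (h (of_real x)) \<le> L" if "0 \<le> x" "x < 1" for x
    unfolding L_def using that by (intro cSup_upper bdd) (auto simp: X_def)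
  have "(h \<longlongrightarrow> of_real L) (at 1 within ball 0 1)"
  proof (rule tendstoI)
    fix e :: real assume e: "e > 0"
    have "X \<noteq> {}" by (auto simp: X_def)
    then obtain x where x: "0 \<le> x" "x < 1" "Re (h (of_real x)) > L - e / 5"
      using less_cSup_iff[of X "L - e / 5"] bdd e by (auto simp: L_def X_def)
    have "eventually (\<lambda>z. norm z < 1 \<and> norm (1 - z) < 1 - x) (at (1::complex) within ball 0 1)"
      using x by (intro eventually_near_one) auto
    thus "eventually (\<lambda>z. dist (h z) (of_real L) < e) (at 1 within ball 0 1)"
    proof eventually_elim
      case (elim z)
      hence z: "norm z < 1" "norm (1 - z) \<le> 1 - x" by auto
      define y where "y = max (norm z) ((1 + x) / 2)"
      have "0 \<le> y" by (simp add: y_def le_max_iff_disj)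
      have "norm (h z - h (of_real x)) \<le> 4 * (Re (h (of_real y)) - Re (h (of_real x)))" "y < 1"
        using wall_class_near_one_finite[OF h z(1) x(1,2) z(2)] by (simp_all add: y_def)
      hence "norm (h z - h (of_real x)) \<le> 4 * (L - Re (h (of_real x)))" using L[OF \<open>0 \<le> y\<close>] by fastforce
      moreover have "norm (h (of_real x) - of_real L) = L - Re (h (of_real x))"
      proof -
        have "h (of_real x) - of_real L = of_real (Re (h (of_real x)) - L)"
          using wall_class_real[OF h x(2)] by simp
        thus ?thesis using L[OF x(1,2)] by (simp only: norm_of_real)
      qed
      moreover have "norm (h z - of_real L) \<le> norm (h z - h (of_real x)) + norm (h (of_real x) - of_real L)"
        using norm_triangle_ineq[of "h z - h (of_real x)" "h (of_real x) - of_real L"] by simp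
      ultimately have "norm (h z - of_real L) \<le> 5 * (L - Re (h (of_real x)))" by simp
      also have "\<dots> < e" using x(3) by simp
      finally show ?case by (simp add: dist_norm)
    qed
  qed
  thus ?thesis using L that by blast
qed

lemma wall_class_tendsto_infinite:
  assumes h: "h \<in> wall_class" and lim: "((\<lambda>x. (1 - x) * Re (h (of_real x))) \<longlongrightarrow> 0) (at_left 1)"
    and unb: "\<And>B. \<exists>x\<ge>0. x < 1 \<and> Re (h (of_real x)) > B"
  shows "filterlim (\<lambda>z. Re (h z)) at_top (at 1 within ball 0 1)"
  unfolding filterlim_at_top
proof
  fix B :: real
  obtain x where x: "0 \<le> x" "x < 1" "Re (h (of_real x)) > 4 * B + 1" using unb by blast
  have "((\<lambda>z. (1 - (1 - norm (1 - z))) * Re (h (of_real (1 - norm (1 - z))))) \<longlongrightarrow> 0) (at (1::complex) within ball 0 1)"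
    by (rule filterlim_compose[OF lim dist_one_filterlim])
  from tendsto_mult_left[OF this, of "2 / (1 - x)"]
  have "((\<lambda>z. 2 / (1 - x) * (norm (1 - z) * Re (h (of_real (1 - norm (1 - z)))))) \<longlongrightarrow> 0) (at (1::complex) within ball 0 1)"
    by simp
  hence "eventually (\<lambda>z. 2 / (1 - x) * (norm (1 - z) * Re (h (of_real (1 - norm (1 - z))))) < 1) (at (1::complex) within ball 0 1)"
    by (rule order_tendstoD) simp
  with eventually_near_one[OF zero_less_one] show "eventually (\<lambda>z. B \<le> Re (h z)) (at 1 within ball 0 1)"
  proof eventually_elim
    case (elim z)
    have "4 * Re (h z) \<ge> Re (h (of_real x)) - 2 / (1 - x) * (norm (1 - z) * Re (h (of_real (1 - norm (1 - z)))))"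
      using elim x by (intro wall_class_near_one_infinite[OF h]) auto
    thus ?case using elim x by linarith
  qed
qed

text \<open>The map \<open>z \<mapsto> 1/(1-z)\<close> sends the disc to the half plane \<open>Re > 1/2\<close>. Its values along this sequence go to
  infinity while approaching the boundary line, so the points tend to one tangentially to the circle.\<close>
definition horocyclic_seq :: "nat \<Rightarrow> complex" where
  "horocyclic_seq n = 1 - 1 / Complex (1 / 2 + inverse (real (Suc n))) (real n)"

lemma norm_one_minus_inverse_less_1:
  assumes "Re v > 1 / 2" shows "norm (1 - 1 / v) < 1"
proof -
  have v: "v \<noteq> 0" using assms by auto
  have "(norm (v - 1))\<^sup>2 < (norm v)\<^sup>2"
    unfolding cmod_power2 using assms by (simp add: power2_eq_square algebra_simps)
  hence "norm (v - 1) < norm v" by (rule power2_less_imp_less) simp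
  moreover have "1 - 1 / v = (v - 1) / v" using v by (simp add: field_simps)
  ultimately show ?thesis using v by (simp add: norm_divide)
qed

lemma horocyclic_seq:
  shows "norm (horocyclic_seq n) < 1"
    and "Re (1 / (1 - horocyclic_seq n)) = 1 / 2 + inverse (real (Suc n))"
    and "filterlim horocyclic_seq (at 1 within ball 0 1) sequentially"
proof -
  define v where "v n = Complex (1 / 2 + inverse (real (Suc n))) (real n)" for n
  have z: "horocyclic_seq n = 1 - 1 / v n" for n by (simp add: horocyclic_seq_def v_def)
  show n: "norm (horocyclic_seq n) < 1" for n
    unfolding z by (rule norm_one_minus_inverse_less_1) (simp add: v_def)
  have "Re (v n) > 0" for n by (simp add: v_def add_pos_pos)
  hence "v n \<noteq> 0" for n by (metis less_irrefl zero_complex.sel(1))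
  hence "1 / (1 - horocyclic_seq n) = v n" by (simp add: z)
  thus "Re (1 / (1 - horocyclic_seq n)) = 1 / 2 + inverse (real (Suc n))" by (simp add: v_def)
  have "filterlim (\<lambda>n. norm (v n)) at_top sequentially"
  proof (rule filterlim_at_top_mono[OF filterlim_real_sequentially])
    have "real n \<le> norm (v n)" for n using abs_Im_le_cmod[of "v n"] by (simp add: v_def)
    thus "eventually (\<lambda>n. real n \<le> norm (v n)) sequentially" by (intro always_eventually) blast
  qed
  hence "filterlim v at_infinity sequentially"
    by (rule filterlim_norm_at_top_imp_at_infinity)
  hence "(\<lambda>n. inverse (v n)) \<longlonglongrightarrow> 0" by (rule filterlim_compose[OF tendsto_inverse_0])
  hence "(\<lambda>n. 1 - inverse (v n)) \<longlonglongrightarrow> 1 - 0" by (intro tendsto_intros)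
  hence "horocyclic_seq \<longlonglongrightarrow> 1" by (simp add: z[abs_def] inverse_eq_divide)
  moreover have "horocyclic_seq m \<in> ball 0 1 \<and> horocyclic_seq m \<noteq> 1" for m
    using n[of m] by auto
  ultimately show "filterlim horocyclic_seq (at 1 within ball 0 1) sequentially"
    unfolding filterlim_at by simp
qed

section \<open>Schur's algorithm\<close>

text \<open>The value at \<open>u\<close> of the finite Schur expansion with parameters \<open>\<gamma> 0, \<gamma> 1, \<dots>\<close>, closed off by the zero function after
  \<open>n\<close> steps.\<close>
fun schur_iter :: "nat \<Rightarrow> (nat \<Rightarrow> real) \<Rightarrow> complex \<Rightarrow> complex" where
  "schur_iter 0 \<gamma> u = 0"
| "schur_iter (Suc n) \<gamma> u = u * (of_real (\<gamma> 0) + schur_iter n (\<lambda>k. \<gamma> (Suc k)) u) /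
                              (1 + of_real (\<gamma> 0) * schur_iter n (\<lambda>k. \<gamma> (Suc k)) u)"

lemma mobius_denominator_nonzero:
  assumes "\<bar>g\<bar> \<le> 1" "norm (v :: complex) < 1"
  shows "1 + of_real g * v \<noteq> 0"
proof -
  have "norm (of_real g * v) \<le> 1 * norm v"
    unfolding norm_mult by (intro mult_right_mono) (use assms in auto)
  hence "norm (of_real g * v) < 1" using assms by simp
  thus ?thesis by (rule one_plus_nonzero)
qed

lemma norm_mobius_le_1:
  assumes "\<bar>g\<bar> \<le> 1" "norm (v :: complex) < 1"
  shows "norm ((of_real g + v) / (1 + of_real g * v)) \<le> 1"
proof -
  have "(norm (1 + of_real g * v))\<^sup>2 - (norm (of_real g + v))\<^sup>2 = (1 - g\<^sup>2) * (1 - (norm v)\<^sup>2)"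
    unfolding cmod_power2 by (simp add: power2_eq_square algebra_simps)
  moreover have "\<dots> \<ge> 0"
    using assms by (intro mult_nonneg_nonneg) (simp_all add: abs_square_le_1 power_le_one)
  ultimately have "(norm (of_real g + v))\<^sup>2 \<le> (norm (1 + of_real g * v))\<^sup>2"
    by linarith
  hence "norm (of_real g + v) \<le> norm (1 + of_real g * v)"
    by (rule power2_le_imp_le) simp
  thus ?thesis using mobius_denominator_nonzero[OF assms] by (simp add: norm_divide)
qed

lemma norm_schur_iter:
  assumes "\<And>k. \<bar>\<gamma> k\<bar> \<le> 1" "norm u < 1"
  shows "norm (schur_iter n \<gamma> u) \<le> norm u"
  using assms
proof (induction n arbitrary: \<gamma>)
  case 0
  show ?case by simp
next
  case (Suc n)
  let ?v = "schur_iter n (\<lambda>k. \<gamma> (Suc k)) u"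
  have "norm ?v \<le> norm u" by (intro Suc.IH Suc.prems)
  hence "norm ?v < 1" using Suc.prems(2) by linarith
  hence "norm u * norm ((of_real (\<gamma> 0) + ?v) / (1 + of_real (\<gamma> 0) * ?v)) \<le> norm u * 1"
    by (intro mult_left_mono norm_mobius_le_1 Suc.prems(1)) auto
  thus ?case by (simp only: schur_iter.simps times_divide_eq_right[symmetric] norm_mult mult_1_right)
qed

lemma schur_iter_denominator_nonzero:
  assumes "\<And>k. \<bar>\<gamma> k\<bar> \<le> 1" "norm u < 1" "\<bar>g\<bar> \<le> 1"
  shows "1 + of_real g * schur_iter n \<gamma> u \<noteq> 0"
proof -
  have "norm (schur_iter n \<gamma> u) \<le> norm u" by (intro norm_schur_iter assms)
  thus ?thesis using assms(2,3) by (intro mobius_denominator_nonzero) linarith+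
qed

lemma schur_iter_holomorphic:
  assumes "\<And>k. \<bar>\<gamma> k\<bar> \<le> 1"
  shows "schur_iter n \<gamma> holomorphic_on ball 0 1"
  using assms
proof (induction n arbitrary: \<gamma>)
  case 0
  show ?case by simp
next
  case (Suc n)
  let ?v = "schur_iter n (\<lambda>k. \<gamma> (Suc k))"
  have hol: "?v holomorphic_on ball 0 1" by (rule Suc.IH) (rule Suc.prems)
  have nz: "1 + of_real (\<gamma> 0) * ?v u \<noteq> 0" if "u \<in> ball 0 1" for u
    by (rule schur_iter_denominator_nonzero) (use that in \<open>simp_all add: Suc.prems\<close>)
  show ?case unfolding schur_iter.simps
    by (intro holomorphic_intros hol nz)
qed

lemma schur_iter_cnj: "schur_iter n \<gamma> (cnj u) = cnj (schur_iter n \<gamma> u)"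
  by (induction n arbitrary: \<gamma>) simp_all

lemma schur_iter_has_fps_expansion:
  assumes "\<And>k. \<bar>\<gamma> k\<bar> \<le> 1"
  shows "schur_iter n \<gamma> has_fps_expansion fps_expansion (schur_iter n \<gamma>) 0"
  using schur_iter_holomorphic[OF assms]
  by (intro analytic_at_imp_has_fps_expansion_0) (auto simp: analytic_at intro!: exI[of _ "ball 0 1"])

text \<open>Each step multiplies the discrepancy between two tails by \<open>u\<close> times a unit, hence raises its order of
  vanishing by one.\<close>
lemma schur_iter_coeff:
  fixes \<Omega> :: "nat \<Rightarrow> complex fps"
  assumes "\<And>k. \<bar>\<gamma> k\<bar> \<le> 1"
    and "\<And>k. \<Omega> k * (1 + fps_const (of_real (\<gamma> k)) * \<Omega> (Suc k)) =
              fps_X * (fps_const (of_real (\<gamma> k)) + \<Omega> (Suc k))"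
    and "\<And>k. fps_nth (\<Omega> k) 0 = 0" and "j \<le> n"
  shows "fps_nth (fps_expansion (schur_iter n \<gamma>) 0) j = fps_nth (\<Omega> 0) j"
  using assms
proof (induction n arbitrary: \<gamma> \<Omega> j)
  case 0
  show ?case using 0(3)[of 0] 0(4) by (simp add: fps_expansion_def)
next
  case (Suc n)
  define \<gamma>' where "\<gamma>' k = \<gamma> (Suc k)" for k
  define g :: "complex fps" where "g = fps_const (of_real (\<gamma> 0))"
  define S where "S = fps_expansion (schur_iter (Suc n) \<gamma>) 0"
  define S' where "S' = fps_expansion (schur_iter n \<gamma>') 0"
  have \<gamma>': "\<bar>\<gamma>' k\<bar> \<le> 1" for k using Suc.prems by (simp add: \<gamma>'_def)
  have eq: "fps_nth S' i = fps_nth (\<Omega> (Suc 0)) i" if "i \<le> n" for i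
    unfolding S'_def using Suc.prems(2,3) \<gamma>' that
    by (intro Suc.IH[of \<gamma>' "\<lambda>k. \<Omega> (Suc k)"]) (auto simp: \<gamma>'_def)
  have S0: "schur_iter (Suc n) \<gamma> has_fps_expansion S"
    unfolding S_def by (intro schur_iter_has_fps_expansion Suc.prems)
  have S'0: "schur_iter n \<gamma>' has_fps_expansion S'"
    unfolding S'_def by (intro schur_iter_has_fps_expansion \<gamma>')
  have "(\<lambda>u. schur_iter (Suc n) \<gamma> u * (1 + of_real (\<gamma> 0) * schur_iter n \<gamma>' u)) has_fps_expansion S * (1 + g * S')"
    unfolding g_def by (intro fps_expansion_intros S0 S'0)
  moreover have R: "(\<lambda>u. u * (of_real (\<gamma> 0) + schur_iter n \<gamma>' u)) has_fps_expansion fps_X * (g + S')"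
    unfolding g_def by (intro fps_expansion_intros S'0)
  moreover have "eventually (\<lambda>u. schur_iter (Suc n) \<gamma> u * (1 + of_real (\<gamma> 0) * schur_iter n \<gamma>' u) =
        u * (of_real (\<gamma> 0) + schur_iter n \<gamma>' u)) (nhds 0)"
  proof -
    have "eventually (\<lambda>u. u \<in> ball (0::complex) 1) (nhds 0)" by (intro eventually_nhds_in_open) auto
    thus ?thesis
    proof eventually_elim
      case (elim u)
      have "1 + of_real (\<gamma> 0) * schur_iter n \<gamma>' u \<noteq> 0"
        by (rule schur_iter_denominator_nonzero) (use elim in \<open>simp_all add: \<gamma>' Suc.prems(1)\<close>)
      moreover have "(\<lambda>k. \<gamma> (Suc k)) = \<gamma>'" by (simp add: \<gamma>'_def fun_eq_iff)
      ultimately show ?case by simp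
    qed
  qed
  ultimately have "(\<lambda>u. u * (of_real (\<gamma> 0) + schur_iter n \<gamma>' u)) has_fps_expansion S * (1 + g * S')"
    by (simp only: has_fps_expansion_cong)
  from this R have rel: "S * (1 + g * S') = fps_X * (g + S')" by (rule fps_expansion_unique_complex)
  \<comment> \<open>The unit by which the difference of the two expansions is cleared of denominators.\<close>
  define U where "U = (1 + g * \<Omega> (Suc 0)) * (1 + g * S')"
  have U0: "fps_nth U 0 \<noteq> 0" using Suc.prems(3) eq[of 0] by (simp add: U_def)
  have rel': "\<Omega> 0 * (1 + g * \<Omega> (Suc 0)) = fps_X * (g + \<Omega> (Suc 0))"
    using Suc.prems(2)[of 0] by (simp add: g_def)
  have "(\<Omega> 0 - S) * U = (\<Omega> 0 * (1 + g * \<Omega> (Suc 0))) * (1 + g * S') - (S * (1 + g * S')) * (1 + g * \<Omega> (Suc 0))"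
    by (simp add: U_def algebra_simps)
  also have "\<dots> = fps_X * ((1 - g * g) * (\<Omega> (Suc 0) - S'))"
    unfolding rel rel' by (simp add: algebra_simps)
  finally have *: "(\<Omega> 0 - S) * U = fps_X * ((1 - g * g) * (\<Omega> (Suc 0) - S'))" .
  have z: "fps_nth ((\<Omega> 0 - S) * U) i = 0" if "i \<le> Suc n" for i
    unfolding * using that eq by (cases i) (auto simp: fps_mult_nth intro!: sum.neutral)
  have "\<Omega> 0 - S = ((\<Omega> 0 - S) * U) * inverse U"
    using inverse_mult_eq_1'[OF U0] by (simp add: mult.assoc)
  hence "fps_nth (\<Omega> 0 - S) j = (\<Sum>i=0..j. fps_nth ((\<Omega> 0 - S) * U) i * fps_nth (inverse U) (j - i))"
    by (metis fps_mult_nth)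
  also have "\<dots> = 0" using z Suc.prems(4) by (intro sum.neutral) auto
  finally show ?case by (simp add: S_def del: schur_iter.simps)
qed

text \<open>Cauchy's inequalities on circles of radius \<open>r < 1\<close>, with \<open>r\<close> tending to one.\<close>
lemma coeff_le_1_if_bounded:
  assumes f: "f holomorphic_on ball 0 1" and b: "\<And>u. norm u < 1 \<Longrightarrow> norm (f u) \<le> 1"
  shows "norm (fps_nth (fps_expansion f 0) k) \<le> 1"
proof -
  have "norm ((deriv ^^ k) f 0 / fact k) \<le> 1 / r ^ k" if r: "0 < r" "r < 1" for r
  proof -
    have "norm ((deriv ^^ k) f 0) \<le> fact k * 1 / r ^ k"
    proof (rule Cauchy_inequality)
      show "f holomorphic_on ball 0 r" using r by (intro holomorphic_on_subset[OF f]) auto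
      show "continuous_on (cball 0 r) f"
        using r by (intro holomorphic_on_imp_continuous_on holomorphic_on_subset[OF f]) auto
    qed (use r b in auto)
    thus ?thesis by (simp add: norm_divide field_simps)
  qed
  hence ev: "eventually (\<lambda>r. norm ((deriv ^^ k) f 0 / fact k) \<le> 1 / r ^ k) (at_left 1)"
    using eventually_at_left_real[of 0 1] by (auto elim!: eventually_mono)
  have "((\<lambda>r::real. 1 / r ^ k) \<longlongrightarrow> 1 / 1 ^ k) (at_left 1)" by (intro tendsto_intros) auto
  from tendsto_lowerbound[OF this ev] show ?thesis by (simp add: fps_expansion_def)
qed

text \<open>Every coefficient of \<open>\<Omega> 0\<close> is a coefficient of some truncation, hence at most one in modulus. So the
  series converges on the disc and is the limit of the truncations, from which it inherits their bound and symmetry.\<close>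
theorem schur_algorithm_converges:
  fixes \<Omega> :: "nat \<Rightarrow> complex fps"
  assumes \<gamma>: "\<And>k. \<bar>\<gamma> k\<bar> \<le> 1"
    and rec: "\<And>k. \<Omega> k * (1 + fps_const (of_real (\<gamma> k)) * \<Omega> (Suc k)) =
              fps_X * (fps_const (of_real (\<gamma> k)) + \<Omega> (Suc k))"
    and zero: "\<And>k. fps_nth (\<Omega> k) 0 = 0"
  shows "fps_conv_radius (\<Omega> 0) \<ge> 1"
    and "norm u < 1 \<Longrightarrow> norm (eval_fps (\<Omega> 0) u) \<le> norm u"
    and "norm u < 1 \<Longrightarrow> eval_fps (\<Omega> 0) (cnj u) = cnj (eval_fps (\<Omega> 0) u)"
proof -
  define S where "S n = fps_expansion (schur_iter n \<gamma>) 0" for n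
  have S: "norm (fps_nth (S n) k) \<le> 1" for n k
    unfolding S_def using norm_schur_iter[OF \<gamma>]
    by (intro coeff_le_1_if_bounded schur_iter_holomorphic \<gamma>) (meson less_imp_le order.trans)
  have eq: "fps_nth (S n) j = fps_nth (\<Omega> 0) j" if "j \<le> n" for n j
    unfolding S_def by (rule schur_iter_coeff[where \<gamma> = \<gamma> and \<Omega> = \<Omega>, OF \<gamma> rec zero that])
  have O: "norm (fps_nth (\<Omega> 0) k) \<le> 1" for k using S[of k k] eq[of k k] by simp
  have summ: "summable (\<lambda>k. norm (fps_nth F k * u ^ k))"
    if "\<And>k. norm (fps_nth F k) \<le> B" "norm u < 1" for F :: "complex fps" and u B
  proof (rule summable_comparison_test')
    show "summable (\<lambda>k. B * norm u ^ k)" using that by (intro summable_mult summable_geometric) auto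
    show "norm (norm (fps_nth F k * u ^ k)) \<le> B * norm u ^ k" for k
      using that by (auto simp: norm_mult norm_power intro!: mult_right_mono)
  qed
  show rad: "fps_conv_radius (\<Omega> 0) \<ge> 1"
    unfolding fps_conv_radius_def
  proof (rule conv_radius_geI_ex')
    fix r :: real assume "0 < r" "ereal r < 1"
    thus "summable (\<lambda>n. fps_nth (\<Omega> 0) n * of_real r ^ n)"
      by (intro summable_norm_cancel[OF summ[OF O]]) auto
  qed
  have lim: "(\<lambda>n. schur_iter n \<gamma> u) \<longlonglongrightarrow> eval_fps (\<Omega> 0) u" if u: "norm u < 1" for u
  proof -
    have bound: "norm (eval_fps (\<Omega> 0) u - schur_iter n \<gamma> u) \<le> 2 * norm u ^ Suc n / (1 - norm u)" for n
    proof -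
      define D where "D = \<Omega> 0 - S n"
      have D: "norm (fps_nth D k) \<le> 2" "k \<le> n \<Longrightarrow> fps_nth D k = 0" for k
        using norm_triangle_ineq4[of "fps_nth (\<Omega> 0) k" "fps_nth (S n) k"] O[of k] S[of n k] eq[of k n]
        by (auto simp: D_def)
      have "(\<lambda>k. fps_nth (\<Omega> 0) k * u ^ k) sums eval_fps (\<Omega> 0) u"
        using sums_eval_fps[of u "\<Omega> 0"] rad u by (metis ereal_less(3) less_le_trans)
      moreover have "(\<lambda>k. fps_nth (S n) k * u ^ k) sums schur_iter n \<gamma> u"
        unfolding S_def using u
        by (intro has_fps_expansion_imp_sums_complex[where r = 1] schur_iter_has_fps_expansion \<gamma>)
           (use schur_iter_holomorphic[OF \<gamma>] in \<open>auto simp: one_ereal_def\<close>)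
      ultimately have "(\<lambda>k. fps_nth D k * u ^ k) sums (eval_fps (\<Omega> 0) u - schur_iter n \<gamma> u)"
        unfolding D_def fps_sub_nth ring_distribs by (rule sums_diff)
      hence "(\<lambda>k. fps_nth D (k + Suc n) * u ^ (k + Suc n)) sums
               (eval_fps (\<Omega> 0) u - schur_iter n \<gamma> u - (\<Sum>k<Suc n. fps_nth D k * u ^ k))"
        by (subst sums_iff_shift)  simp
      moreover have "(\<Sum>k<Suc n. fps_nth D k * u ^ k) = 0"
        using D(2) by (intro sum.neutral) auto
      ultimately have s: "(\<lambda>k. fps_nth D (k + Suc n) * u ^ (k + Suc n)) sums (eval_fps (\<Omega> 0) u - schur_iter n \<gamma> u)"
        by simp
      have g: "(\<lambda>k. 2 * norm u ^ Suc n * norm u ^ k) sums (2 * norm u ^ Suc n * (1 / (1 - norm u)))"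
        using u by (intro sums_mult geometric_sums) auto
      have "norm (\<Sum>k. fps_nth D (k + Suc n) * u ^ (k + Suc n)) \<le> (\<Sum>k. 2 * norm u ^ Suc n * norm u ^ k)"
      proof (rule norm_suminf_le)
        show "norm (fps_nth D (k + Suc n) * u ^ (k + Suc n)) \<le> 2 * norm u ^ Suc n * norm u ^ k" for k
          using mult_right_mono[OF D(1)[of "k + Suc n"], of "norm u ^ (k + Suc n)"]
          by (simp add: norm_mult norm_power power_add mult_ac)
      qed (use g in \<open>simp add: sums_iff\<close>)
      thus ?thesis using s g by (simp add: sums_iff)
    qed
    have "(\<lambda>n. norm u ^ n) \<longlonglongrightarrow> 0" using u by (intro LIMSEQ_power_zero) simp
    from tendsto_mult_left[OF this, of "2 * norm u / (1 - norm u)"]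
    have lim0: "(\<lambda>n. 2 * norm u ^ Suc n / (1 - norm u)) \<longlonglongrightarrow> 0" by (simp add: mult.assoc)
    have "(\<lambda>n. eval_fps (\<Omega> 0) u - schur_iter n \<gamma> u) \<longlonglongrightarrow> 0"
      by (rule Lim_null_comparison[OF always_eventually lim0]) (use bound in blast)
    from tendsto_diff[OF tendsto_const[of "eval_fps (\<Omega> 0) u"] this]
    show ?thesis by simp
  qed
  show "norm (eval_fps (\<Omega> 0) u) \<le> norm u" if u: "norm u < 1"
    using norm_schur_iter[OF \<gamma> u] by (intro tendsto_upperbound[OF tendsto_norm[OF lim[OF u]]]) auto
  show "eval_fps (\<Omega> 0) (cnj u) = cnj (eval_fps (\<Omega> 0) u)" if u: "norm u < 1"
  proof -
    have "(\<lambda>n. schur_iter n \<gamma> (cnj u)) \<longlonglongrightarrow> cnj (eval_fps (\<Omega> 0) u)"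
      unfolding schur_iter_cnj by (intro tendsto_cnj lim u)
    moreover have "(\<lambda>n. schur_iter n \<gamma> (cnj u)) \<longlonglongrightarrow> eval_fps (\<Omega> 0) (cnj u)"
      using u by (intro lim) auto
    ultimately show ?thesis by (rule LIMSEQ_unique[symmetric])
  qed
qed

section \<open>The hypergeometric series\<close>

definition hyp_fps :: "real \<Rightarrow> real \<Rightarrow> real \<Rightarrow> complex fps" where
  "hyp_fps a b c = Abs_fps (\<lambda>n. of_real (pochhammer a n * pochhammer b n / (pochhammer c n * fact n)))"

lemma hyp2F1_series_eq_eval_hyp_fps: "hyp2F1_series a b c = eval_fps (hyp_fps a b c)"
  by (rule ext) (simp add: hyp2F1_series_altdef eval_fps_def hyp_fps_def)

lemma hyp_fps_nth_0 [simp]: "fps_nth (hyp_fps a b c) 0 = 1"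
  by (simp add: hyp_fps_def)

lemma eval_hyp_fps_0 [simp]: "eval_fps (hyp_fps a b c) 0 = 1"
  by (simp add: eval_fps_at_0)

lemma hyp_fps_commute: "hyp_fps b a c = hyp_fps a b c"
  by (simp add: hyp_fps_def mult.commute)

text \<open>The factor that leads from one coefficient to the next tends to one. A bound on quotients, rather than
  their limit, is used because all coefficients may vanish from some index on, as they do for \<open>b = 0\<close>.\<close>
lemma hyp_fps_conv_radius:
  assumes "c > 0"
  shows "fps_conv_radius (hyp_fps a b c) \<ge> 1"
  unfolding fps_conv_radius_def
proof (rule conv_radius_geI_ex')
  fix r :: real assume r: "0 < r" "ereal r < 1"
  define q where "q = (1 + r) / 2"
  have q: "r < q" "q < 1" using r by (auto simp: q_def)
  have "((\<lambda>n::nat. (a + n) * (b + n) / ((c + n) * (1 + n)) * r) \<longlongrightarrow> r) at_top"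
    by real_asymp
  hence "((\<lambda>n::nat. \<bar>(a + n) * (b + n) / ((c + n) * (1 + n)) * r\<bar>) \<longlongrightarrow> \<bar>r\<bar>) at_top"
    by (rule tendsto_rabs)
  hence "eventually (\<lambda>n::nat. \<bar>(a + n) * (b + n) / ((c + n) * (1 + n)) * r\<bar> < q) at_top"
    using q r by (intro order_tendstoD) auto
  then obtain N where N: "\<And>n. n \<ge> N \<Longrightarrow> \<bar>(a + real n) * (b + real n) / ((c + real n) * (1 + real n)) * r\<bar> < q"
    by (auto simp: eventually_at_top_linorder)
  show "summable (\<lambda>n. fps_nth (hyp_fps a b c) n * of_real r ^ n)"
  proof (rule summable_ratio_test[OF q(2), of N])
    fix n assume n: "n \<ge> N"
    define A where "A = pochhammer a n * pochhammer b n / (pochhammer c n * fact n) * r ^ n"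
    have A1: "pochhammer a (Suc n) * pochhammer b (Suc n) / (pochhammer c (Suc n) * fact (Suc n)) * r ^ Suc n =
       ((a + n) * (b + n) / ((c + n) * (1 + n)) * r) * A"
      by (simp add: A_def pochhammer_Suc mult_ac)
    have "\<bar>((a + n) * (b + n) / ((c + n) * (1 + n)) * r) * A\<bar> \<le> q * \<bar>A\<bar>"
      unfolding abs_mult[of _ A] using N[OF n] by (intro mult_right_mono) auto
    moreover have "norm (fps_nth (hyp_fps a b c) n * of_real r ^ n) = \<bar>A\<bar>"
      by (simp add: hyp_fps_def A_def flip: of_real_power of_real_mult del: of_real_divide of_real_mult of_real_power)
    moreover have "norm (fps_nth (hyp_fps a b c) (Suc n) * of_real r ^ Suc n) =
       \<bar>((a + n) * (b + n) / ((c + n) * (1 + n)) * r) * A\<bar>"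
      unfolding A1[symmetric] hyp_fps_def fps_nth_Abs_fps of_real_power[symmetric] of_real_mult[symmetric] norm_of_real ..
    ultimately show "norm (fps_nth (hyp_fps a b c) (Suc n) * of_real r ^ Suc n) \<le>
          q * norm (fps_nth (hyp_fps a b c) n * of_real r ^ n)" by simp
  qed
qed

lemma pochhammer_shift: "x * pochhammer (x + 1) n = (x + real n) * pochhammer (x :: real) n"
  using pochhammer_rec[of x n] by (simp add: pochhammer_Suc mult.commute)

lemma hyp_fps_numerator_shift:
  assumes "c > 0"
  shows "hyp_fps (a + 1) b c - hyp_fps a b c =
         fps_const (of_real (b / c)) * (fps_X * hyp_fps (a + 1) (b + 1) (c + 1))"
proof (rule fps_ext)
  fix n
  show "fps_nth (hyp_fps (a + 1) b c - hyp_fps a b c) n =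
        fps_nth (fps_const (of_real (b / c)) * (fps_X * hyp_fps (a + 1) (b + 1) (c + 1))) n"
  proof (cases n)
    case (Suc m)
    define P Q R f where "P = pochhammer (a + 1) m" "Q = pochhammer (b + 1) m"
      "R = pochhammer (c + 1) m" "f = (fact m :: real)"
    have pos: "R > 0" "f > 0" using assms by (auto simp: P_Q_R_f_def intro: pochhammer_pos)
    have e: "pochhammer (a + 1) (Suc m) = P * (a + 1 + m)" "pochhammer a (Suc m) = a * P"
            "pochhammer b (Suc m) = b * Q" "pochhammer c (Suc m) = c * R" "fact (Suc m) = (real m + 1) * f"
      by (simp_all add: P_Q_R_f_def pochhammer_Suc pochhammer_rec[of a] pochhammer_rec[of b] pochhammer_rec[of c]
           del: pochhammer_Suc) (simp_all add: pochhammer_Suc add.commute)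
    have "P * (a + 1 + m) * (b * Q) / (c * R * ((real m + 1) * f)) - a * P * (b * Q) / (c * R * ((real m + 1) * f))
          = b / c * (P * Q / (R * f))"
      using pos assms by (simp add: divide_simps) (simp add: algebra_simps)
    hence "pochhammer (a + 1) n * pochhammer b n / (pochhammer c n * fact n) - pochhammer a n * pochhammer b n / (pochhammer c n * fact n)
      = b / c * (pochhammer (a + 1) m * pochhammer (b + 1) m / (pochhammer (c + 1) m * fact m))"
      unfolding Suc e by (simp add: P_Q_R_f_def)
    hence "complex_of_real (pochhammer (a + 1) n * pochhammer b n / (pochhammer c n * fact n)) -
           of_real (pochhammer a n * pochhammer b n / (pochhammer c n * fact n))
      = of_real (b / c) * of_real (pochhammer (a + 1) m * pochhammer (b + 1) m / (pochhammer (c + 1) m * fact m))"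
      by (simp only: of_real_diff[symmetric] of_real_mult[symmetric])
    thus ?thesis by (simp add: hyp_fps_def Suc del: of_real_mult of_real_divide)
  qed simp
qed

lemma hyp_fps_contiguous:
  assumes "c > 0"
  shows "fps_const (of_real (c - b)) * hyp_fps a b (c + 1) + fps_const (of_real b) * hyp_fps a (b + 1) (c + 1)
         = fps_const (of_real c) * hyp_fps a b c"
proof (rule fps_ext)
  fix n
  define P B B' C C' f where "P = pochhammer a n" "B = pochhammer b n" "B' = pochhammer (b + 1) n"
    "C = pochhammer c n" "C' = pochhammer (c + 1) n" "f = (fact n :: real)"
  note defs = this
  have pos: "C > 0" "C' > 0" "f > 0" using assms by (auto simp: defs intro: pochhammer_pos)
  have e: "b * B' = (b + n) * B" "c * C' = (c + n) * C" unfolding defs by (rule pochhammer_shift)+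
  have "(c - b) * (P * B / (C' * f)) + b * (P * B' / (C' * f)) = P / (C' * f) * ((c - b) * B + b * B')"
    by (simp add: algebra_simps add_divide_distrib diff_divide_distrib)
  also have "\<dots> = P / (C' * f) * (B * (c + n))" by (simp only: e) (simp add: algebra_simps)
  also have "\<dots> = c * (P * B / (C * f))"
    using pos e(2) by (simp add: divide_simps)
  finally have "complex_of_real (c - b) * of_real (P * B / (C' * f)) + of_real b * of_real (P * B' / (C' * f))
     = of_real c * of_real (P * B / (C * f))" by (simp only: of_real_add[symmetric] of_real_mult[symmetric])
  thus "fps_nth (fps_const (of_real (c - b)) * hyp_fps a b (c + 1) + fps_const (of_real b) * hyp_fps a (b + 1) (c + 1)) n
         = fps_nth (fps_const (of_real c) * hyp_fps a b c) n"
    by (simp add: hyp_fps_def defs del: of_real_mult of_real_divide of_real_diff)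
qed

lemma hyp_fps_euler_operator:
  "fps_X * fps_deriv (hyp_fps a b c) = fps_const (of_real a) * (hyp_fps (a + 1) b c - hyp_fps a b c)"
proof (rule fps_ext)
  fix n
  define A where "A = pochhammer a n"
  define K where "K = pochhammer b n / (pochhammer c n * fact n)"
  have "real n * (A * K) = a * pochhammer (a + 1) n * K - a * A * K"
    unfolding pochhammer_shift A_def by (simp add: algebra_simps)
  hence "complex_of_real (real n) * of_real (A * K) = of_real a * (of_real (pochhammer (a + 1) n * K) - of_real (A * K))"
    by (simp only: of_real_diff[symmetric] of_real_mult[symmetric]) (simp add: algebra_simps)
  thus "fps_nth (fps_X * fps_deriv (hyp_fps a b c)) n = fps_nth (fps_const (of_real a) * (hyp_fps (a + 1) b c - hyp_fps a b c)) n"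
    by (cases n) (simp_all add: hyp_fps_def A_def K_def del: of_real_mult of_real_divide of_nat_Suc pochhammer_Suc)
qed

text \<open>The hypergeometric equation \<open>z (1 - z) F'' + (c - (a + b + 1) z) F' = a b F\<close>, which is the recursion
  \<open>(n + 1) (c + n) A\<^sub>n\<^sub>+\<^sub>1 = (a + n) (b + n) A\<^sub>n\<close> for the coefficients.\<close>
lemma hyp_fps_ode:
  assumes "c > 0"
  shows "fps_X * fps_deriv (fps_deriv (hyp_fps a b c)) + fps_const (of_real c) * fps_deriv (hyp_fps a b c) =
    fps_X * (fps_X * fps_deriv (fps_deriv (hyp_fps a b c))) +
    fps_const (of_real (a + b + 1)) * (fps_X * fps_deriv (hyp_fps a b c)) + fps_const (of_real (a * b)) * hyp_fps a b c"
proof (rule fps_ext)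
  fix n
  define A where "A n = pochhammer a n * pochhammer b n / (pochhammer c n * fact n)" for n
  have nth: "fps_nth (hyp_fps a b c) k = of_real (A k)" for k by (simp add: hyp_fps_def A_def)
  have rec: "(real n + 1) * (c + real n) * A (Suc n) = (a + n) * (b + n) * A n"
  proof -
    have "pochhammer c n > 0" "c + real n > 0" using assms by (auto intro: pochhammer_pos)
    thus ?thesis by (simp add: A_def pochhammer_Suc divide_simps)
  qed
  have r: "of_nat n * (of_nat (Suc n) * of_real (A (Suc n))) + of_real c * (of_nat (Suc n) * of_real (A (Suc n)))
    = complex_of_real ((real n + 1) * (c + real n) * A (Suc n))" by (simp add: algebra_simps)
  show "fps_nth (fps_X * fps_deriv (fps_deriv (hyp_fps a b c)) + fps_const (of_real c) * fps_deriv (hyp_fps a b c)) n =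
    fps_nth (fps_X * (fps_X * fps_deriv (fps_deriv (hyp_fps a b c))) +
    fps_const (of_real (a + b + 1)) * (fps_X * fps_deriv (hyp_fps a b c)) + fps_const (of_real (a * b)) * hyp_fps a b c) n"
  proof -
    have "fps_nth (fps_X * fps_deriv (fps_deriv (hyp_fps a b c)) + fps_const (of_real c) * fps_deriv (hyp_fps a b c)) n =
      of_nat n * (of_nat (Suc n) * of_real (A (Suc n))) + of_real c * (of_nat (Suc n) * of_real (A (Suc n)))"
      by (cases n) (simp_all add: nth)
    moreover have "fps_nth (fps_X * (fps_X * fps_deriv (fps_deriv (hyp_fps a b c))) +
       fps_const (of_real (a + b + 1)) * (fps_X * fps_deriv (hyp_fps a b c)) + fps_const (of_real (a * b)) * hyp_fps a b c) n
      = of_real ((a + n) * (b + n) * A n)"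
    proof (cases n)
      case (Suc m)
      thus ?thesis by (cases m) (simp_all add: nth algebra_simps)
    qed (simp add: nth A_def)
    ultimately show ?thesis by (simp only: r rec)
  qed
qed

section \<open>Gauss' continued fraction\<close>

text \<open>The parameters of the tails of the continued fraction of \<open>F(a+1,b;c;z)/F(a,b;c;z)\<close>. Letting the first two change
  places gives one uniform step in place of the usual alternation of odd and even steps.\<close>
fun gauss_params :: "nat \<Rightarrow> real \<times> real \<times> real \<Rightarrow> real \<times> real \<times> real" where
  "gauss_params 0 p = p"
| "gauss_params (Suc n) p = (case gauss_params n p of (a, b, c) \<Rightarrow> (b, a + 1, c + 1))"

lemma gauss_params_bounds:
  assumes "0 \<le> a" "a \<le> c" "0 \<le> b" "b \<le> c" "0 < c" "gauss_params n (a, b, c) = (a', b', c')"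
  shows "0 \<le> a' \<and> a' \<le> c' \<and> 0 \<le> b' \<and> b' \<le> c' \<and> 0 < c'"
  using assms by (induction n arbitrary: a' b' c') (auto split: prod.splits)

definition gauss_ratio :: "real \<times> real \<times> real \<Rightarrow> complex \<Rightarrow> complex" where
  "gauss_ratio p z = (case p of (a, b, c) \<Rightarrow> eval_fps (hyp_fps (a + 1) b c) z / eval_fps (hyp_fps a b c) z)"

text \<open>One step of the continued fraction. The contiguous relations express numerator and denominator
  of \<open>W\<close> through the same pair of series, the denominator and numerator of \<open>W'\<close>.\<close>
lemma gauss_ratio_step:
  assumes c: "c > 0" and z: "norm z < 1"
    and nz: "eval_fps (hyp_fps a b c) z \<noteq> 0" "eval_fps (hyp_fps b (a + 1) (c + 1)) z \<noteq> 0"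
  defines "g \<equiv> complex_of_real (b / c)"
  defines "W \<equiv> gauss_ratio (a, b, c) z" and "W' \<equiv> gauss_ratio (b, a + 1, c + 1) z"
  shows "W * (1 - g + g * (1 - z) * W') = 1 - g + g * W'"
proof -
  define A B C D where "A = eval_fps (hyp_fps a b c) z" "B = eval_fps (hyp_fps (a + 1) b c) z"
    "C = eval_fps (hyp_fps (a + 1) b (c + 1)) z" "D = eval_fps (hyp_fps (a + 1) (b + 1) (c + 1)) z"
  note defs = this
  have rad: "ereal (norm z) < fps_conv_radius (hyp_fps a' b' c')" if "c' > 0" for a' b' c'
    using hyp_fps_conv_radius[OF that, of a' b'] z by (meson ereal_less(3) less_le_trans)
  have rX: "ereal (norm z) < fps_conv_radius (fps_X * hyp_fps (a + 1) (b + 1) (c + 1))"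
    using rad[of "c + 1" "a + 1" "b + 1"] c fps_conv_radius_mult[of "fps_X :: complex fps" "hyp_fps (a + 1) (b + 1) (c + 1)"]
    by (auto simp: less_le_trans)
  have "eval_fps (hyp_fps (a + 1) b c - hyp_fps a b c) z =
        eval_fps (fps_const (of_real (b / c)) * (fps_X * hyp_fps (a + 1) (b + 1) (c + 1))) z"
    by (simp only: hyp_fps_numerator_shift[OF c])
  hence 1: "B - A = g * (z * D)"
    using rad c rX by (simp add: eval_fps_diff eval_fps_mult defs g_def)
  have "eval_fps (fps_const (of_real (c - b)) * hyp_fps (a + 1) b (c + 1) +
             fps_const (of_real b) * hyp_fps (a + 1) (b + 1) (c + 1)) z = eval_fps (fps_const (of_real c) * hyp_fps (a + 1) b c) z"
    by (simp only: hyp_fps_contiguous[OF c])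
  moreover have "ereal (norm z) < fps_conv_radius (fps_const (complex_of_real k) * hyp_fps a' b' c')" if "c' > 0" for a' b' c' k
    using rad[OF that, of a' b'] fps_conv_radius_mult[of "fps_const (complex_of_real k)" "hyp_fps a' b' c'"]
    by (auto simp: less_le_trans)
  ultimately have "of_real (c - b) * C + of_real b * D = of_real c * B"
    using rad c by (simp add: eval_fps_add eval_fps_mult defs del: of_real_diff)
  hence "(of_real (c - b) * C + of_real b * D) / of_real c = B" using c by simp
  hence 2: "(1 - g) * C + g * D = B"
    using c by (simp add: g_def add_divide_distrib diff_divide_distrib left_diff_distrib)
  have AC: "A \<noteq> 0" "C \<noteq> 0" using nz by (simp_all add: defs hyp_fps_commute[of b "a + 1"])
  have WW: "W = B / A" "W' = D / C"
    by (simp_all add: W_def W'_def gauss_ratio_def defs hyp_fps_commute[of b "a + 1"] hyp_fps_commute[of "b + 1" "a + 1"])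
  have 3: "(1 - g) * C + g * (1 - z) * D = A" using 1 2 by (simp add: algebra_simps)
  have "W * (1 - g + g * (1 - z) * W') = B / A * (((1 - g) * C + g * (1 - z) * D) / C)"
    using AC by (simp add: WW add_divide_distrib)
  also have "\<dots> = B / C" using AC by (simp add: 3)
  also have "\<dots> = 1 - g + g * W'" using AC by (simp add: 2[symmetric] WW add_divide_distrib)
  finally show ?thesis .
qed

text \<open>With \<open>s = sqrt(1-z)\<close> the step reads \<open>\<phi> = ((1-g) s + g \<phi>')/((1-g) + g s \<phi>')\<close> for \<open>\<phi> = s W\<close>. The Cayley
  transform of \<open>s\<close> is \<open>u\<close>, and that of \<open>\<phi>\<close> obeys the Schur recursion with parameter \<open>1 - 2g\<close>.\<close>
lemma schur_step_of_ratio_step: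
  fixes s W W' g u :: complex
  assumes "W * (1 - g + g * s\<^sup>2 * W') = 1 - g + g * W'"
    and s: "s * (1 + u) = 1 - u" "1 + u \<noteq> 0"
    and nz: "1 + s * W \<noteq> 0" "1 + s * W' \<noteq> 0"
  defines "w \<equiv> (1 - s * W) / (1 + s * W)" and "w' \<equiv> (1 - s * W') / (1 + s * W')"
  shows "w * (1 + (1 - 2 * g) * w') = u * ((1 - 2 * g) + w')"
proof -
  define p p' where "p = s * W" "p' = s * W'"
  have "s * (W * (1 - g + g * s\<^sup>2 * W')) = s * (1 - g + g * W')" using assms(1) by simp
  hence rel: "p * (1 - g + g * s * p') = (1 - g) * s + g * p'"
    by (simp add: p_p'_def power2_eq_square algebra_simps)
  have "1 + s \<noteq> 0"
  proof
    assume "1 + s = 0"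
    hence "s = -1" by (simp add: add_eq_0_iff)
    thus False using s(1) by (simp add: algebra_simps)
  qed
  have u: "u = (1 - s) / (1 + s)"
    using s(1) \<open>1 + s \<noteq> 0\<close> by (simp add: nonzero_eq_divide_eq) (simp add: algebra_simps)
  have "(1 - p) * (1 - g + g * p') * (1 + s) = (1 - s) * (1 - g - g * p') * (1 + p)"
    using rel by algebra
  hence "(1 - p) * ((1 + p') + (1 - 2 * g) * (1 - p')) * (1 + s) = (1 - s) * ((1 - 2 * g) * (1 + p') + (1 - p')) * (1 + p)"
    by algebra
  moreover have "w * (1 + (1 - 2 * g) * w') = (1 - p) * ((1 + p') + (1 - 2 * g) * (1 - p')) / ((1 + p) * (1 + p'))"
    using nz by (simp add: w_def w'_def p_p'_def[symmetric] divide_simps)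
  moreover have "u * ((1 - 2 * g) + w') = (1 - s) * ((1 - 2 * g) * (1 + p') + (1 - p')) / ((1 + s) * (1 + p'))"
    using nz \<open>1 + s \<noteq> 0\<close> by (simp add: u w'_def p_p'_def[symmetric] divide_simps)
  moreover have "x / ((1 + p) * (1 + p')) = y / ((1 + s) * (1 + p'))" if "x * (1 + s) = y * (1 + p)" for x y
  proof -
    have "x / (1 + p) = y / (1 + s)"
      using that nz \<open>1 + s \<noteq> 0\<close> by (simp add: frac_eq_eq p_p'_def)
    thus ?thesis by (simp only: divide_divide_eq_left[symmetric])
  qed
  ultimately show ?thesis by (simp only: mult.assoc mult.commute mult.left_commute)
qed

lemma isCont_eventually_neq:
  fixes f :: "'a::t2_space \<Rightarrow> 'b::t1_space"
  assumes "isCont f x" "f x \<noteq> c"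
  shows "eventually (\<lambda>y. f y \<noteq> c) (nhds x)"
proof -
  have "(f \<longlongrightarrow> f x) (nhds x)"
    using assms(1) by (simp add: isCont_def tendsto_at_iff_tendsto_nhds)
  from topological_tendstoD[OF this, of "- {c}"] show ?thesis using assms(2) by auto
qed

lemma cayley_involution: "1 + x \<noteq> 0 \<Longrightarrow> (1 - (1 - x) / (1 + x)) / (1 + (1 - x) / (1 + x)) = (x :: complex)"
proof -
  assume nz: "1 + x \<noteq> 0"
  have "1 - (1 - x) / (1 + x) = 2 * x / (1 + x)" "1 + (1 - x) / (1 + x) = 2 / (1 + x)"
    using nz by (simp_all add: divide_simps) 
  thus ?thesis using nz by simp
qed

text \<open>The germ at zero to which Schur's algorithm is applied. Only a neighbourhood of zero matters, since farther out
  the denominators might vanish.\<close>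
definition gauss_schur :: "real \<times> real \<times> real \<Rightarrow> complex \<Rightarrow> complex" where
  "gauss_schur p u = (1 - (1 - u) / (1 + u) * gauss_ratio p (koebe u)) / (1 + (1 - u) / (1 + u) * gauss_ratio p (koebe u))"

lemma koebe_0 [simp]: "koebe 0 = 0" and koebe_inv_0 [simp]: "koebe_inv 0 = 0"
  by (simp_all add: koebe_def koebe_inv_def)

lemma gauss_ratio_0 [simp]: "gauss_ratio p 0 = 1"
  by (cases p) (simp add: gauss_ratio_def)

lemma gauss_schur_0 [simp]: "gauss_schur p 0 = 0"
  by (simp add: gauss_schur_def)

lemma koebe_analytic_0: "koebe analytic_on {0}"
  using koebe_holomorphic by (auto simp: analytic_at intro!: exI[of _ "ball 0 1"])

lemma eval_hyp_koebe_analytic: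
  assumes "c > 0" shows "(\<lambda>u. eval_fps (hyp_fps a b c) (koebe u)) analytic_on {0}"
proof -
  have "eval_fps (hyp_fps a b c) analytic_on {0}"
    using hyp_fps_conv_radius[OF assms, of a b]
    by (intro analytic_on_eval_fps) (auto simp: zero_ereal_def[symmetric] intro: less_le_trans[of 0 1])
  thus ?thesis using analytic_on_compose_gen[OF koebe_analytic_0, of _ "{0}"] by (auto simp: o_def)
qed

lemma eventually_eval_hyp_koebe_nonzero:
  assumes "c > 0" shows "eventually (\<lambda>u. eval_fps (hyp_fps a b c) (koebe u) \<noteq> 0) (nhds 0)"
proof -
  have "isCont (\<lambda>u. eval_fps (hyp_fps a b c) (koebe u)) 0"
    by (intro analytic_at_imp_isCont eval_hyp_koebe_analytic assms)
  thus ?thesis by (intro isCont_eventually_neq) auto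
qed

lemma gauss_ratio_koebe_analytic:
  assumes "snd (snd p) > 0" shows "(\<lambda>u. gauss_ratio p (koebe u)) analytic_on {0}"
  using assms unfolding gauss_ratio_def
  by (cases p) (auto intro!: analytic_on_divide eval_hyp_koebe_analytic)

lemma gauss_schur_analytic:
  assumes "snd (snd p) > 0" shows "gauss_schur p analytic_on {0}"
  unfolding gauss_schur_def
  by (intro analytic_intros gauss_ratio_koebe_analytic assms) auto

lemma eventually_one_plus_ratio_nonzero:
  assumes "snd (snd p) > 0"
  shows "eventually (\<lambda>u. 1 + (1 - u) / (1 + u) * gauss_ratio p (koebe u) \<noteq> 0) (nhds 0)"
proof -
  have "(\<lambda>u. 1 + (1 - u) / (1 + u) * gauss_ratio p (koebe u)) analytic_on {0}"
    by (intro analytic_intros gauss_ratio_koebe_analytic assms) auto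
  hence "isCont (\<lambda>u. 1 + (1 - u) / (1 + u) * gauss_ratio p (koebe u)) 0" by (rule analytic_at_imp_isCont)
  thus ?thesis by (intro isCont_eventually_neq) auto
qed

lemma gauss_schur_step:
  assumes "c > 0"
  shows "eventually (\<lambda>u. gauss_schur (a, b, c) u * (1 + of_real (1 - 2 * (b / c)) * gauss_schur (b, a + 1, c + 1) u) =
           u * (of_real (1 - 2 * (b / c)) + gauss_schur (b, a + 1, c + 1) u)) (nhds 0)"
proof -
  have c1: "0 < c + 1" using assms by simp
  have "eventually (\<lambda>u. u \<in> ball (0::complex) 1) (nhds 0)" by (intro eventually_nhds_in_open) auto
  moreover have "eventually (\<lambda>u. koebe u \<in> ball 0 1) (nhds 0)"
    using analytic_at_imp_isCont[OF koebe_analytic_0]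
    by (intro topological_tendstoD[of koebe "koebe 0"]) (auto simp: isCont_def tendsto_nhds_iff continuous_at)
  moreover note eventually_eval_hyp_koebe_nonzero[OF assms, of a b]
    eventually_eval_hyp_koebe_nonzero[OF c1, of b "a + 1"]
    eventually_one_plus_ratio_nonzero[of "(a, b, c)", simplified, OF assms]
    eventually_one_plus_ratio_nonzero[of "(b, a + 1, c + 1)", simplified, OF c1]
  ultimately show ?thesis
  proof eventually_elim
    case (elim u)
    define s where "s = (1 - u) / (1 + u)"
    have u: "norm u < 1" using elim by simp
    note nu = one_plus_nonzero[OF u]
    have "gauss_ratio (a, b, c) (koebe u) * (1 - of_real (b / c) + of_real (b / c) * (1 - koebe u) * gauss_ratio (b, a + 1, c + 1) (koebe u)) =
          1 - of_real (b / c) + of_real (b / c) * gauss_ratio (b, a + 1, c + 1) (koebe u)"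
      using elim assms by (intro gauss_ratio_step) auto
    hence "gauss_ratio (a, b, c) (koebe u) * (1 - of_real (b / c) + of_real (b / c) * s\<^sup>2 * gauss_ratio (b, a + 1, c + 1) (koebe u)) =
          1 - of_real (b / c) + of_real (b / c) * gauss_ratio (b, a + 1, c + 1) (koebe u)"
      unfolding koebe_eq[OF u] s_def .
    from schur_step_of_ratio_step[OF this _ nu] nu elim
    show ?case by (simp add: gauss_schur_def s_def[symmetric]) (simp add: s_def)
  qed
qed

text \<open>Under the stated bounds on the parameters all quotients \<open>b/c\<close> met in the continued fraction lie in \<open>[0,1]\<close>, so all Schur parameters lie in
  \<open>[-1,1]\<close>. The bounded function found by Schur's algorithm is carried back to the slit plane by the
  inverse Cayley transform and the inverse Koebe map.\<close>
theorem gauss_ratio_wall_class: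
  assumes "0 \<le> a" "a \<le> c" "0 \<le> b" "b \<le> c" "0 < c"
  obtains f where "f \<in> wall_class" "eventually (\<lambda>z. f z = gauss_ratio (a, b, c) z) (nhds 0)"
proof -
  define p where "p n = gauss_params n (a, b, c)" for n
  define \<gamma> where "\<gamma> n = (case p n of (a, b, c) \<Rightarrow> 1 - 2 * (b / c))" for n
  define \<Omega> where "\<Omega> n = fps_expansion (gauss_schur (p n)) 0" for n
  have pb: "0 \<le> a' \<and> a' \<le> c' \<and> 0 \<le> b' \<and> b' \<le> c' \<and> 0 < c'" if "p n = (a', b', c')" for n a' b' c'
    using gauss_params_bounds[OF assms] that by (simp add: p_def)
  have \<gamma>: "\<bar>\<gamma> n\<bar> \<le> 1" for n
    using pb[of n] by (cases "p n") (auto simp: \<gamma>_def abs_le_iff field_simps)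
  have exp: "gauss_schur (p n) has_fps_expansion \<Omega> n" for n
    unfolding \<Omega>_def using pb[of n] by (intro analytic_at_imp_has_fps_expansion_0 gauss_schur_analytic) (cases "p n", auto)
  have zero: "fps_nth (\<Omega> n) 0 = 0" for n
    by (simp add: \<Omega>_def fps_expansion_def)
  have rec: "\<Omega> n * (1 + fps_const (of_real (\<gamma> n)) * \<Omega> (Suc n)) = fps_X * (fps_const (of_real (\<gamma> n)) + \<Omega> (Suc n))" for n
  proof -
    obtain a' b' c' where p: "p n = (a', b', c')" by (cases "p n") auto
    hence pS: "p (Suc n) = (b', a' + 1, c' + 1)" by (simp add: p_def)
    have c': "c' > 0" using pb[OF p] by simp
    have L: "(\<lambda>u. gauss_schur (p n) u * (1 + of_real (\<gamma> n) * gauss_schur (p (Suc n)) u)) has_fps_expansion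
          \<Omega> n * (1 + fps_const (of_real (\<gamma> n)) * \<Omega> (Suc n))" by (intro fps_expansion_intros exp)
    have R: "(\<lambda>u. u * (of_real (\<gamma> n) + gauss_schur (p (Suc n)) u)) has_fps_expansion
          fps_X * (fps_const (of_real (\<gamma> n)) + \<Omega> (Suc n))" by (intro fps_expansion_intros exp)
    have "eventually (\<lambda>u. gauss_schur (p n) u * (1 + of_real (\<gamma> n) * gauss_schur (p (Suc n)) u) =
            u * (of_real (\<gamma> n) + gauss_schur (p (Suc n)) u)) (nhds 0)"
      using gauss_schur_step[OF c', of a' b'] unfolding p pS by (simp add: \<gamma>_def p)
    with L have "(\<lambda>u. u * (of_real (\<gamma> n) + gauss_schur (p (Suc n)) u)) has_fps_expansion
          \<Omega> n * (1 + fps_const (of_real (\<gamma> n)) * \<Omega> (Suc n))" by (simp only: has_fps_expansion_cong)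
    thus ?thesis using R by (rule fps_expansion_unique_complex)
  qed
  note schur = schur_algorithm_converges[where \<gamma> = \<gamma> and \<Omega> = \<Omega>, OF \<gamma> rec zero]
  define w where "w = eval_fps (\<Omega> 0)"
  define f where "f z = (1 - w (koebe_inv z)) / (1 + w (koebe_inv z)) / csqrt (1 - z)" for z
  have w0: "w 0 = 0" by (simp add: w_def eval_fps_at_0 zero)
  have w1: "norm (w u) < 1" if "norm u < 1" for u
    using schur(2)[OF that] that by (simp add: w_def)
  have whol: "w holomorphic_on ball 0 1"
  proof -
    have "ball 0 1 \<subseteq> eball (0::complex) (fps_conv_radius (\<Omega> 0))"
      using schur(1) by (auto simp: in_eball_iff) (metis ereal_less(3) less_le_trans)
    thus ?thesis unfolding w_def by (intro holomorphic_on_eval_fps) 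
  qed
  have "(w \<circ> koebe_inv) holomorphic_on slit_plane"
    by (intro holomorphic_on_compose_gen[OF koebe_inv_holomorphic whol]) (use norm_koebe_inv in auto)
  hence wk: "(\<lambda>z. w (koebe_inv z)) holomorphic_on slit_plane" by (simp add: o_def)
  have wk1: "norm (w (koebe_inv z)) < 1" if "z \<in> slit_plane" for z
    using that by (intro w1 norm_koebe_inv)
  have snz: "csqrt (1 - z) \<noteq> 0" if "z \<in> slit_plane" for z using Re_csqrt_slit_plane[OF that] by auto
  have "f \<in> wall_class"
    unfolding wall_class_def
  proof (intro CollectI conjI ballI)
    show "f holomorphic_on slit_plane"
      unfolding f_def by (intro holomorphic_intros wk csqrt_one_minus_holomorphic one_plus_nonzero wk1 snz)
    show "f 0 = 1" by (simp add: f_def w0)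
    fix z assume z: "z \<in> slit_plane"
    show "f (cnj z) = cnj (f z)"
      using schur(3)[OF norm_koebe_inv[OF z]] z
      by (simp add: f_def koebe_inv_cnj csqrt_one_minus_cnj w_def del: csqrt.simps)
    have "csqrt (1 - z) * f z = (1 - w (koebe_inv z)) / (1 + w (koebe_inv z))"
      using snz[OF z] by (simp add: f_def del: csqrt.simps)
    thus "Re (csqrt (1 - z) * f z) > 0" using Re_cayley_pos[OF wk1[OF z]] by metis
  qed
  moreover have "eventually (\<lambda>z. f z = gauss_ratio (a, b, c) z) (nhds 0)"
  proof -
    have p0: "p 0 = (a, b, c)" by (simp add: p_def)
    have ev: "eventually (\<lambda>u. w u = gauss_schur (a, b, c) u \<and> 1 + (1 - u) / (1 + u) * gauss_ratio (a, b, c) (koebe u) \<noteq> 0) (nhds 0)"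
      using exp[of 0] assms eventually_one_plus_ratio_nonzero[of "(a, b, c)"]
      by (auto simp: has_fps_expansion_def w_def p0 intro: eventually_conj)
    have "isCont koebe_inv 0"
      using koebe_inv_holomorphic open_slit_plane
      by (metis continuous_on_eq_continuous_at holomorphic_on_imp_continuous_on mem_slit_plane_simps(1))
    hence "filterlim koebe_inv (nhds 0) (nhds 0)"
      by (metis continuous_at koebe_inv_0 tendsto_at_iff_tendsto_nhds isCont_def)
    from eventually_compose_filterlim[OF ev this]
    have "eventually (\<lambda>z. w (koebe_inv z) = gauss_schur (a, b, c) (koebe_inv z) \<and>
       1 + (1 - koebe_inv z) / (1 + koebe_inv z) * gauss_ratio (a, b, c) (koebe (koebe_inv z)) \<noteq> 0) (nhds 0)" .
    moreover have "eventually (\<lambda>z. z \<in> slit_plane) (nhds 0)"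
      by (intro eventually_nhds_in_open open_slit_plane) auto
    ultimately show ?thesis
    proof eventually_elim
      case (elim z)
      let ?s = "csqrt (1 - z)" and ?W = "gauss_ratio (a, b, c) z"
      have s: "(1 - koebe_inv z) / (1 + koebe_inv z) = ?s"
        using csqrt_koebe[OF norm_koebe_inv[OF elim(2)]] koebe_koebe_inv[OF elim(2)] by metis
      have "1 + ?s * ?W \<noteq> 0" "w (koebe_inv z) = (1 - ?s * ?W) / (1 + ?s * ?W)"
        using elim by (auto simp: gauss_schur_def s koebe_koebe_inv simp del: csqrt.simps)
      hence "(1 - w (koebe_inv z)) / (1 + w (koebe_inv z)) = ?s * ?W"
        by (metis cayley_involution)
      thus ?case using snz[OF elim(2)] by (simp add: f_def del: csqrt.simps)
    qed
  qed
  ultimately show ?thesis using that by blast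
qed

section \<open>Analytic continuation of the hypergeometric function\<close>

text \<open>The slit plane is connected, so a continuation is determined by its values on the disc.\<close>
lemma hyp2F1_eqI:
  assumes F: "F holomorphic_on slit_plane"
    and eq: "\<And>z. z \<in> ball 0 1 \<Longrightarrow> F z = eval_fps (hyp_fps a b c) z" and z: "z \<in> slit_plane"
  shows "hyp2F1 a b c z = F z"
proof -
  let ?P = "\<lambda>F. F holomorphic_on (- complex_of_real ` {1..}) \<and> (\<forall>z\<in>ball 0 1. F z = hyp2F1_series a b c z)"
  have "?P F" using F eq by (simp add: slit_plane_def hyp2F1_series_eq_eval_hyp_fps)
  hence P: "?P (hyp2F1 a b c)" unfolding hyp2F1_def by (rule someI[of ?P F])
  show ?thesis
  proof (rule analytic_continuation_open[where f = "hyp2F1 a b c" and g = F and s = "ball 0 1" and s' = slit_plane])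
    show "hyp2F1 a b c holomorphic_on slit_plane" using P by (simp add: slit_plane_def)
    fix z :: complex assume "z \<in> ball 0 1"
    thus "hyp2F1 a b c z = F z" using P eq by (simp add: hyp2F1_series_eq_eval_hyp_fps)
  qed (use F z open_slit_plane connected_slit_plane ball_subset_slit_plane in auto)
qed

lemma eval_hyp_fps_holomorphic:
  assumes "c > 0" shows "eval_fps (hyp_fps a b c) holomorphic_on ball 0 1"
proof -
  have "ball 0 1 \<subseteq> eball (0::complex) (fps_conv_radius (hyp_fps a b c))"
    using hyp_fps_conv_radius[OF assms, of a b]
    by (auto simp: in_eball_iff) (metis ereal_less(3) less_le_trans)
  thus ?thesis by (intro holomorphic_on_eval_fps)
qed

lemma norm_less_hyp_fps_conv_radius:
  assumes "c > 0" "norm (z::complex) < 1"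
  shows "ereal (norm z) < fps_conv_radius (hyp_fps a b c)"
  using hyp_fps_conv_radius[OF assms(1), of a b] assms(2) by (meson ereal_less(3) less_le_trans)

lemma eval_hyp_fps_has_derivative:
  assumes "c > 0" "norm z < 1"
  shows "(eval_fps (hyp_fps a b c) has_field_derivative eval_fps (fps_deriv (hyp_fps a b c)) z) (at z)"
  by (intro has_field_derivative_eval_fps norm_less_hyp_fps_conv_radius assms)

lemma norm_less_deriv_conv_radius:
  fixes F :: "complex fps" and z :: complex
  assumes "ereal (norm z) < fps_conv_radius F"
  shows "ereal (norm z) < fps_conv_radius (fps_deriv F)"
  using fps_conv_radius_deriv[of F] assms by simp

lemma norm_less_mult_conv_radius:
  fixes F G :: "complex fps" and z :: complex
  assumes "ereal (norm z) < fps_conv_radius F" "ereal (norm z) < fps_conv_radius G"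
  shows "ereal (norm z) < fps_conv_radius (F * G)"
  by (rule less_le_trans[OF _ fps_conv_radius_mult]) (simp add: assms)

lemma norm_less_add_conv_radius:
  fixes F G :: "complex fps" and z :: complex
  assumes "ereal (norm z) < fps_conv_radius F" "ereal (norm z) < fps_conv_radius G"
  shows "ereal (norm z) < fps_conv_radius (F + G)"
  by (rule less_le_trans[OF _ fps_conv_radius_add]) (simp add: assms)

lemma norm_less_diff_conv_radius:
  fixes F G :: "complex fps" and z :: complex
  assumes "ereal (norm z) < fps_conv_radius F" "ereal (norm z) < fps_conv_radius G"
  shows "ereal (norm z) < fps_conv_radius (F - G)"
  by (rule less_le_trans[OF _ fps_conv_radius_diff]) (simp add: assms)

lemmas conv_radius_rules =
  norm_less_hyp_fps_conv_radius norm_less_deriv_conv_radius norm_less_mult_conv_radius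
  norm_less_add_conv_radius norm_less_diff_conv_radius

lemma eval_hyp_fps_euler_operator:
  assumes "c > 0" "norm z < 1"
  shows "z * eval_fps (fps_deriv (hyp_fps a b c)) z =
         of_real a * (eval_fps (hyp_fps (a + 1) b c) z - eval_fps (hyp_fps a b c) z)"
proof -
  have "eval_fps (fps_X * fps_deriv (hyp_fps a b c)) z =
        eval_fps (fps_const (of_real a) * (hyp_fps (a + 1) b c - hyp_fps a b c)) z"
    by (simp only: hyp_fps_euler_operator)
  thus ?thesis using assms by (simp add: eval_fps_mult eval_fps_diff conv_radius_rules)
qed

lemma eval_hyp_fps_ode:
  fixes a b c :: real and z :: complex
  assumes "c > 0" "norm z < 1"
  defines "F1 \<equiv> eval_fps (fps_deriv (hyp_fps a b c)) z"
    and "F2 \<equiv> eval_fps (fps_deriv (fps_deriv (hyp_fps a b c))) z"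
  shows "z * F2 + of_real c * F1 =
         z * (z * F2) + of_real (a + b + 1) * (z * F1) + of_real (a * b) * eval_fps (hyp_fps a b c) z"
proof -
  have "eval_fps (fps_X * fps_deriv (fps_deriv (hyp_fps a b c)) + fps_const (of_real c) * fps_deriv (hyp_fps a b c)) z =
    eval_fps (fps_X * (fps_X * fps_deriv (fps_deriv (hyp_fps a b c))) +
    fps_const (of_real (a + b + 1)) * (fps_X * fps_deriv (hyp_fps a b c)) + fps_const (of_real (a * b)) * hyp_fps a b c) z"
    by (simp only: hyp_fps_ode[OF assms(1)])
  thus ?thesis using assms(1,2)
    by (simp add: eval_fps_mult eval_fps_add conv_radius_rules F1_def F2_def del: of_real_mult of_real_add)
qed

text \<open>The relation \<open>z F' = a (w - 1) F\<close> and a primitive of \<open>a (w - 1)/z\<close>, which exists since the slit plane is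
  starlike, give the continuation of \<open>F\<close> as an exponential. In particular \<open>F\<close> has no zeros there.\<close>
theorem hyp2F1_wall_class_ratio:
  assumes abc: "0 \<le> a" "a \<le> c" "0 \<le> b" "b \<le> c" "0 < c"
  obtains w where "w \<in> wall_class" "\<And>z. z \<in> slit_plane \<Longrightarrow> hyp2F1 a b c z \<noteq> 0"
    "\<And>z. z \<in> slit_plane \<Longrightarrow> hyp2F1 (a + 1) b c z = w z * hyp2F1 a b c z"
    "\<And>z. norm z < 1 \<Longrightarrow> hyp2F1 a b c z = eval_fps (hyp_fps a b c) z"
    "\<And>z. norm z < 1 \<Longrightarrow> eval_fps (hyp_fps (a + 1) b c) z = w z * eval_fps (hyp_fps a b c) z"
proof -
  obtain w where w: "w \<in> wall_class" and ev: "eventually (\<lambda>z. w z = gauss_ratio (a, b, c) z) (nhds 0)"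
    using gauss_ratio_wall_class[OF abc] by blast
  define H H1 where "H = eval_fps (hyp_fps a b c)" and "H1 = eval_fps (hyp_fps (a + 1) b c)"
  have hol: "H holomorphic_on ball 0 1" "H1 holomorphic_on ball 0 1"
    unfolding H_def H1_def by (intro eval_hyp_fps_holomorphic abc)+
  have whol: "w holomorphic_on slit_plane" by (rule wall_class_holomorphic[OF w])
  have cont: "isCont H 0"
    using hol(1) by (metis centre_in_ball continuous_on_eq_continuous_at holomorphic_on_imp_continuous_on open_ball zero_less_one)
  have "eventually (\<lambda>z. H1 z = w z * H z) (nhds 0)"
    using ev isCont_eventually_neq[OF cont, of 0]
    by (auto simp: H_def H1_def gauss_ratio_def elim: eventually_elim2)
  then obtain S where S: "open S" "0 \<in> S" "\<And>z. z \<in> S \<Longrightarrow> H1 z = w z * H z"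
    by (auto simp: eventually_nhds)
  have wH: "H1 z = w z * H z" if z: "norm z < 1" for z
  proof (rule analytic_continuation_open[where f = H1 and g = "\<lambda>z. w z * H z" and s = "S \<inter> ball 0 1" and s' = "ball 0 1"])
    show "(\<lambda>z. w z * H z) holomorphic_on ball 0 1"
      by (intro holomorphic_intros hol holomorphic_on_subset[OF whol] ball_subset_slit_plane)
    show "S \<inter> ball 0 1 \<noteq> {}" using S(2) by force
  qed (use S hol z in auto)
  \<comment> \<open>The quotient \<open>(w - 1)/z\<close> with its removable singularity filled in.\<close>
  define q where "q z = (if z = 0 then deriv (\<lambda>z. w z - 1) 0 else (w z - 1) / z)" for z
  have "q holomorphic_on slit_plane"
  proof (rule pole_theorem_0[where g = "\<lambda>z. w z - 1" and a = 0])
    show "0 \<in> interior slit_plane" using open_slit_plane by (simp add: interior_open)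
  qed (auto simp: q_def wall_class_0[OF w] intro!: holomorphic_intros whol)
  hence "\<exists>A. \<forall>z\<in>slit_plane. (A has_field_derivative q z) (at z)"
    by (intro holomorphic_starlike_primitive[where k = "{}"] starlike_slit_plane open_slit_plane
         holomorphic_on_imp_continuous_on holomorphic_on_imp_differentiable_at[of _ slit_plane]) auto
  then obtain A where A: "\<And>z. z \<in> slit_plane \<Longrightarrow> (A has_field_derivative q z) (at z)" by blast
  define E where "E z = exp (of_real a * (A z - A 0))" for z
  have E': "(E has_field_derivative (of_real a * q z * E z)) (at z)" if "z \<in> slit_plane" for z
    unfolding E_def by (auto intro!: derivative_eq_intros A that)
  have Ehol: "E holomorphic_on slit_plane"
    using E' open_slit_plane by (auto simp: holomorphic_on_open)
  have HE: "H z = E z" if z: "norm z < 1" for z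
  proof -
    have cont: "continuous_on (ball 0 1) (\<lambda>z. H z / E z)"
      by (intro holomorphic_on_imp_continuous_on holomorphic_intros hol
            holomorphic_on_subset[OF Ehol] ball_subset_slit_plane) (auto simp: E_def)
    have diff: "((\<lambda>z. H z / E z) has_field_derivative 0) (at z)" if z: "z \<in> ball 0 1 - {0}" for z
    proof -
      have zs: "z \<in> slit_plane" using z ball_subset_slit_plane by auto
      have "z * eval_fps (fps_deriv (hyp_fps a b c)) z = of_real a * ((w z - 1) * H z)"
        using eval_hyp_fps_euler_operator[of c z a b] wH[of z] z abc by (simp add: H_def H1_def algebra_simps)
      hence d: "eval_fps (fps_deriv (hyp_fps a b c)) z = of_real a * q z * H z"
        using z by (simp add: q_def field_simps)
      have "(H has_field_derivative of_real a * q z * H z) (at z)"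
        using eval_hyp_fps_has_derivative[of c z a b] z abc d by (simp add: H_def)
      thus ?thesis
        by (auto intro!: derivative_eq_intros E'[OF zs] A[OF zs] simp: E_def)
    qed
    have "(\<lambda>z. H z / E z) constant_on ball 0 1"
      by (rule DERIV_zero_connected_constant_on[OF _ _ _ cont, of "{0}"]) (auto intro: diff)
    then obtain k where k: "\<And>z. z \<in> ball 0 1 \<Longrightarrow> H z / E z = k" by (auto simp: constant_on_def)
    have "k = 1" using k[of 0] by (simp add: H_def E_def)
    thus ?thesis using k[of z] z by (simp add: E_def field_simps)
  qed
  have F: "hyp2F1 a b c z = E z" if "z \<in> slit_plane" for z
    using that by (intro hyp2F1_eqI Ehol) (use HE in \<open>auto simp: H_def\<close>)
  have F1: "hyp2F1 (a + 1) b c z = w z * E z" if "z \<in> slit_plane" for z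
    using that by (intro hyp2F1_eqI holomorphic_intros whol Ehol) (use HE wH in \<open>auto simp: H_def H1_def\<close>)
  show ?thesis
  proof (rule that[OF w])
    show "hyp2F1 a b c z = eval_fps (hyp_fps a b c) z" if "norm z < 1" for z
      using F[of z] HE[OF that] that ball_subset_slit_plane by (auto simp: H_def)
    show "eval_fps (hyp_fps (a + 1) b c) z = w z * eval_fps (hyp_fps a b c) z" if "norm z < 1" for z
      using wH[OF that] by (simp add: H_def H1_def)
  qed (use F F1 in \<open>auto simp: E_def\<close>)
qed

lemma deriv_z_hyp2F1:
  assumes c: "c > 0" and F: "\<And>z. norm z < 1 \<Longrightarrow> hyp2F1 a b c z = eval_fps (hyp_fps a b c) z"
    and z: "norm z < 1"
  shows "deriv (\<lambda>z. z * hyp2F1 a b c z) z =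
           eval_fps (hyp_fps a b c) z + z * eval_fps (fps_deriv (hyp_fps a b c)) z" (is ?d1)
    and "deriv (deriv (\<lambda>z. z * hyp2F1 a b c z)) z =
           2 * eval_fps (fps_deriv (hyp_fps a b c)) z + z * eval_fps (fps_deriv (fps_deriv (hyp_fps a b c))) z" (is ?d2)
    and "(\<lambda>z. z * hyp2F1 a b c z) holomorphic_on ball 0 1"
proof -
  let ?H = "eval_fps (hyp_fps a b c)" and ?H1 = "eval_fps (fps_deriv (hyp_fps a b c))"
    and ?H2 = "eval_fps (fps_deriv (fps_deriv (hyp_fps a b c)))"
  have ev: "eventually (\<lambda>u. norm u < 1) (nhds z)" if "norm z < 1" for z :: complex
    using eventually_nhds_in_open[of "ball 0 1" z] that by simp
  have d1: "deriv (\<lambda>z. z * hyp2F1 a b c z) z = ?H z + z * ?H1 z" if z: "norm z < 1" for z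
  proof -
    have "deriv (\<lambda>z. z * hyp2F1 a b c z) z = deriv (\<lambda>z. z * ?H z) z"
      by (intro deriv_cong_ev eventually_mono[OF ev[OF z]]) (auto simp: F)
    also have "\<dots> = ?H z + z * ?H1 z"
      using DERIV_mult[OF DERIV_ident eval_hyp_fps_has_derivative[OF c z, of a b]]
      by (intro DERIV_imp_deriv) (simp add: algebra_simps)
    finally show ?thesis .
  qed
  show ?d1 by (rule d1[OF z])
  have "deriv (deriv (\<lambda>z. z * hyp2F1 a b c z)) z = deriv (\<lambda>z. ?H z + z * ?H1 z) z"
    by (intro deriv_cong_ev eventually_mono[OF ev[OF z]]) (auto simp: d1)
  also have "\<dots> = 2 * ?H1 z + z * ?H2 z"
  proof (rule DERIV_imp_deriv)
    have "(?H has_field_derivative ?H1 z) (at z)" "(?H1 has_field_derivative ?H2 z) (at z)"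
      by (intro has_field_derivative_eval_fps norm_less_deriv_conv_radius norm_less_hyp_fps_conv_radius[OF c z])+
    from DERIV_add[OF this(1) DERIV_mult[OF DERIV_ident this(2)]]
    show "((\<lambda>z. ?H z + z * ?H1 z) has_field_derivative 2 * ?H1 z + z * ?H2 z) (at z)"
      by (simp add: algebra_simps)
  qed
  finally show ?d2 .
  have "(\<lambda>z. z * ?H z) holomorphic_on ball 0 1"
    by (intro holomorphic_intros eval_hyp_fps_holomorphic c)
  thus "(\<lambda>z. z * hyp2F1 a b c z) holomorphic_on ball 0 1"
    by (rule holomorphic_transform) (auto simp: F)
qed

section \<open>Growth of the logarithmic derivative near one\<close>

lemma eval_fps_nonneg_coeffs:
  fixes G :: "complex fps"
  assumes G: "\<And>n. fps_nth G n = of_real (A n)" "\<And>n. A n \<ge> 0"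
    and x: "0 \<le> x" "ereal x < fps_conv_radius G"
  shows "eval_fps G (of_real x) = of_real (\<Sum>n. A n * x ^ n)" "(\<lambda>n. A n * x ^ n) sums (\<Sum>n. A n * x ^ n)"
    and "(\<Sum>n. A n * x ^ n) \<ge> 0"
proof -
  have s: "(\<lambda>n. of_real (A n * x ^ n)) sums eval_fps G (of_real x)"
    using sums_eval_fps[of "of_real x" G] x by (simp add: G)
  have "(\<lambda>n. Re (of_real (A n * x ^ n))) sums Re (eval_fps G (of_real x))"
    using s by (rule sums_Re)
  thus sums: "(\<lambda>n. A n * x ^ n) sums (\<Sum>n. A n * x ^ n)" by (simp add: sums_iff)
  hence "(\<lambda>n. complex_of_real (A n * x ^ n)) sums of_real (\<Sum>n. A n * x ^ n)" by (rule sums_of_real)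
  with s show "eval_fps G (of_real x) = of_real (\<Sum>n. A n * x ^ n)" by (rule sums_unique2)
  show "(\<Sum>n. A n * x ^ n) \<ge> 0" using sums G x by (intro suminf_nonneg) (auto simp: sums_iff)
qed

text \<open>Here \<open>S'\<close> is \<open>x\<close> times the derivative of the power series \<open>S\<close>. If \<open>S'(x) \<le> B S(x)\<close> for all \<open>x\<close>, then
  \<open>\<Sum> (n - B) A\<^sub>n x\<^sup>n\<close> would be at most zero on \<open>(0,1)\<close>. But its terms are eventually at least a positive multiple
  of \<open>x\<^sup>n/n\<close>, and the harmonic series diverges.\<close>
lemma log_derivative_unbounded:
  fixes A :: "nat \<Rightarrow> real"
  assumes A: "\<And>n. A n \<ge> 0" and C: "C > 0" "\<And>n. n \<ge> 1 \<Longrightarrow> C \<le> real n * (real n * A n)"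
    and s: "\<And>x. 0 < x \<Longrightarrow> x < 1 \<Longrightarrow> (\<lambda>n. A n * x ^ n) sums S x"
    and s': "\<And>x. 0 < x \<Longrightarrow> x < 1 \<Longrightarrow> (\<lambda>n. real n * A n * x ^ n) sums S' x"
  shows "\<exists>x>0. x < 1 \<and> S' x > B * S x"
proof (rule ccontr)
  assume "\<not> (\<exists>x>0. x < 1 \<and> S' x > B * S x)"
  hence le: "S' x \<le> B * S x" if "0 < x" "x < 1" for x using that by force
  \<comment> \<open>From this index on, \<open>n - B\<close> is at least \<open>n/2\<close>.\<close>
  define m where "m = max 1 (nat \<lceil>2 * B\<rceil>)"
  have m: "real n - B \<ge> real n / 2" "real n - B \<ge> 0" "n \<ge> 1" if "n \<ge> m" for n
  proof -
    have "real n \<ge> 2 * B" using that unfolding m_def by linarith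
    thus "real n - B \<ge> real n / 2" "real n - B \<ge> 0" by (auto simp: field_simps)
    show "n \<ge> 1" using that by (simp add: m_def)
  qed
  define P where "P N x = (\<Sum>n<N. (real n - B) * A n * x ^ n)" for N and x :: real
  have lower: "(real n - B) * A n \<ge> C / 2 * inverse (real n)" if "n \<ge> m" for n
  proof -
    have n: "n > 0" using m(3)[OF that] by simp
    have "C * inverse (real n) \<le> real n * A n" using C(2)[OF m(3)[OF that]] n by (simp add: field_simps)
    hence "C / 2 * inverse (real n) \<le> real n / 2 * A n" by simp
    also have "\<dots> \<le> (real n - B) * A n" by (rule mult_right_mono[OF m(1)[OF that] A])
    finally show ?thesis .
  qed
  have "\<exists>N\<ge>m. P N 1 > 0"
  proof (rule ccontr)
    assume "\<not> (\<exists>N\<ge>m. P N 1 > 0)"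
    hence neg: "P N 1 \<le> 0" if "N \<ge> m" for N using that by force
    have "summable (\<lambda>n. inverse (real (n + m)))"
    proof (rule summableI_nonneg_bounded)
      fix N
      have "P (N + m) 1 = P m 1 + (\<Sum>n<N. (real (n + m) - B) * A (n + m))"
        unfolding P_def by (induction N) (auto simp: add.commute)
      moreover have "(\<Sum>n<N. (real (n + m) - B) * A (n + m)) \<ge> (\<Sum>n<N. C / 2 * inverse (real (n + m)))"
        by (intro sum_mono lower) auto
      ultimately have "C / 2 * (\<Sum>n<N. inverse (real (n + m))) \<le> - P m 1"
        using neg[of "N + m"] by (simp add: sum_distrib_left)
      thus "(\<Sum>n<N. inverse (real (n + m))) \<le> - P m 1 * 2 / C" using C(1) by (simp add: field_simps)
    qed auto
    hence "summable (\<lambda>n. inverse (real n))"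
      using summable_iff_shift[of "\<lambda>n. inverse (real n)" m] by blast
    thus False using not_summable_harmonic[where 'a = real] by (simp add: inverse_eq_divide)
  qed
  then obtain N where N: "N \<ge> m" "P N 1 > 0" by blast
  have "isCont (P N) 1" unfolding P_def by (intro continuous_intros)
  hence "eventually (\<lambda>x. P N x > 0) (at_left 1)"
    using N(2) by (intro order_tendstoD(1)) (auto simp: isCont_def filterlim_at_split)
  moreover have "eventually (\<lambda>x::real. x \<in> {0<..<1}) (at_left 1)" by (rule eventually_at_left_real) simp
  ultimately have "eventually (\<lambda>x. P N x > 0 \<and> x \<in> {0<..<1}) (at_left 1)" by (rule eventually_conj)
  then obtain x where x: "P N x > 0" "0 < x" "x < 1"
    using eventually_happens[of _ "at_left (1::real)"] by force
  have "(\<lambda>n. real n * A n * x ^ n - B * (A n * x ^ n)) sums (S' x - B * S x)"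
    by (intro sums_diff sums_mult s s' x)
  hence D: "(\<lambda>n. (real n - B) * A n * x ^ n) sums (S' x - B * S x)"
    by (simp add: algebra_simps)
  have "P N x \<le> (\<Sum>n. (real n - B) * A n * x ^ n)"
    unfolding P_def
  proof (rule sum_le_suminf)
    show "summable (\<lambda>n. (real n - B) * A n * x ^ n)" using D by (simp add: sums_iff)
    fix n assume "n \<in> - {..<N}"
    hence "n \<ge> m" using N(1) by simp
    thus "0 \<le> (real n - B) * A n * x ^ n" using m(2) A x by simp
  qed simp
  also have "\<dots> = S' x - B * S x" using D by (simp add: sums_iff)
  also have "\<dots> \<le> 0" using le[OF x(2,3)] by simp
  finally show False using x(1) by simp
qed

text \<open>The recursion for the coefficients shows that \<open>n\<^sup>2 A\<^sub>n\<close> is nondecreasing.\<close>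
lemma hyp_coeff_lower_bound:
  fixes a b c :: real
  assumes pos: "0 < a" "0 < b" "0 < c" and c: "c \<le> a + b + 1"
  defines "A \<equiv> \<lambda>n. pochhammer a n * pochhammer b n / (pochhammer c n * fact n)"
  shows "\<exists>C>0. \<forall>n\<ge>1. C \<le> real n * (real n * A n)"
proof -
  have A: "A n > 0" for n using pos by (auto simp: A_def intro!: divide_pos_pos mult_pos_pos pochhammer_pos)
  define v where "v n = real n * (real n * A n)" for n
  have rec: "(real n + 1) * (c + real n) * A (Suc n) = (a + n) * (b + n) * A n" for n
  proof -
    have "pochhammer c n > 0" "c + real n > 0" using pos by (auto intro: pochhammer_pos)
    thus ?thesis by (simp add: A_def pochhammer_Suc divide_simps)
  qed
  have step: "v n \<le> v (Suc n)" for n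
  proof -
    have "real n * (real n * (c + n)) \<le> (real n + 1) * ((a + n) * (b + n))"
    proof -
      have "0 \<le> (a + b + 1 - c) * (real n * real n) + (a + b + a * b) * n + a * b" using pos c by simp
      thus ?thesis by (simp add: algebra_simps)
    qed
    hence "real n * (real n * (c + n)) * A n \<le> (real n + 1) * ((a + n) * (b + n)) * A n"
      using A[of n] by (intro mult_right_mono) auto
    hence "(c + n) * v n \<le> (real n + 1) * ((a + n) * (b + n) * A n)" by (simp add: v_def mult_ac)
    also have "\<dots> = (real n + 1) * ((real n + 1) * (c + real n) * A (Suc n))" by (simp only: rec)
    also have "\<dots> = (c + n) * v (Suc n)" by (simp add: v_def mult_ac add.commute)
    finally show ?thesis using pos by (simp add: mult_le_cancel_left_pos add_pos_nonneg)
  qed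
  have "v 1 \<le> v n" if "n \<ge> 1" for n using lift_Suc_mono_le[of v 1 n] step that by blast
  moreover have "v 1 > 0" using A[of 1] by (simp add: v_def)
  ultimately show ?thesis unfolding v_def by blast
qed

section \<open>The convexity quantity of the normalised hypergeometric function\<close>

lemma diff_mult_divide: "(k - q * y) / x = k * (1 / x) - q * (y * (1 / x))" for k q x y :: complex
  by (simp add: diff_divide_distrib)

text \<open>Here \<open>P\<close> and \<open>Q\<close> stand for \<open>z F'\<close> and \<open>z\<^sup>2 F''\<close>, so that the left-hand side is \<open>z f''/f'\<close> for \<open>f = z F\<close>. The
  differential equation eliminates \<open>Q\<close>, and \<open>P = F (D - 1)\<close>.\<close>
lemma convexity_identity:
  fixes a b c z H P Q D :: complex
  assumes ode: "(1 - z) * Q = (a + b + 1) * z * P + a * b * z * H - c * P"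
    and D: "H * D = H + P" and nz: "H \<noteq> 0" "D \<noteq> 0" "z \<noteq> 1"
  defines "k \<equiv> c - 1 - a - b + a * b"
  shows "(2 * P + Q) / (H * D) =
         1 - a - b + (a * b - k) / (1 - z) + (k * (1 / ((1 - z) * D)) - (1 - a) * (1 - b) * ((1 - z) * (1 / ((1 - z) * D))))"
proof -
  have P: "P = H * D - H" using D by simp
  have z: "1 - z \<noteq> 0" using nz by simp
  have "(1 - z) * (2 * P + Q) = ((1 - a - b) * (1 - z) + (a * b - k)) * (H * D) + (k - (1 - a) * (1 - b) * (1 - z)) * H"
    unfolding distrib_left[of "1 - z"] ode P k_def by (simp add: algebra_simps)
  hence "(2 * P + Q) / (H * D) = (((1 - a - b) * (1 - z) + (a * b - k)) * (H * D) + (k - (1 - a) * (1 - b) * (1 - z)) * H) / ((1 - z) * (H * D))"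
    using nz z by (simp add: frac_eq_eq) (simp add: mult_ac)
  also have "\<dots> = ((1 - a - b) * (1 - z) + (a * b - k)) / (1 - z) + (k - (1 - a) * (1 - b) * (1 - z)) / ((1 - z) * D)"
    using nz z by (simp add: add_divide_distrib)
  also have "\<dots> = 1 - a - b + (a * b - k) / (1 - z) + (k - (1 - a) * (1 - b) * (1 - z)) / ((1 - z) * D)"
    using z by (simp add: add_divide_distrib)
  also have "(k - (1 - a) * (1 - b) * (1 - z)) / ((1 - z) * D) =
     k * (1 / ((1 - z) * D)) - (1 - a) * (1 - b) * ((1 - z) * (1 / ((1 - z) * D)))"
    by (rule diff_mult_divide)
  finally show ?thesis .
qed

text \<open>Here \<open>h = 1/((1-z) D)\<close>. The last two statements concern the weight of \<open>1/(1-z)\<close> in \<open>h\<close>, which is the limit of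
  \<open>(1-x) h(x) = 1/D(x)\<close>. For the lower bound, the differential equation gives
  \<open>a b F - (k - a b) z F' = (1-z) (z F'' + c F')\<close>, and the right-hand side is nonnegative on \<open>(0,1)\<close> since the
  coefficients of \<open>F\<close> are. For the limit, \<open>D = 1 + z F'/F\<close> is unbounded.\<close>
theorem hyp2F1_convexity_representation:
  fixes a b c :: real
  assumes a: "0 < a" "a < 1" and ac: "a \<le> c" and b: "0 \<le> b" "b \<le> c"
  defines "f \<equiv> \<lambda>z. z * hyp2F1 a b c z"
  defines "k \<equiv> c - 2 + (1 - a) * (1 - b)"
  obtains h where "h \<in> wall_class"
    "\<And>z. z \<in> slit_plane \<Longrightarrow> M_fun a b c z = of_real k * h z - of_real ((1 - a) * (1 - b)) * ((1 - z) * h z)"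
    "f holomorphic_on ball 0 1" "deriv f 0 = 1" "\<And>z. norm z < 1 \<Longrightarrow> deriv f z \<noteq> 0"
    "\<And>z. norm z < 1 \<Longrightarrow> 1 + z * deriv (deriv f) z / deriv f z =
        of_real (2 - a - b) + of_real (a * b - k) / (1 - z) + M_fun a b c z"
    "\<And>x. k > a * b \<Longrightarrow> 0 < x \<Longrightarrow> x < 1 \<Longrightarrow> (k - a * b) / k \<le> (1 - x) * Re (h (of_real x))"
    "k < a * b \<Longrightarrow> 0 < b \<Longrightarrow> ((\<lambda>x. (1 - x) * Re (h (of_real x))) \<longlongrightarrow> 0) (at_left 1)"
proof -
  have c: "c > 0" using a ac by simp
  have k: "k = c - 1 - a - b + a * b" by (simp add: k_def algebra_simps)
  obtain w where w: "w \<in> wall_class" and F0: "\<And>z. z \<in> slit_plane \<Longrightarrow> hyp2F1 a b c z \<noteq> 0"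
    and F1: "\<And>z. z \<in> slit_plane \<Longrightarrow> hyp2F1 (a + 1) b c z = w z * hyp2F1 a b c z"
    and FH: "\<And>z. norm z < 1 \<Longrightarrow> hyp2F1 a b c z = eval_fps (hyp_fps a b c) z"
    and H1: "\<And>z. norm z < 1 \<Longrightarrow> eval_fps (hyp_fps (a + 1) b c) z = w z * eval_fps (hyp_fps a b c) z"
    using hyp2F1_wall_class_ratio[of a c b] a ac b c by (metis less_imp_le)
  define D where "D z = of_real (1 - a) + of_real a * w z" for z
  define h where "h z = 1 / ((1 - z) * D z)" for z
  have D: "D \<in> wall_class" unfolding D_def by (intro wall_class_convex_one w) (use a in auto)
  have h: "h \<in> wall_class" unfolding h_def by (intro wall_class_dual D)
  define H H' H'' where "H = eval_fps (hyp_fps a b c)" and "H' = eval_fps (fps_deriv (hyp_fps a b c))"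
    and "H'' = eval_fps (fps_deriv (fps_deriv (hyp_fps a b c)))"
  note Hs = H_def H'_def H''_def
  have Hnz: "H z \<noteq> 0" if "norm z < 1" for z
    using F0[of z] FH[OF that] that mem_slit_plane_if_norm_less_1 by (simp add: H_def)
  have HD: "H z * D z = H z + z * H' z" if z: "norm z < 1" for z
    using eval_hyp_fps_euler_operator[OF c z, of a b] H1[OF z] by (simp add: Hs D_def algebra_simps)
  have d1: "deriv f z = H z * D z" if z: "norm z < 1" for z
    using deriv_z_hyp2F1(1)[OF c FH z] HD[OF z] by (simp add: f_def Hs)
  have d2: "deriv (deriv f) z = 2 * H' z + z * H'' z" if z: "norm z < 1" for z
    using deriv_z_hyp2F1(2)[OF c FH z] by (simp add: f_def Hs)
  have ode: "z * H'' z + of_real c * H' z =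
         z * (z * H'' z) + of_real (a + b + 1) * (z * H' z) + of_real (a * b) * H z" if z: "norm z < 1" for z
    using eval_hyp_fps_ode[OF c z, of a b] by (simp add: Hs)
  have M: "M_fun a b c z = of_real k * h z - of_real ((1 - a) * (1 - b)) * ((1 - z) * h z)" if z: "z \<in> slit_plane" for z
  proof -
    have "hyp2F1 (a + 1) b c z / hyp2F1 a b c z = w z" using F0[OF z] F1[OF z] by simp
    hence "M_fun a b c z = (of_real (c - 2) + of_real ((1 - a) * (1 - b)) * z) / ((1 - z) * D z)"
      by (simp add: M_fun_def D_def)
    also have "of_real (c - 2) + of_real ((1 - a) * (1 - b)) * z = of_real k - of_real ((1 - a) * (1 - b)) * (1 - z)"
      by (simp add: k_def algebra_simps)
    finally show ?thesis by (simp only: h_def diff_mult_divide)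
  qed
  have T: "1 + z * deriv (deriv f) z / deriv f z =
        of_real (2 - a - b) + of_real (a * b - k) / (1 - z) + M_fun a b c z" if z: "norm z < 1" for z
  proof -
    have zs: "z \<in> slit_plane" by (rule mem_slit_plane_if_norm_less_1[OF z])
    have "z * (z * H'' z + of_real c * H' z) =
         z * (z * (z * H'' z) + of_real (a + b + 1) * (z * H' z) + of_real (a * b) * H z)"
      by (simp only: ode[OF z])
    hence "(1 - z) * (z * (z * H'' z)) = (of_real a + of_real b + 1) * z * (z * H' z) +
        of_real a * of_real b * z * H z - of_real c * (z * H' z)"
      by (simp add: algebra_simps)
    from convexity_identity[OF this HD[OF z] Hnz[OF z] wall_class_nonzero[OF D zs]]
    have "(2 * (z * H' z) + z * (z * H'' z)) / (H z * D z) = of_real (1 - a - b) + of_real (a * b - k) / (1 - z) +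
       (of_real k * h z - of_real ((1 - a) * (1 - b)) * ((1 - z) * h z))"
      using z by (auto simp: h_def k)
    moreover have "z * deriv (deriv f) z = 2 * (z * H' z) + z * (z * H'' z)"
      unfolding d2[OF z] by (simp add: algebra_simps)
    ultimately show ?thesis unfolding d1[OF z] M[OF zs] by simp
  qed
  define A where "A n = pochhammer a n * pochhammer b n / (pochhammer c n * fact n)" for n
  have A: "A n \<ge> 0" for n
  proof -
    have "pochhammer x n \<ge> 0" if "x \<ge> 0" for x :: real
      using that by (induction n) (auto simp: pochhammer_Suc)
    thus ?thesis using a b c unfolding A_def by (intro divide_nonneg_nonneg mult_nonneg_nonneg) auto
  qed
  have coeff: "fps_nth (hyp_fps a b c) n = of_real (A n)" for n by (simp add: hyp_fps_def A_def)
  have coeff': "fps_nth (fps_deriv (hyp_fps a b c)) n = of_real (real (Suc n) * A (Suc n))" for n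
    by (simp add: coeff)
  have coeff'': "fps_nth (fps_deriv (fps_deriv (hyp_fps a b c))) n = of_real (real (Suc n) * (real (Suc (Suc n)) * A (Suc (Suc n))))" for n
    by (simp add: coeff)
  have coeffX: "fps_nth (fps_X * fps_deriv (hyp_fps a b c)) n = of_real (real n * A n)" for n
    by (cases n) (simp_all add: coeff)
  have xn: "norm (complex_of_real x) < 1" if "0 < x" "x < 1" for x using that by simp
  have rad: "ereal x < fps_conv_radius (hyp_fps a b c)" "ereal x < fps_conv_radius (fps_deriv (hyp_fps a b c))"
     "ereal x < fps_conv_radius (fps_deriv (fps_deriv (hyp_fps a b c)))"
     "ereal x < fps_conv_radius (fps_X * fps_deriv (hyp_fps a b c))" if x: "0 < x" "x < 1" for x
  proof -
    have 1: "ereal (norm (complex_of_real x)) < fps_conv_radius (hyp_fps a b c)"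
      by (rule norm_less_hyp_fps_conv_radius[OF c xn[OF x]])
    have 2: "ereal (norm (complex_of_real x)) < fps_conv_radius (fps_X * fps_deriv (hyp_fps a b c))"
      by (intro norm_less_mult_conv_radius norm_less_deriv_conv_radius 1) simp
    show "ereal x < fps_conv_radius (hyp_fps a b c)" "ereal x < fps_conv_radius (fps_deriv (hyp_fps a b c))"
     "ereal x < fps_conv_radius (fps_deriv (fps_deriv (hyp_fps a b c)))"
     "ereal x < fps_conv_radius (fps_X * fps_deriv (hyp_fps a b c))"
      using 1 2 norm_less_deriv_conv_radius[OF 1] norm_less_deriv_conv_radius[OF norm_less_deriv_conv_radius[OF 1]] x
      by simp_all
  qed
  define S where "S x = (\<Sum>n. A n * x ^ n)" for x
  define S' where "S' x = (\<Sum>n. real n * A n * x ^ n)" for x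
  have S: "H (of_real x) = of_real (S x)" "(\<lambda>n. A n * x ^ n) sums S x" "S x > 0"
    and S': "of_real x * H' (of_real x) = of_real (S' x)" "(\<lambda>n. real n * A n * x ^ n) sums S' x" "S' x \<ge> 0"
    if x: "0 < x" "x < 1" for x
  proof -
    have x0: "0 \<le> x" using x by simp
    have nn: "real n * A n \<ge> 0" for n using A[of n] by simp
    show 1: "H (of_real x) = of_real (S x)"
      unfolding H_def S_def by (rule eval_fps_nonneg_coeffs(1)[OF coeff A x0 rad(1)[OF x]])
    show "(\<lambda>n. A n * x ^ n) sums S x"
      unfolding S_def by (rule eval_fps_nonneg_coeffs(2)[OF coeff A x0 rad(1)[OF x]])
    have "S x \<ge> 0"
      unfolding S_def by (rule eval_fps_nonneg_coeffs(3)[OF coeff A x0 rad(1)[OF x]])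
    moreover have "S x \<noteq> 0" using Hnz[OF xn[OF x]] 1 by auto
    ultimately show "S x > 0" by simp
    have "of_real x * H' (of_real x) = eval_fps (fps_X * fps_deriv (hyp_fps a b c)) (of_real x)"
      unfolding H'_def using rad(2)[OF x] x by (subst eval_fps_mult) auto
    also have "\<dots> = of_real (S' x)"
      unfolding S'_def by (rule eval_fps_nonneg_coeffs(1)[OF coeffX nn x0 rad(4)[OF x]])
    finally show "of_real x * H' (of_real x) = of_real (S' x)" .
    show "(\<lambda>n. real n * A n * x ^ n) sums S' x"
      unfolding S'_def by (rule eval_fps_nonneg_coeffs(2)[OF coeffX nn x0 rad(4)[OF x]])
    show "S' x \<ge> 0"
      unfolding S'_def by (rule eval_fps_nonneg_coeffs(3)[OF coeffX nn x0 rad(4)[OF x]])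
  qed
  have Dx: "Re (D (of_real x)) = (S x + S' x) / S x" if x: "0 < x" "x < 1" for x
  proof -
    have "of_real (S x) * D (of_real x) = complex_of_real (S x + S' x)"
      using HD[OF xn[OF x]] S(1)[OF x] S'(1)[OF x] by simp
    hence "D (of_real x) = complex_of_real ((S x + S' x) / S x)"
      using S(3)[OF x] by (simp add: field_simps)
    thus ?thesis by simp
  qed
  have hx: "(1 - x) * Re (h (of_real x)) = 1 / Re (D (of_real x))" if x: "x < 1" for x
  proof -
    have "h (of_real x) = 1 / ((1 - of_real x) * of_real (Re (D (of_real x))))"
      unfolding h_def wall_class_real[OF D x, symmetric] ..
    also have "\<dots> = of_real (1 / ((1 - x) * Re (D (of_real x))))" by simp
    finally show ?thesis using x by simp
  qed
  have p1: "(k - a * b) / k \<le> (1 - x) * Re (h (of_real x))" if kab: "k > a * b" and x: "0 < x" "x < 1" for x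
  proof -
    have "k > 0" using kab a b by (meson le_less_trans less_imp_le mult_nonneg_nonneg)
    let ?x = "complex_of_real x"
    have e: "of_real (a * b) * H ?x - of_real (k - a * b) * (?x * H' ?x) = (1 - ?x) * (?x * H'' ?x + of_real c * H' ?x)"
    proof -
      have "a' * b' * H0 - (c' - 1 - a' - b') * (z * H1) = (1 - z) * (z * H2 + c' * H1)"
        if "z * H2 + c' * H1 = z * (z * H2) + (a' + b' + 1) * (z * H1) + a' * b' * H0"
        for a' b' c' z H0 H1 H2 :: complex using that by algebra
      from this[of ?x "H'' ?x" "of_real c" "H' ?x" "of_real a" "of_real b" "H ?x"] show ?thesis
        using ode[OF xn[OF x]] by (simp add: k)
    qed
    define p where "p = (\<Sum>n. real (Suc n) * A (Suc n) * x ^ n)"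
    define q where "q = (\<Sum>n. real (Suc n) * (real (Suc (Suc n)) * A (Suc (Suc n))) * x ^ n)"
    have x0: "0 \<le> x" using x by simp
    have nn: "real (Suc n) * A (Suc n) \<ge> 0" "real (Suc n) * (real (Suc (Suc n)) * A (Suc (Suc n))) \<ge> 0" for n
      using A by (intro mult_nonneg_nonneg; simp)+
    have p: "H' ?x = of_real p" "p \<ge> 0"
      unfolding H'_def p_def by (rule eval_fps_nonneg_coeffs[OF coeff' nn(1) x0 rad(2)[OF x]])+
    have q: "H'' ?x = of_real q" "q \<ge> 0"
      unfolding H''_def q_def by (rule eval_fps_nonneg_coeffs[OF coeff'' nn(2) x0 rad(3)[OF x]])+
    have "complex_of_real (a * b * S x - (k - a * b) * S' x) = of_real ((1 - x) * (x * q + c * p))"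
      using e unfolding S(1)[OF x] S'(1)[OF x] unfolding p(1) q(1) by simp
    hence "a * b * S x - (k - a * b) * S' x = (1 - x) * (x * q + c * p)" by (simp only: of_real_eq_iff)
    moreover have "(1 - x) * (x * q + c * p) \<ge> 0" using p(2) q(2) x c by simp
    ultimately have "(k - a * b) * (S x + S' x) \<le> k * S x" by (simp add: algebra_simps)
    hence "(k - a * b) / k \<le> S x / (S x + S' x)"
      using \<open>k > 0\<close> S(3)[OF x] S'(3)[OF x] by (simp add: divide_simps mult.commute)
    thus ?thesis using hx[of x] x by (simp add: Dx)
  qed
  have p2: "((\<lambda>x. (1 - x) * Re (h (of_real x))) \<longlongrightarrow> 0) (at_left 1)" if kab: "k < a * b" and b0: "0 < b"
  proof -
    have "filterlim (\<lambda>x. Re (D (of_real x))) at_top (at_left (1::real))"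
      unfolding filterlim_at_top
    proof
      fix B :: real
      obtain C where C: "C > 0" "\<And>n. n \<ge> 1 \<Longrightarrow> C \<le> real n * (real n * A n)"
        using hyp_coeff_lower_bound[OF a(1) b0 c] kab unfolding A_def k by auto
      obtain x where x: "0 < x" "x < 1" "S' x > B * S x"
        using log_derivative_unbounded[OF A C S(2) S'(2), of B] by blast
      have "B * S x \<le> S x + S' x" using x S(3)[of x] by simp
      hence "B \<le> Re (D (of_real x))" using S(3)[OF x(1,2)] unfolding Dx[OF x(1,2)] by (simp add: field_simps)
      hence "B \<le> Re (D (of_real y))" if "x < y" "y < 1" for y
        using wall_class_mono[OF D, of x y] that by simp
      thus "eventually (\<lambda>x. B \<le> Re (D (of_real x))) (at_left 1)"
        unfolding eventually_at_left_field using x by blast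
    qed
    hence "((\<lambda>x. inverse (Re (D (of_real x)))) \<longlongrightarrow> 0) (at_left (1::real))"
      by (rule tendsto_inverse_0_at_top)
    moreover have "eventually (\<lambda>x. inverse (Re (D (of_real x))) = (1 - x) * Re (h (of_real x))) (at_left 1)"
      unfolding eventually_at_left_field by (intro exI[of _ 0]) (auto simp: hx inverse_eq_divide)
    ultimately show ?thesis by (rule Lim_transform_eventually)
  qed
  show ?thesis
  proof (rule that[OF h M _ _ _ T p1 p2])
    show "f holomorphic_on ball 0 1"
      unfolding f_def by (rule deriv_z_hyp2F1(3)[OF c FH, of 0]) auto
    show "deriv f 0 = 1" using d1[of 0] by (simp add: H_def wall_class_0[OF D])
    show "deriv f z \<noteq> 0" if "norm z < 1" for z
      unfolding d1[OF that] using Hnz[OF that] wall_class_nonzero[OF D mem_slit_plane_if_norm_less_1[OF that]] by simp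
  qed auto
qed

section \<open>The order of convexity\<close>

text \<open>A lower bound that is approached along a sequence is the infimum, also when it is \<open>-\<infinity>\<close>.\<close>
lemma has_order_of_convexityI:
  assumes f: "f holomorphic_on ball 0 1" "f 0 = 0" "deriv f 0 = 1" "\<And>z. norm z < 1 \<Longrightarrow> deriv f z \<noteq> 0"
    and T: "\<And>z. norm z < 1 \<Longrightarrow> 1 + z * deriv (deriv f) z / deriv f z = T z"
    and lower: "\<And>z. norm z < 1 \<Longrightarrow> \<kappa> \<le> ereal (Re (T z))"
    and lim: "(\<lambda>n. ereal (Re (T (s n)))) \<longlonglongrightarrow> \<kappa>" "\<And>n. norm (s n) < 1"
  shows "has_order_of_convexity f \<kappa>"
proof -
  define I where "I = (INF z\<in>ball 0 1. ereal (Re (z * deriv (deriv f) z / deriv f z)))"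
  have g: "Re (z * deriv (deriv f) z / deriv f z) = Re (T z) - 1" if "norm z < 1" for z
    unfolding T[OF that, symmetric] by simp
  have "1 + I \<le> ereal (Re (T (s n)))" for n
  proof -
    have "I \<le> ereal (Re (T (s n)) - 1)"
      unfolding I_def g[OF lim(2), symmetric] by (intro INF_lower) (use lim(2) in auto)
    thus ?thesis by (cases I) (auto simp: one_ereal_def)
  qed
  hence upper: "1 + I \<le> \<kappa>" by (intro tendsto_lowerbound[OF lim(1)]) auto
  have "\<kappa> - 1 \<le> I" unfolding I_def
  proof (rule INF_greatest)
    fix z :: complex assume "z \<in> ball 0 1"
    hence z: "norm z < 1" by simp
    show "\<kappa> - 1 \<le> ereal (Re (z * deriv (deriv f) z / deriv f z))"
      unfolding g[OF z] using lower[OF z] by (cases \<kappa>) (auto simp: one_ereal_def)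
  qed
  with upper have "\<kappa> = 1 + I" by (cases \<kappa>; cases I) (auto simp: one_ereal_def)
  thus ?thesis unfolding has_order_of_convexity_def I_def using f by auto
qed

text \<open>The constant is \<open>2 - a - b + (a b - k)/2\<close>, the half coming from the least real part of \<open>1/(1-z)\<close>. In (1)
  the infimum is approached along real points tending to \<open>-1\<close>, in (2) along a sequence tangential to the
  circle at \<open>1\<close>. There \<open>M(1)\<close> is zero if \<open>k = 0\<close>, and otherwise \<open>k\<close> times the limit of \<open>h\<close>, which is finite or \<open>+\<infinity>\<close>
  according as \<open>h\<close> is bounded on \<open>[0,1)\<close> or not.\<close>
theorem theorem1p5:
  fixes a b c :: real
  assumes "0 < a" and "a < 1" and "a \<le> c" and "0 \<le> b" and "b \<le> c"
  shows "(1 - b > 0 \<and> c - 2 + (1 - a) * (1 - b) \<ge> 0 \<longrightarrow>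
           (\<exists>m::real. M_fun a b c (-1) = complex_of_real m \<and>
              has_order_of_convexity (\<lambda>z. z * hyp2F1 a b c z) (ereal ((5 - c - a - b) / 2 + m)))) \<and>
         (1 - b < 0 \<and> c - 2 + (1 - a) * (1 - b) \<le> 0 \<longrightarrow>
           (\<exists>m::ereal. has_ext_limit_at_one (M_fun a b c) m \<and>
              has_order_of_convexity (\<lambda>z. z * hyp2F1 a b c z) (ereal ((5 - c - a - b) / 2) + m)))"
proof -
  define k where "k = c - 2 + (1 - a) * (1 - b)"
  define q where "q = (1 - a) * (1 - b)"
  define f where "f = (\<lambda>z. z * hyp2F1 a b c z)"
  obtain h where h: "h \<in> wall_class"
    and M: "\<And>z. z \<in> slit_plane \<Longrightarrow> M_fun a b c z = of_real k * h z - of_real q * ((1 - z) * h z)"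
    and f': "f holomorphic_on ball 0 1" "deriv f 0 = 1" "\<And>z. norm z < 1 \<Longrightarrow> deriv f z \<noteq> 0"
    and T: "\<And>z. norm z < 1 \<Longrightarrow> 1 + z * deriv (deriv f) z / deriv f z =
        of_real (2 - a - b) + of_real (a * b - k) / (1 - z) + M_fun a b c z"
    and atom: "\<And>x. k > a * b \<Longrightarrow> 0 < x \<Longrightarrow> x < 1 \<Longrightarrow> (k - a * b) / k \<le> (1 - x) * Re (h (of_real x))"
    and no_atom: "k < a * b \<Longrightarrow> 0 < b \<Longrightarrow> ((\<lambda>x. (1 - x) * Re (h (of_real x))) \<longlongrightarrow> 0) (at_left 1)"
  proof (rule hyp2F1_convexity_representation[OF assms, folded k_def q_def f_def], goal_cases)
    case (1 h)
    show ?case by (rule 1(1)) (fact 1)+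
  qed
  have "f 0 = 0" by (simp add: f_def)
  note f = f'(1) this f'(2,3)
  define T' where "T' z = of_real (2 - a - b) + of_real (a * b - k) / (1 - z) + M_fun a b c z" for z
  have const: "2 - a - b + (a * b - k) / 2 = (5 - c - a - b) / 2" by (simp add: k_def field_simps)
  have ReT': "Re (T' z) = 2 - a - b + (a * b - k) * Re (1 / (1 - z)) + Re (M_fun a b c z)" for z
  proof -
    have "T' z = of_real (2 - a - b) + of_real (a * b - k) * (1 / (1 - z)) + M_fun a b c z" by (simp add: T'_def)
    thus ?thesis by (simp only: plus_complex.sel Re_complex_of_real times_complex.sel Im_complex_of_real mult_zero_left diff_zero)
  qed
  have ReM: "Re (M_fun a b c z) = k * Re (h z) - q * Re ((1 - z) * h z)" if "z \<in> slit_plane" for z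
    unfolding M[OF that] by (simp only: minus_complex.sel Re_complex_of_real times_complex.sel Im_complex_of_real mult_zero_left diff_zero)
  have "\<exists>m::real. M_fun a b c (-1) = complex_of_real m \<and> has_order_of_convexity f (ereal ((5 - c - a - b) / 2 + m))"
    if b1: "1 - b > 0" and k0: "k \<ge> 0"
  proof -
    have q0: "q \<ge> 0" using assms b1 by (simp add: q_def)
    define m where "m = Re (M_fun a b c (-1))"
    have hr: "h (-1) = of_real (Re (h (-1)))" using wall_class_real[OF h, of "-1"] by simp
    have "M_fun a b c (-1) = of_real k * of_real (Re (h (-1))) - of_real q * ((1 - (-1)) * of_real (Re (h (-1))))"
      using M[of "-1"] hr by simp
    also have "\<dots> = of_real (k * Re (h (-1)) - q * (2 * Re (h (-1))))" by simp
    finally have Mr: "M_fun a b c (-1) = of_real (k * Re (h (-1)) - q * (2 * Re (h (-1))))" .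
    hence m: "m = k * Re (h (-1)) - q * (2 * Re (h (-1)))" by (simp add: m_def)
    have lower: "(5 - c - a - b) / 2 + m \<le> Re (T' z)" if z: "norm z < 1" for z
    proof -
      let ?R = "Re (1 / (1 - z)) - 1 / 2"
      have R: "?R \<ge> 0" using Re_inverse_one_minus_ge[OF z] by simp
      have 1: "(a * b - k) * ?R + k * (Re (h z) - Re (h (-1))) \<ge> 0"
      \<comment> \<open>The coefficient of \<open>1/(1-z)\<close> is negative in the first case only, where the weight of \<open>1/(1-z)\<close> in \<open>h\<close> makes up for it.\<close>
      proof (cases "k > a * b")
        case True
        hence kp: "k > 0" using assms by (meson le_less_trans less_imp_le mult_nonneg_nonneg)
        have "Re (h z) - Re (h (-1)) \<ge> (k - a * b) / k * ?R"
          by (rule wall_class_atom_bound[OF h z atom[OF True]])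
        hence "k * (Re (h z) - Re (h (-1))) \<ge> k * ((k - a * b) / k * ?R)" using kp by (intro mult_left_mono) auto
        also have "k * ((k - a * b) / k * ?R) = (k - a * b) * ?R" using kp by simp
        finally have "(k - a * b) * ?R \<le> k * (Re (h z) - Re (h (-1)))" .
        moreover have "(a * b - k) * ?R = - ((k - a * b) * ?R)"
          by (simp only: minus_mult_left minus_diff_eq)
        ultimately show ?thesis by linarith
      next
        case False
        have "k * (Re (h z) - Re (h (-1))) \<ge> 0"
          using k0 wall_class_Re_ge_neg_one[OF h z] by simp
        moreover have "(a * b - k) * ?R \<ge> 0" using False R by (intro mult_nonneg_nonneg) auto
        ultimately show ?thesis by linarith
      qed
      have 2: "q * Re ((1 - z) * h z) \<le> q * (2 * Re (h (-1)))"
        using wall_class_dual_Re_bounds(1)[OF h z] q0 by (rule mult_left_mono)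
      have "Re (T' z) - ((5 - c - a - b) / 2 + m) = ((a * b - k) * ?R + k * (Re (h z) - Re (h (-1)))) +
          (q * (2 * Re (h (-1))) - q * Re ((1 - z) * h z))"
        unfolding ReT' ReM[OF mem_slit_plane_if_norm_less_1[OF z]] m const[symmetric] by (simp add: algebra_simps)
      thus ?thesis using 1 2 by linarith
    qed
    define s where "s n = complex_of_real (- 1 + inverse (real (Suc n)))" for n
    have s: "norm (s n) < 1" for n
    proof -
      have "inverse (real (Suc n)) \<le> 1" "inverse (real (Suc n)) > 0" by (simp_all add: field_simps)
      thus ?thesis unfolding s_def norm_of_real by linarith
    qed
    have "s \<longlonglongrightarrow> of_real (-1 + 0)" unfolding s_def by (intro tendsto_intros LIMSEQ_inverse_real_of_nat)
    hence slim: "s \<longlonglongrightarrow> -1" by simp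
    have "isCont h (-1)"
      using wall_class_holomorphic[OF h] open_slit_plane
      by (metis continuous_on_eq_continuous_at holomorphic_on_imp_continuous_on mem_slit_plane_simps(2))
    hence hlim: "(\<lambda>n. h (s n)) \<longlonglongrightarrow> h (-1)" using slim by (rule isCont_tendsto_compose)
    have "(\<lambda>n. 2 - a - b + (a * b - k) * Re (1 / (1 - s n)) + (k * Re (h (s n)) - q * Re ((1 - s n) * h (s n)))) \<longlonglongrightarrow>
        2 - a - b + (a * b - k) * Re (1 / (1 - (-1))) + (k * Re (h (-1)) - q * Re ((1 - (-1)) * h (-1)))"
      by (intro tendsto_intros hlim slim) auto
    moreover have "Re ((1 - (-1)) * h (-1)) = 2 * Re (h (-1))" by simp
    ultimately have "(\<lambda>n. Re (T' (s n))) \<longlonglongrightarrow> (5 - c - a - b) / 2 + m"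
      unfolding ReT' ReM[OF mem_slit_plane_if_norm_less_1[OF s]] m const[symmetric] by simp
    hence "(\<lambda>n. ereal (Re (T' (s n)))) \<longlonglongrightarrow> ereal ((5 - c - a - b) / 2 + m)" by simp
    hence "has_order_of_convexity f (ereal ((5 - c - a - b) / 2 + m))"
      using lower s by (intro has_order_of_convexityI[OF f, where T = T' and s = s]) (auto simp: T T'_def)
    moreover have "M_fun a b c (-1) = complex_of_real m" using Mr by (simp only: m)
    ultimately show ?thesis by blast
  qed
  moreover have "\<exists>m::ereal. has_ext_limit_at_one (M_fun a b c) m \<and> has_order_of_convexity f (ereal ((5 - c - a - b) / 2) + m)"
    if b1: "1 - b < 0" and k0: "k \<le> 0"
  proof -
    have q0: "q \<le> 0" using assms b1 by (simp add: q_def mult_nonneg_nonpos)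
    have ab: "a * b > 0" using assms b1 by simp
    have kab: "k < a * b" using k0 ab by simp
    have lim0: "((\<lambda>x. (1 - x) * Re (h (of_real x))) \<longlongrightarrow> 0) (at_left 1)" using no_atom kab b1 by simp
    have dual0: "((\<lambda>z. (1 - z) * h z) \<longlongrightarrow> 0) (at 1 within ball 0 1)"
      by (rule wall_class_dual_tendsto_zero[OF h lim0])
    have evM: "eventually (\<lambda>z. of_real k * h z - of_real q * ((1 - z) * h z) = M_fun a b c z) (at 1 within ball 0 1)"
      using eventually_near_one[OF zero_less_one] M mem_slit_plane_if_norm_less_1 by (auto elim!: eventually_mono)
    have main: "has_order_of_convexity f (ereal ((5 - c - a - b) / 2) + m)"
      if lim: "((\<lambda>z. ereal (Re (M_fun a b c z))) \<longlongrightarrow> m) (at 1 within ball 0 1)"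
        and lower: "\<And>z. norm z < 1 \<Longrightarrow> m \<le> ereal (Re (M_fun a b c z))" for m
    proof (rule has_order_of_convexityI[OF f, where T = T' and s = horocyclic_seq])
      fix z :: complex assume z: "norm z < 1"
      have "(a * b - k) * (1 / 2) \<le> (a * b - k) * Re (1 / (1 - z))"
        using Re_inverse_one_minus_ge[OF z] kab by (intro mult_left_mono) auto
      hence "(5 - c - a - b) / 2 \<le> 2 - a - b + (a * b - k) * Re (1 / (1 - z))"
        unfolding const[symmetric] by simp
      hence "ereal ((5 - c - a - b) / 2) + m \<le> ereal (2 - a - b + (a * b - k) * Re (1 / (1 - z))) + ereal (Re (M_fun a b c z))"
        by (intro add_mono lower z) simp
      thus "ereal ((5 - c - a - b) / 2) + m \<le> ereal (Re (T' z))" by (simp add: ReT')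
    next
      have "(\<lambda>n. 2 - a - b + (a * b - k) * (1 / 2 + inverse (real (Suc n)))) \<longlonglongrightarrow> 2 - a - b + (a * b - k) * (1 / 2 + 0)"
        by (intro tendsto_intros LIMSEQ_inverse_real_of_nat)
      hence "(\<lambda>n. ereal (2 - a - b + (a * b - k) * Re (1 / (1 - horocyclic_seq n)))) \<longlonglongrightarrow> ereal ((5 - c - a - b) / 2)"
        unfolding horocyclic_seq(2) const[symmetric] by simp
      moreover have "(\<lambda>n. ereal (Re (M_fun a b c (horocyclic_seq n)))) \<longlonglongrightarrow> m"
        by (rule filterlim_compose[OF lim horocyclic_seq(3)])
      ultimately have "(\<lambda>n. ereal (Re (M_fun a b c (horocyclic_seq n))) +
          ereal (2 - a - b + (a * b - k) * Re (1 / (1 - horocyclic_seq n)))) \<longlonglongrightarrow> m + ereal ((5 - c - a - b) / 2)"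
        by (intro tendsto_add_ereal_general1) auto
      thus "(\<lambda>n. ereal (Re (T' (horocyclic_seq n)))) \<longlonglongrightarrow> ereal ((5 - c - a - b) / 2) + m"
        by (simp add: ReT' add.commute)
    qed (use horocyclic_seq(1) T in \<open>auto simp: T'_def\<close>)
    have finite_case: ?thesis
      if lim: "((\<lambda>z. of_real k * h z - of_real q * ((1 - z) * h z)) \<longlongrightarrow> complex_of_real r) (at 1 within ball 0 1)"
        and lower: "\<And>z. norm z < 1 \<Longrightarrow> r \<le> k * Re (h z)" for r
    proof (intro exI[of _ "ereal r"] conjI main)
      have lim': "(M_fun a b c \<longlongrightarrow> of_real r) (at 1 within ball 0 1)"
        by (rule Lim_transform_eventually[OF lim evM])
      thus "has_ext_limit_at_one (M_fun a b c) (ereal r)" by (auto simp: has_ext_limit_at_one_def)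
      from tendsto_Re[OF lim'] show "((\<lambda>z. ereal (Re (M_fun a b c z))) \<longlongrightarrow> ereal r) (at 1 within ball 0 1)" by simp
      fix z :: complex assume z: "norm z < 1"
      have "q * Re ((1 - z) * h z) \<le> 0"
        using q0 wall_class_dual_Re_bounds(2)[OF h z] by (rule mult_nonpos_nonneg)
      thus "ereal r \<le> ereal (Re (M_fun a b c z))"
        using lower[OF z] unfolding ReM[OF mem_slit_plane_if_norm_less_1[OF z]] ereal_less_eq by linarith
    qed
    consider "k = 0" | B where "k < 0" "\<And>x. 0 \<le> x \<Longrightarrow> x < 1 \<Longrightarrow> Re (h (of_real x)) \<le> B"
      | "k < 0" "\<And>B. \<exists>x\<ge>0. x < 1 \<and> Re (h (of_real x)) > B"
      using k0 by (metis le_less linorder_not_less)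
    thus ?thesis
    proof cases
      case 1
      have "((\<lambda>z. - (of_real q * ((1 - z) * h z))) \<longlongrightarrow> - (of_real q * 0)) (at 1 within ball 0 1)"
        by (rule tendsto_minus[OF tendsto_mult_left[OF dual0]])
      thus ?thesis using 1 by (intro finite_case[of 0]) simp_all
    next
      case 2
      obtain L where L: "(h \<longlongrightarrow> of_real L) (at 1 within ball 0 1)" "\<And>x. 0 \<le> x \<Longrightarrow> x < 1 \<Longrightarrow> Re (h (of_real x)) \<le> L"
        using wall_class_tendsto_finite[OF h 2(2)] by blast
      have "((\<lambda>z. of_real k * h z - of_real q * ((1 - z) * h z)) \<longlongrightarrow> of_real k * of_real L - of_real q * 0) (at 1 within ball 0 1)"
        by (intro tendsto_intros L dual0)
      moreover have "k * L \<le> k * Re (h z)" if z: "norm z < 1" for z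
      proof -
        have "Re (h z) \<le> norm (h z)" by (rule complex_Re_le_cmod)
        also have "\<dots> \<le> Re (h (of_real (norm z)))" by (rule wall_class_norm_le_norm[OF h z])
        also have "\<dots> \<le> L" using z by (intro L) auto
        finally show ?thesis using 2(1) by (intro mult_left_mono_neg) auto
      qed
      ultimately show ?thesis by (intro finite_case[of "k * L"]) auto
    next
      case 3
      have top: "filterlim (\<lambda>z. Re (h z)) at_top (at 1 within ball 0 1)"
        by (rule wall_class_tendsto_infinite[OF h lim0 3(2)])
      have q_lim: "((\<lambda>z. q * Re ((1 - z) * h z)) \<longlongrightarrow> q * Re 0) (at 1 within ball 0 1)"
        by (intro tendsto_intros dual0)
      have "filterlim (\<lambda>z. - k * Re (h z)) at_top (at 1 within ball 0 1)"
        using 3(1) by (intro filterlim_tendsto_pos_mult_at_top[OF tendsto_const _ top]) simp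
      from filterlim_tendsto_add_at_top[OF q_lim this]
      have "filterlim (\<lambda>z. q * Re ((1 - z) * h z) + (- k * Re (h z))) at_top (at 1 within ball 0 1)" .
      moreover have "eventually (\<lambda>z. q * Re ((1 - z) * h z) + (- k * Re (h z)) = - Re (M_fun a b c z)) (at 1 within ball 0 1)"
        using eventually_near_one[OF zero_less_one]
        by eventually_elim (simp add: ReM mem_slit_plane_if_norm_less_1 del: times_complex.sel)
      ultimately have neg_top: "filterlim (\<lambda>z. - Re (M_fun a b c z)) at_top (at 1 within ball 0 1)"
        by (rule filterlim_cong[OF refl refl, THEN iffD1, rotated])
      hence "filterlim (\<lambda>z. Re (M_fun a b c z)) at_bot (at 1 within ball 0 1)"
        by (simp add: filterlim_uminus_at_top)
      hence lim: "((\<lambda>z. ereal (Re (M_fun a b c z))) \<longlongrightarrow> -\<infinity>) (at 1 within ball 0 1)"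
        unfolding tendsto_MInfty filterlim_at_bot_dense by auto
      have "- Re w \<le> norm w" for w :: complex using abs_Re_le_cmod[of w] by linarith
      hence "filterlim (\<lambda>z. norm (M_fun a b c z)) at_top (at 1 within ball 0 1)"
        by (intro filterlim_at_top_mono[OF neg_top] always_eventually) blast
      hence inf: "filterlim (M_fun a b c) at_infinity (at 1 within ball 0 1)"
        by (rule filterlim_norm_at_top_imp_at_infinity)
      have "filterlim complex_of_real (at 1 within ball 0 1) (at_left 1)"
        unfolding filterlim_at
      proof
        show "eventually (\<lambda>x. complex_of_real x \<in> ball 0 1 \<and> complex_of_real x \<noteq> 1) (at_left 1)"
          unfolding eventually_at_left_field by (intro exI[of _ 0]) auto
        show "(complex_of_real \<longlongrightarrow> 1) (at_left 1)"
          using tendsto_of_real[OF tendsto_ident_at, of 1 "{..<1}"] by simp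
      qed
      hence "((\<lambda>x. ereal (Re (M_fun a b c (of_real x)))) \<longlongrightarrow> -\<infinity>) (at_left 1)"
        by (rule filterlim_compose[OF lim])
      hence "has_ext_limit_at_one (M_fun a b c) (-\<infinity>)" using inf by (simp add: has_ext_limit_at_one_def)
      thus ?thesis using main[OF lim] by (intro exI[of _ "-\<infinity>"]) auto
    qed
  qed
  ultimately show ?thesis unfolding k_def f_def by blast
qed

end
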